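(* Let $F\in\mathcal{S}^{\sharp}$. For every non-negative integer $k$, \[ N(T;F_k)=\frac{d_F}{2\pi}T\log T+c_FT+O_k(\log T), \] where $c_F$ depends only on $F$. Here $N(T;F_k)$ is the number of zeros, counted with multiplicity, of $F_k(s)$ in the rectangle $\{s=\sigma+it \mid 1-\sigma_{F,k}<\sigma<\sigma_{F,k},\ 0<t<T\}$, with $\sigma_{F,k}$ a sufficiently large positive number.
   Context: Write $s=\sigma+it$. The extended Selberg class $\mathcal{S}^{\sharp}$ is the set of functions $F$ such that: (S1) $F(s)=\sum_{n\ge1}a_F(n)n^{-s}$, absolutely convergent for $\sigma>1$, with $a_F(1)=1$; (S2) there is an integer $m\ge0$ such that $(s-1)^mF(s)$ extends to an entire function of finite order; the smallest such $m$ is denoted $m_F$; (S3) there exist an integer $r\ge0$, real numbers $Q>0$, $\lambda_j>0$, complex numbers $\mu_j$ with $\Re\mu_j\ge0$ $(1\le j\le r)$ and $\omega\in\mathbb{C}$ with $|\omega|=1$ such that, with the gamma factor $\gamma(s)=Q^s\prod_{j=1}^r\Gamma(\lambda_js+\mu_j)$, the function $\xi_F(s)=s^{m_F}(s-1)^{m_F}\gamma(s)F(s)$ satisfies $\xi_F(s)=\omega\overline{\xi_F(1-\overline{s})}$. The degree of $F$ is $d_F=2\sum_{j=1}^r\lambda_j$ (it depends only on $F$). Put $H(s)=\omega\overline{\gamma(1-\overline{s})}/\gamma(s)$ and $\psi_F(s)=H'(s)/H(s)$. The meromorphic functions $F_k$ are defined by $F_0=F$ and $F_{k+1}(s)=F_k'(s)-\tfrac12\psi_F(s)F_k(s)$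 for $k\ge0$. The subscript $k$ in $O_k$ means that the implied constant depends on $k$. *)

theory Defs
  imports "HOL-Complex_Analysis.Complex_Analysis" "HOL-Library.Landau_Symbols"
begin

text \<open>
  A meromorphic function on the plane is represented by a function of type
  \<^typ>\<open>complex \<Rightarrow> complex\<close> whose values at a closed discrete set of points (poles, removable
  singularities of an expression) carry no meaning.  Identities of meromorphic functions are
  therefore stated off a sparse set, and zeros and multiplicities are read off from the behaviour
  in punctured neighbourhoods.
\<close>

definition finite_order :: "(complex \<Rightarrow> complex) \<Rightarrow> bool" where
  "finite_order g \<longleftrightarrow> (\<exists>A. \<forall>\<^sub>F s in at_infinity. norm (g s) \<le> exp (norm s powr A))"

definition dirichlet_axiom :: "(complex \<Rightarrow> complex) \<Rightarrow> bool" where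
  "dirichlet_axiom F \<longleftrightarrow> (\<exists>a :: nat \<Rightarrow> complex. a 1 = 1 \<and>
     (\<forall>s. Re s > 1 \<longrightarrow>
        summable (\<lambda>n. norm (a (Suc n) * of_nat (Suc n) powr (- s))) \<and>
        (\<lambda>n. a (Suc n) * of_nat (Suc n) powr (- s)) sums F s))"

text \<open>The value \<open>F 1\<close> is unconstrained: it is meaningless at a pole, and immaterial otherwise.\<close>

definition continuation_exponent :: "(complex \<Rightarrow> complex) \<Rightarrow> nat \<Rightarrow> bool" where
  "continuation_exponent F m \<longleftrightarrow> (\<exists>G. G holomorphic_on UNIV \<and> finite_order G \<and>
     (\<forall>s. s \<noteq> 1 \<longrightarrow> G s = (s - 1) ^ m * F s))"

definition m_exponent :: "(complex \<Rightarrow> complex) \<Rightarrow> nat" where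
  "m_exponent F = (LEAST m. continuation_exponent F m)"

definition gamma_factor ::
    "nat \<Rightarrow> real \<Rightarrow> (nat \<Rightarrow> real) \<Rightarrow> (nat \<Rightarrow> complex) \<Rightarrow> complex \<Rightarrow> complex" where
  "gamma_factor r Q lam mu s =
     of_real Q powr s * (\<Prod>j=1..r. Gamma (of_real (lam j) * s + mu j))"

definition xi_fun ::
    "(complex \<Rightarrow> complex) \<Rightarrow> nat \<Rightarrow> real \<Rightarrow> (nat \<Rightarrow> real) \<Rightarrow> (nat \<Rightarrow> complex) \<Rightarrow> complex \<Rightarrow> complex" where
  "xi_fun F r Q lam mu s =
     s ^ m_exponent F * (s - 1) ^ m_exponent F * gamma_factor r Q lam mu s * F s"

text \<open>
  The exceptional sparse set is needed since \<^const>\<open>Gamma\<close> is \<open>0\<close> by convention at its poles, so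
  that the product fails to have the right value where a pole of a gamma factor meets a zero
  of \<open>F\<close>.
\<close>

definition functional_equation ::
    "(complex \<Rightarrow> complex) \<Rightarrow> nat \<Rightarrow> real \<Rightarrow> (nat \<Rightarrow> real) \<Rightarrow> (nat \<Rightarrow> complex) \<Rightarrow> complex \<Rightarrow> bool" where
  "functional_equation F r Q lam mu \<omega> \<longleftrightarrow>
     Q > 0 \<and> (\<forall>j\<in>{1..r}. lam j > 0 \<and> Re (mu j) \<ge> 0) \<and> norm \<omega> = 1 \<and>
     (\<forall>\<^sub>\<approx>s\<in>UNIV. xi_fun F r Q lam mu s = \<omega> * cnj (xi_fun F r Q lam mu (1 - cnj s)))"

definition extended_Selberg_class :: "(complex \<Rightarrow> complex) set" where
  "extended_Selberg_class = {F. dirichlet_axiom F \<and> (\<exists>m. continuation_exponent F m) \<and>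
     (\<exists>r Q lam mu \<omega>. functional_equation F r Q lam mu \<omega>)}"

definition gamma_degree :: "nat \<Rightarrow> (nat \<Rightarrow> real) \<Rightarrow> real" where
  "gamma_degree r lam = 2 * (\<Sum>j=1..r. lam j)"

definition H_fun ::
    "nat \<Rightarrow> real \<Rightarrow> (nat \<Rightarrow> real) \<Rightarrow> (nat \<Rightarrow> complex) \<Rightarrow> complex \<Rightarrow> complex \<Rightarrow> complex" where
  "H_fun r Q lam mu \<omega> s =
     \<omega> * cnj (gamma_factor r Q lam mu (1 - cnj s)) / gamma_factor r Q lam mu s"

definition psi_fun ::
    "nat \<Rightarrow> real \<Rightarrow> (nat \<Rightarrow> real) \<Rightarrow> (nat \<Rightarrow> complex) \<Rightarrow> complex \<Rightarrow> complex \<Rightarrow> complex" where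
  "psi_fun r Q lam mu \<omega> s = deriv (H_fun r Q lam mu \<omega>) s / H_fun r Q lam mu \<omega> s"

primrec F_iter ::
    "(complex \<Rightarrow> complex) \<Rightarrow> (complex \<Rightarrow> complex) \<Rightarrow> nat \<Rightarrow> complex \<Rightarrow> complex" where
  "F_iter \<psi> F 0 = F"
| "F_iter \<psi> F (Suc k) = (\<lambda>s. deriv (F_iter \<psi> F k) s - 1/2 * \<psi> s * F_iter \<psi> F k s)"

text \<open>
  A zero of a meromorphic \<open>f\<close> is a point at which \<open>f\<close> tends to \<open>0\<close>; its multiplicity is
  \<^const>\<open>zorder\<close>.  If \<open>f\<close> is meromorphic and not identically zero, the zeros in the bounded
  rectangle form a finite set.  For \<open>f\<close> identically zero the sum over the infinite zero set is \<open>0\<close>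
  by convention; within the extended Selberg class this concerns only \<open>F = 1\<close> with \<open>k \<ge> 1\<close>.
\<close>

definition zero_count :: "(complex \<Rightarrow> complex) \<Rightarrow> real \<Rightarrow> real \<Rightarrow> nat" where
  "zero_count f \<sigma> T =
     (\<Sum>\<rho> | 1 - \<sigma> < Re \<rho> \<and> Re \<rho> < \<sigma> \<and> 0 < Im \<rho> \<and> Im \<rho> < T \<and> (f \<longlongrightarrow> 0) (at \<rho>).
        nat (zorder f \<rho>))"

end

theory Submission
  imports Defs "HOL-Real_Asymp.Real_Asymp"
begin

text \<open>
  The functions \<open>F\<^sub>k\<close> inherit from \<open>F\<close> the functional equation
  \<open>F\<^sub>k(s) = (-1)\<^sup>k H(s) cnj (F\<^sub>k(1 - cnj s))\<close>. In vertical strips \<open>\<psi>(s) = -(d log t + C\<^sub>0) + O(1/t)\<close> by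
  the asymptotics of the digamma function, so far to the right \<open>F\<^sub>k / (-\<psi>/2)\<^sup>k\<close> is close to \<open>1\<close> and the
  argument of \<open>F\<^sub>k\<close> stays bounded there. The argument principle on a rectangle symmetric about the critical
  line then counts the zeros: the left side contributes, through the functional equation, the variation of
  \<open>arg H\<close>, which is \<open>-(d (T log T - T) + C\<^sub>0 T) + O(log T)\<close>; the horizontal sides contribute \<open>O(log T)\<close>
  since \<open>F\<^sub>k\<close> has polynomial growth (Phragmen--Lindelof). Comparing two functional equations at \<open>k = 0\<close> shows
  that the constant depends on \<open>F\<close> only. The exceptional case of a constant \<open>H\<close> forces \<open>F = 1\<close>.
\<close>

section \<open>The digamma function in the upper half-plane\<close>

text \<open>The asymptotics of \<open>\<psi>\<close> is established only in strips of bounded real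
  part, so for k \<ge> 1 the comparison of \<open>F_k\<close> with a power of
  \<open>-\<psi>/2\<close> is available only there. This dictates the order of choices: first the
  abscissa \<open>\<sigma>\<close>, then a height \<open>T1\<close> depending on it; the finitely
  many zeros up to \<open>T1\<close> are absorbed by the error term. Only the logarithmic derivative
  of the gamma factor is estimated, never Gamma itself. The modulus of \<open>H\<close> is recovered
  by integrating from the critical line, where it is 1, and the argument of \<open>H\<close> is
  obtained up to a constant, which an error of size log T tolerates. Dividing by
  \<open>\<psi>\<close> requires it to stay away from 0 at large height. For d > 0 it grows like log
  t. For d = 0 there are no gamma factors, \<open>H\<close> is \<omega> times the power of Q with
  exponent 1 - 2s, and \<open>\<psi>\<close> is the constant -2 ln Q, which vanishes only for Q = 1.
  This is the single degenerate case, and it is treated apart.\<close>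

lemma Ln_diff_bound:
  assumes "0 < y" "y \<le> Im w" "y \<le> Im z"
  shows "norm (Ln w - Ln z) \<le> norm (w - z) / y"
proof -
  have "norm (Ln w - Ln z) \<le> 1 / y * norm (w - z)"
  proof (rule field_differentiable_bound)
    show "convex {u. y \<le> Im u}" by (rule convex_halfspace_Im_ge)
    fix u assume u: "u \<in> {u. y \<le> Im u}"
    then have "u \<notin> \<real>\<^sub>\<le>\<^sub>0" using assms by (auto simp: complex_nonpos_Reals_iff)
    then show "(Ln has_field_derivative inverse u) (at u within {u. y \<le> Im u})"
      by (rule has_field_derivative_at_within[OF has_field_derivative_Ln])
    have "y \<le> norm u" using u abs_Im_le_cmod[of u] by auto
    then show "norm (inverse u) \<le> 1 / y"
      using assms by (simp add: norm_inverse inverse_eq_divide[symmetric] le_imp_inverse_le)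
  qed (use assms in auto)
  then show ?thesis by simp
qed

text \<open>The increment of \<open>Ln u - u / z\<close> from \<open>z\<close> to
  \<open>z + 1\<close> is exactly the quantity to bound, while the derivative
  \<open>1 / u - 1 / z = - v / (u * z)\<close> is already of second order. On the segment |z| \<le>
  2|u|, which gives the factor 2.\<close>

lemma Ln_plus1_bound:
  assumes "1 \<le> Im z"
  shows "norm (Ln (z + 1) - Ln z - inverse z) \<le> 2 / (norm z)\<^sup>2"
proof -
  define f where "f = (\<lambda>u. Ln u - u / z)"
  have z0: "norm z \<ge> 1" using assms abs_Im_le_cmod[of z] by linarith
  then have zn: "z \<noteq> 0" by auto
  have "norm (f (z + 1) - f z) \<le> 2 / (norm z)\<^sup>2 * norm ((z + 1) - z)"
  proof (rule field_differentiable_bound)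
    show "convex (closed_segment z (z+1))" by simp
    fix u assume "u \<in> closed_segment z (z+1)"
    then obtain v where v: "0 \<le> v" "v \<le> 1" "u = z + of_real v"
      by (auto simp: in_segment algebra_simps scaleR_conv_of_real)
    have u1: "Im u \<ge> 1" using v assms by simp
    then have un: "norm u \<ge> 1" using abs_Im_le_cmod[of u] by linarith
    then have u0: "u \<noteq> 0" by auto
    have "u \<notin> \<real>\<^sub>\<le>\<^sub>0" using u1 by (auto simp: complex_nonpos_Reals_iff)
    then show "(f has_field_derivative (inverse u - 1 / z)) (at u within closed_segment z (z+1))"
      unfolding f_def using zn u0 by (auto intro!: derivative_eq_intros simp: field_simps)
    have e: "inverse u - 1 / z = - of_real v / (u * z)"
      using u0 zn v(3) by (simp add: field_simps)
    have "norm z \<le> norm u + norm (of_real v :: complex)"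
      using norm_triangle_ineq4[of u "of_real v"] v(3) by simp
    then have "norm z \<le> norm u + 1" using v by simp
    then have "norm z \<le> 2 * norm u" using un by simp
    then have "(norm z)\<^sup>2 \<le> 2 * (norm u * norm z)"
      using mult_right_mono[of "norm z" "2 * norm u" "norm z"] by (simp add: power2_eq_square)
    moreover have le: "norm (inverse u - 1 / z) \<le> 1 / (norm u * norm z)"
      unfolding e using v z0 un by (simp add: norm_divide norm_mult divide_right_mono)
    moreover have "norm u * norm z > 0" using u0 zn by simp
    moreover have "(norm z)\<^sup>2 > 0" using zn by simp
    ultimately have "1 / (norm u * norm z) \<le> 2 / (norm z)\<^sup>2"
      by (simp only: divide_le_eq pos_le_divide_eq) (simp add: field_simps)
    with le show "norm (inverse u - 1 / z) \<le> 2 / (norm z)\<^sup>2" by linarith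
  qed auto
  moreover have "f (z + 1) - f z = Ln (z + 1) - Ln z - inverse z"
    using zn by (simp add: f_def add_divide_distrib inverse_eq_divide)
  ultimately show ?thesis by simp
qed

text \<open>The sum of 1/|z+n|^2 over n has to be O(1/Im z) without any restriction on Re z.
  Dominating each term by an increment of arctan (mean value theorem) makes the sum telescope, and
  the total variation of arctan is only pi.\<close>

lemma inverse_sq_le_arctan_diff:
  fixes x y :: real
  assumes "1 \<le> y"
  shows "1 / (x\<^sup>2 + y\<^sup>2) \<le> 4 / y * (arctan ((x + 1) / y) - arctan (x / y))"
proof -
  have "\<exists>\<xi>>x. \<xi> < x + 1 \<and> arctan ((x + 1) / y) - arctan (x / y) = (x + 1 - x) * (y / (\<xi>\<^sup>2 + y\<^sup>2))"
  proof (rule MVT2)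
    fix u :: real
    have "y\<^sup>2 > 0" using assms by simp
    then have "y\<^sup>2 + u\<^sup>2 > 0" by (simp add: add_pos_nonneg)
    then show "((\<lambda>u. arctan (u / y)) has_real_derivative y / (u\<^sup>2 + y\<^sup>2)) (at u)"
      using assms by (auto intro!: derivative_eq_intros simp: field_simps power2_eq_square)
  qed simp
  then obtain \<xi> where \<xi>: "x < \<xi>" "\<xi> < x + 1"
    "arctan ((x + 1) / y) - arctan (x / y) = y / (\<xi>\<^sup>2 + y\<^sup>2)" by auto
  have "\<bar>\<xi>\<bar> \<le> \<bar>x\<bar> + 1" using \<xi> by linarith
  then have "\<xi>\<^sup>2 \<le> (\<bar>x\<bar> + 1)\<^sup>2" by (metis abs_ge_zero power2_abs power_mono)
  also have "\<dots> \<le> 2 * x\<^sup>2 + 2" using sum_squares_bound[of "\<bar>x\<bar>" 1] by (simp add: power2_eq_square algebra_simps)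
  also have "\<dots> \<le> 2 * x\<^sup>2 + 2 * y\<^sup>2" using assms by simp
  finally have "\<xi>\<^sup>2 + y\<^sup>2 \<le> 4 * (x\<^sup>2 + y\<^sup>2)"
    using zero_le_power2[of x] zero_le_power2[of y] unfolding distrib_left by linarith
  moreover have "y\<^sup>2 > 0" using assms by simp
  then have "\<xi>\<^sup>2 + y\<^sup>2 > 0" "x\<^sup>2 + y\<^sup>2 > 0" by (simp_all add: add_nonneg_pos)
  ultimately have "1 / (x\<^sup>2 + y\<^sup>2) \<le> 4 / (\<xi>\<^sup>2 + y\<^sup>2)"
    by (simp add: divide_simps)
  also have "\<dots> = 4 / y * (y / (\<xi>\<^sup>2 + y\<^sup>2))" using assms by simp
  finally show ?thesis using \<xi>(3) by simp
qed

text \<open>The partial sums defining \<^const>\<open>Digamma\<close> are compared with a telescoping sum of logarithms.\<close>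

lemma Digamma_minus_Ln_bound:
  assumes "1 \<le> Im z"
  shows "norm (Digamma z - Ln z) \<le> 8 * pi / Im z"
proof -
  define y where "y = Im z"
  have y: "1 \<le> y" using assms by (simp add: y_def)
  have z0: "z \<noteq> 0" using assms by auto
  define E where "E = (\<lambda>n. inverse (z + of_nat n) - (Ln (z + of_nat (Suc n)) - Ln (z + of_nat n)))"
  define a where "a = (\<lambda>n. arctan ((Re z + real n) / y))"
  have En: "norm (E n) \<le> 8 / y * (a (Suc n) - a n)" for n
  proof -
    have "norm (E n) = norm (Ln (z + of_nat n + 1) - Ln (z + of_nat n) - inverse (z + of_nat n))"
      unfolding E_def by (simp add: norm_minus_commute add_ac)
    also have "\<dots> \<le> 2 / (norm (z + of_nat n))\<^sup>2"
      using assms by (intro Ln_plus1_bound) simp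
    also have "\<dots> = 2 * (1 / ((Re z + real n)\<^sup>2 + y\<^sup>2))" by (simp add: cmod_power2 y_def)
    also have "\<dots> \<le> 2 * (4 / y * (arctan ((Re z + real n + 1) / y) - arctan ((Re z + real n) / y)))"
      using inverse_sq_le_arctan_diff[OF y] by (intro mult_left_mono) auto
    also have "\<dots> = 8 / y * (a (Suc n) - a n)" by (simp add: a_def add_ac)
    finally show ?thesis .
  qed
  have sumE: "(\<Sum>n<m. E n) = (\<Sum>n<m. inverse (z + of_nat n)) - (Ln (z + of_nat m) - Ln z)" for m
    by (induction m) (auto simp: E_def algebra_simps)
  have bound: "norm (\<Sum>n<m. E n) \<le> 8 * pi / y" for m
  proof -
    have "norm (\<Sum>n<m. E n) \<le> (\<Sum>n<m. 8 / y * (a (Suc n) - a n))"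
      by (rule sum_norm_le) (use En in auto)
    also have "\<dots> = 8 / y * (a m - a 0)"
      by (simp only: sum_distrib_left[symmetric] sum_lessThan_telescope)
    also have "a m - a 0 \<le> pi"
      using arctan_bounded[of "(Re z + real m)/y"] arctan_bounded[of "(Re z + real 0)/y"]
      by (simp add: a_def)
    finally show ?thesis using y by (simp add: mult_left_mono divide_right_mono)
  qed
  \<comment> \<open>\<open>Digamma\<close> is normalised by \<open>ln m\<close>, whereas the
    telescoped logarithms end in \<open>Ln (z + m)\<close>; in the limit the two may be
    exchanged.\<close>
  have lnlim: "(\<lambda>m. of_real (ln (real m)) - Ln (z + of_nat m)) \<longlonglongrightarrow> 0"
  proof -
    have "(\<lambda>m. z / of_nat m) \<longlonglongrightarrow> 0"
      by (rule tendsto_divide_0[OF tendsto_const tendsto_of_nat])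
    then have "(\<lambda>m. - Ln (1 + z / of_nat m)) \<longlonglongrightarrow> - Ln (1 + 0)"
      by (intro tendsto_intros) auto
    moreover have "\<forall>\<^sub>F m in sequentially. - Ln (1 + z / of_nat m) = of_real (ln (real m)) - Ln (z + of_nat m)"
    proof (rule eventually_sequentiallyI[of 1])
      fix m :: nat assume m: "1 \<le> m"
      have "z + of_nat m = of_real (real m) * (1 + z / of_nat m)" using m by (simp add: field_simps)
      also have "Ln \<dots> = of_real (ln (real m)) + Ln (1 + z / of_nat m)"
      proof -
        have "1 + z / of_nat m \<noteq> 0" using m assms by (auto simp: complex_eq_iff)
        then show ?thesis using Ln_times_of_real[of "real m" "1 + z / of_nat m"] m by (simp add: Ln_of_real)
      qed
      finally show "- Ln (1 + z / of_nat m) = of_real (ln (real m)) - Ln (z + of_nat m)" by simp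
    qed
    ultimately have "(\<lambda>m. of_real (ln (real m)) - Ln (z + of_nat m)) \<longlonglongrightarrow> - Ln (1 + 0)"
      by (rule Lim_transform_eventually)
    then show ?thesis by simp
  qed
  have "(\<lambda>m. (of_real (ln (real m)) - (\<Sum>n<m. inverse (z + of_nat n))) -
      (of_real (ln (real m)) - Ln (z + of_nat m)) - Ln z) \<longlonglongrightarrow> Digamma z - 0 - Ln z"
    by (intro tendsto_diff Digamma_LIMSEQ z0 lnlim tendsto_const)
  moreover have "(\<lambda>m. (of_real (ln (real m)) - (\<Sum>n<m. inverse (z + of_nat n))) -
      (of_real (ln (real m)) - Ln (z + of_nat m)) - Ln z) = (\<lambda>m. - (\<Sum>n<m. E n))"
    by (simp add: sumE fun_eq_iff)
  ultimately have "(\<lambda>m. - (\<Sum>n<m. E n)) \<longlonglongrightarrow> Digamma z - Ln z" by simp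
  then have "norm (Digamma z - Ln z) \<le> 8 * pi / y"
    by (rule Lim_norm_ubound[rotated]) (use bound in auto)
  then show ?thesis by (simp add: y_def)
qed

text \<open>The main term is \<open>Ln\<close> of the purely imaginary point
  \<open>\<i> * (l * Im s)\<close>, hence the exact imaginary part pi/2. In the strip
  \<open>l * s + m\<close> stays within bounded distance of that point, and \<open>Ln\<close> has
  derivative O(1/Im s) between them.\<close>

lemma Digamma_affine_strip:
  assumes "0 < l"
  shows "\<exists>C T. \<forall>s. \<bar>Re s\<bar> \<le> B \<longrightarrow> T \<le> Im s \<longrightarrow>
    norm (Digamma (of_real l * s + m) - (of_real (ln (Im s) + ln l) + \<i> * of_real (pi/2))) \<le> C / Im s"
proof -
  \<comment> \<open>Forces the imaginary part of \<open>l * s + m\<close> to be at least 1 and at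
    least \<open>l * Im s / 2\<close>, whatever the sign of \<open>Im m\<close>.\<close>
  define T where "T = 1 + 2 * (\<bar>Im m\<bar> + 1) / l"
  have T: "1 \<le> T" using assms by (simp add: T_def)
  define C where "C = 16 * pi / l + 2 * (l * \<bar>B\<bar> + norm m) / l"
  show ?thesis
  proof (intro exI allI impI)
    fix s :: complex assume s: "\<bar>Re s\<bar> \<le> B" "T \<le> Im s"
    have t: "Im s \<ge> 1" using s T by linarith
    have "2 * (\<bar>Im m\<bar> + 1) / l \<le> Im s" using s by (simp add: T_def)
    then have h: "2 * (\<bar>Im m\<bar> + 1) \<le> l * Im s" using assms by (simp add: field_simps)
    let ?z = "of_real l * s + m"
    have im: "Im ?z \<ge> l * Im s / 2" "Im ?z \<ge> 1"
      using h by (auto simp: abs_if split: if_splits)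
    have lp: "l * Im s / 2 > 0" using assms t by simp
    have "norm (Digamma ?z - Ln ?z) \<le> 8 * pi / Im ?z"
      by (rule Digamma_minus_Ln_bound) (use im in auto)
    also have "\<dots> \<le> 8 * pi / (l * Im s / 2)"
      using im lp by (intro divide_left_mono) auto
    finally have 1: "norm (Digamma ?z - Ln ?z) \<le> 16 * pi / l / Im s" by simp
    let ?w = "\<i> * of_real (l * Im s)"
    have "norm (Ln ?z - Ln ?w) \<le> norm (?z - ?w) / (l * Im s / 2)"
      using im lp by (intro Ln_diff_bound) auto
    also have "?z - ?w = of_real (l * Re s) + m" by (simp add: complex_eq_iff)
    also have "norm \<dots> \<le> l * \<bar>B\<bar> + norm m"
    proof -
      have "\<bar>l * Re s\<bar> \<le> l * \<bar>B\<bar>" using s assms by (simp add: abs_mult)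
      moreover have "norm (of_real (l * Re s) :: complex) = \<bar>l * Re s\<bar>" by (rule norm_of_real)
      ultimately show ?thesis using norm_triangle_ineq[of "of_real (l * Re s)" m] by linarith
    qed
    finally have "norm (Ln ?z - Ln ?w) \<le> (l * \<bar>B\<bar> + norm m) / (l * Im s / 2)"
      using lp by (simp add: divide_right_mono)
    then have 2: "norm (Ln ?z - Ln ?w) \<le> 2 * (l * \<bar>B\<bar> + norm m) / l / Im s"
      by (simp add: mult.commute)
    have "Ln ?w = Ln (of_real (l * Im s) * \<i>)" by (simp add: mult_ac)
    also have "\<dots> = of_real (ln (l * Im s)) + Ln \<i>"
      using Ln_times_of_real[of "l * Im s" \<i>] Ln_of_real[of "l * Im s"] lp
      by (simp del: of_real_mult)
    also have "\<dots> = of_real (ln (Im s) + ln l) + \<i> * of_real (pi/2)"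
      using assms t by (simp add: ln_mult)
    finally have 3: "Ln ?w = of_real (ln (Im s) + ln l) + \<i> * of_real (pi/2)" .
    have "norm (Digamma ?z - Ln ?w) \<le> norm (Digamma ?z - Ln ?z) + norm (Ln ?z - Ln ?w)"
      using norm_triangle_ineq[of "Digamma ?z - Ln ?z" "Ln ?z - Ln ?w"] by simp
    also have "\<dots> \<le> C / Im s" using 1 2 by (simp add: C_def add_divide_distrib)
    finally show "norm (Digamma ?z - (of_real (ln (Im s) + ln l) + \<i> * of_real (pi/2))) \<le> C / Im s"
      using 3 by simp
  qed
qed

section \<open>The Phragmen--Lindelof principle and the variation of the argument\<close>

text \<open>The damping factor is exp(-\<epsilon> w) with w = cos(\<delta>(z - c)). The choice
  \<delta> = 2/(b - a) keeps the real part of the argument of the cosine in [-1, 1], so Re w is at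
  least cos 1 > 0 times exp(\<delta> Im z)/2. This beats any growth of finite order on a high top
  edge, and the maximum principle applies on the truncated rectangle.\<close>

lemma phragmen_lindelof_half_strip:
  fixes f :: "complex \<Rightarrow> complex"
  assumes holo: "f holomorphic_on S" and "a < b" "0 < C"
    and sub: "\<And>s. a \<le> Re s \<Longrightarrow> Re s \<le> b \<Longrightarrow> t0 \<le> Im s \<Longrightarrow> s \<in> S"
    and bd: "\<And>s. a \<le> Re s \<Longrightarrow> Re s \<le> b \<Longrightarrow> t0 \<le> Im s \<Longrightarrow> Re s = a \<or> Re s = b \<or> Im s = t0 \<Longrightarrow>
      norm (f s) \<le> C"
    and growth: "\<And>s. a \<le> Re s \<Longrightarrow> Re s \<le> b \<Longrightarrow> t0 \<le> Im s \<Longrightarrow> R \<le> norm s \<Longrightarrow>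
      norm (f s) \<le> exp (norm s powr A)"
    and s: "a \<le> Re s" "Re s \<le> b" "t0 \<le> Im s"
  shows "norm (f s) \<le> C"
proof -
  define c where "c = (a + b) / 2"
  define \<delta> where "\<delta> = 2 / (b - a)"
  define A' where "A' = max A 1"
  define M where "M = \<bar>a\<bar> + \<bar>b\<bar> + 1"
  have \<delta>: "\<delta> > 0" using \<open>a < b\<close> by (simp add: \<delta>_def)
  define w :: "complex \<Rightarrow> complex" where "w = (\<lambda>z. cos (of_real \<delta> * (z - of_real c)))"
  have cos1: "cos (1::real) > 0" using cos_gt_zero_pi[of 1] pi_gt3 by simp
  have Rew: "Re (w z) \<ge> cos 1 * (exp (\<delta> * Im z) / 2)" if "a \<le> Re z" "Re z \<le> b" for z
  proof -
    have "\<bar>Re z - c\<bar> \<le> (b - a) / 2" using that by (auto simp: c_def abs_if field_simps)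
    then have "\<delta> * \<bar>Re z - c\<bar> \<le> \<delta> * ((b - a) / 2)" using \<delta> by (intro mult_left_mono) auto
    also have "\<dots> = 1" using \<open>a < b\<close> by (simp add: \<delta>_def)
    finally have "\<bar>\<delta> * (Re z - c)\<bar> \<le> 1" using \<delta> by (simp add: abs_mult)
    then have "cos 1 \<le> cos \<bar>\<delta> * (Re z - c)\<bar>" using pi_gt3 by (intro cos_monotone_0_pi_le) auto
    then have 1: "cos 1 \<le> cos (\<delta> * (Re z - c))" by simp
    have "Re (w z) = cos (\<delta> * (Re z - c)) * ((exp (\<delta> * Im z) + exp (- (\<delta> * Im z))) / 2)"
      by (simp add: w_def Re_cos)
    also have "\<dots> \<ge> cos 1 * (exp (\<delta> * Im z) / 2)"
      using 1 cos1 by (intro mult_mono) auto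
    finally show ?thesis .
  qed
  have key: "norm (f s) * exp (- \<epsilon> * Re (w s)) \<le> C" if \<epsilon>: "\<epsilon> > 0" for \<epsilon>
  proof -
    have "filterlim (\<lambda>Y::real. (M + Y) powr A' - \<epsilon> * cos 1 / 2 * exp (\<delta> * Y)) at_bot at_top"
    proof -
      have "M > 0" "A' > 0" "\<epsilon> * cos 1 / 2 > 0" using \<epsilon> cos1 by (auto simp: M_def A'_def)
      then show ?thesis using \<delta> by real_asymp
    qed
    then have "\<forall>\<^sub>F Y in at_top. (M + Y) powr A' - \<epsilon> * cos 1 / 2 * exp (\<delta> * Y) \<le> ln C"
      by (simp add: filterlim_at_bot)
    moreover have "\<forall>\<^sub>F Y in at_top. Y \<ge> max (max R 1) (Im s)" by (rule eventually_ge_at_top)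
    ultimately have "\<forall>\<^sub>F Y in at_top. (M + Y) powr A' - \<epsilon> * cos 1 / 2 * exp (\<delta> * Y) \<le> ln C
        \<and> Y \<ge> max (max R 1) (Im s)" by (rule eventually_conj)
    then obtain Y where Y: "(M + Y) powr A' - \<epsilon> * cos 1 / 2 * exp (\<delta> * Y) \<le> ln C"
        "Y \<ge> R" "Y \<ge> 1" "Y \<ge> Im s"
      by (auto dest!: eventually_happens)
    define g where "g = (\<lambda>z. f z * exp (- of_real \<epsilon> * w z))"
    have ng: "norm (g z) = norm (f z) * exp (- \<epsilon> * Re (w z))" for z
      by (simp add: g_def norm_mult)
    let ?K = "cbox (Complex a t0) (Complex b Y)"
    have KS: "?K \<subseteq> S" using sub by (auto simp: in_cbox_complex_iff)
    have gh: "g holomorphic_on ?K"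
      unfolding g_def w_def by (intro holomorphic_intros holomorphic_on_subset[OF holo KS])
    have "norm (g s) \<le> C"
    proof (rule maximum_modulus_frontier[of g ?K])
      show "g holomorphic_on interior ?K" by (rule holomorphic_on_subset[OF gh interior_subset])
      show "continuous_on (closure ?K) g" using gh by (simp add: holomorphic_on_imp_continuous_on)
      show "s \<in> ?K" using s Y by (simp add: in_cbox_complex_iff)
      fix z assume "z \<in> frontier ?K"
      then have "z \<in> ?K" "z \<notin> box (Complex a t0) (Complex b Y)"
        by (auto simp: frontier_def)
      then have z: "a \<le> Re z" "Re z \<le> b" "t0 \<le> Im z" "Im z \<le> Y"
        and zf: "Re z = a \<or> Re z = b \<or> Im z = t0 \<or> Im z = Y"
        by (auto simp: in_cbox_complex_iff in_box_complex_iff)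
      have Rp: "Re (w z) \<ge> 0" by (rule order_trans[OF _ Rew[OF z(1,2)]]) (use cos1 in auto)
      show "norm (g z) \<le> C"
      proof (cases "Im z = Y")
        case False
        then have "norm (f z) \<le> C" using bd z zf by auto
        moreover have "exp (- \<epsilon> * Re (w z)) \<le> 1" using \<epsilon> Rp by simp
        ultimately show ?thesis unfolding ng
          using mult_mono[of "norm (f z)" C "exp (- \<epsilon> * Re (w z))" 1] \<open>0 < C\<close> by simp
      next
        case True
        have n1: "norm z \<ge> Y" using abs_Im_le_cmod[of z] True by simp
        have n2: "norm z \<le> M + Y" using cmod_le[of z] z True Y by (auto simp: M_def)
        have "norm z powr A \<le> norm z powr A'"
          using n1 Y by (intro powr_mono) (auto simp: A'_def)
        also have "\<dots> \<le> (M + Y) powr A'"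
          using n1 n2 Y by (intro powr_mono2) (auto simp: A'_def)
        finally have "norm (f z) \<le> exp ((M + Y) powr A')"
          using growth[OF z(1-3)] n1 Y by (meson exp_le_cancel_iff order_trans)
        moreover have "exp (- \<epsilon> * Re (w z)) \<le> exp (- (\<epsilon> * cos 1 / 2 * exp (\<delta> * Y)))"
          using mult_left_mono[OF Rew[OF z(1,2)], of \<epsilon>] \<epsilon> True by simp
        ultimately have "norm (g z) \<le> exp ((M + Y) powr A') * exp (- (\<epsilon> * cos 1 / 2 * exp (\<delta> * Y)))"
          unfolding ng by (intro mult_mono) auto
        also have "\<dots> = exp ((M + Y) powr A' - \<epsilon> * cos 1 / 2 * exp (\<delta> * Y))"
          unfolding exp_add[symmetric] by simp
        also have "\<dots> \<le> exp (ln C)" using Y by simp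
        also have "\<dots> = C" using \<open>0 < C\<close> by simp
        finally show ?thesis .
      qed
    qed auto
    then show ?thesis by (simp add: ng)
  qed
  \<comment> \<open>The point s is fixed and the bound holds for every \<epsilon> > 0, so the
    damping can be removed by letting \<epsilon> tend to 0.\<close>
  have "((\<lambda>\<epsilon>. norm (f s) * exp (- \<epsilon> * Re (w s))) \<longlongrightarrow> norm (f s) * exp (- 0 * Re (w s))) (at_right 0)"
    by (intro tendsto_intros)
  moreover have "\<forall>\<^sub>F \<epsilon> in at_right 0. norm (f s) * exp (- \<epsilon> * Re (w s)) \<le> C"
    using eventually_at_right_less[of 0] by eventually_elim (rule key)
  ultimately have "norm (f s) * exp (- 0 * Re (w s)) \<le> C"
    by (intro tendsto_upperbound) auto
  then show ?thesis by simp
qed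

section \<open>Variation of the argument along a segment, by dividing out zeros\<close>

lemma borel_caratheodory:
  fixes h :: "complex \<Rightarrow> complex"
  assumes h: "h holomorphic_on ball z0 r" and "h z0 = 0" "0 < r" "0 < A"
    and Re: "\<And>z. z \<in> ball z0 r \<Longrightarrow> Re (h z) < A" and z: "dist z0 z \<le> r / 2"
  shows "norm (h z) \<le> 2 * A"
proof -
  define k where "k = (\<lambda>w. h (z0 + of_real r * w))"
  \<comment> \<open>This Moebius map sends the half-plane Re < A into the unit disc and fixes 0.
    Schwarz at half the radius gives |k| \<le> |2A - k|/2, and solving for |k| gives the bound
    2A.\<close>
  define \<phi> where "\<phi> = (\<lambda>w. k w / (2 * of_real A - k w))"
  have inb: "z0 + of_real r * w \<in> ball z0 r" if "norm w < 1" for w :: complex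
    using that \<open>0 < r\<close> by (simp add: dist_norm norm_mult)
  have kh: "k holomorphic_on ball 0 1"
    unfolding k_def using inb
    by (intro holomorphic_on_compose_gen[OF _ h, unfolded o_def] holomorphic_intros) auto
  have lt: "norm (k w) < norm (2 * of_real A - k w)" if "norm w < 1" for w
  proof -
    have "Re (k w) < A" using Re[OF inb[OF that]] by (simp add: k_def)
    then have "0 < 4 * A * (A - Re (k w))" using \<open>0 < A\<close> by simp
    then have "(norm (k w))\<^sup>2 < (norm (2 * of_real A - k w))\<^sup>2"
      unfolding cmod_power2 by (simp add: power2_eq_square algebra_simps)
    then show ?thesis by (rule power_less_imp_less_base) simp
  qed
  define w where "w = (z - z0) / of_real r"
  have w: "norm w \<le> 1 / 2" using z \<open>0 < r\<close> by (simp add: w_def norm_divide dist_norm norm_minus_commute field_simps)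
  have "norm (\<phi> w) \<le> norm w"
  proof (rule Schwarz_Lemma)
    have "2 * of_real A - k w \<noteq> 0" if "norm w < 1" for w using lt[OF that] by auto
    then show "\<phi> holomorphic_on ball 0 1"
      unfolding \<phi>_def by (intro holomorphic_intros kh) auto
    show "\<phi> 0 = 0" by (simp add: \<phi>_def k_def \<open>h z0 = 0\<close>)
    show "norm (\<phi> u) < 1" if "norm u < 1" for u
      using lt[OF that] by (simp add: \<phi>_def norm_divide divide_less_eq)
    show "norm w < 1" using w by simp
  qed
  then have "norm (\<phi> w) \<le> 1 / 2" using w by linarith
  then have "norm (k w) / norm (2 * of_real A - k w) \<le> 1 / 2"
    unfolding \<phi>_def norm_divide .
  moreover have "norm (2 * of_real A - k w) > 0" 
  proof -
    have "norm w < 1" using w by linarith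
    from lt[OF this] show ?thesis using norm_ge_zero[of "k w"] by linarith
  qed
  ultimately have "2 * norm (k w) \<le> norm (2 * of_real A - k w)" by (simp add: field_simps)
  also have "\<dots> \<le> 2 * A + norm (k w)"
    using norm_triangle_ineq4[of "2 * of_real A" "k w"] \<open>0 < A\<close> by (simp add: norm_mult)
  finally have "norm (k w) \<le> 2 * A" by simp
  moreover have "k w = h z" using \<open>0 < r\<close> by (simp add: k_def w_def)
  ultimately show ?thesis by simp
qed

lemma holomorphic_divide_zero:
  assumes "f holomorphic_on S" "open S" "a \<in> S" "f a = 0"
  obtains g where "g holomorphic_on S" "\<And>z. z \<in> S \<Longrightarrow> f z = (z - a) * g z"
proof
  show "(\<lambda>z. if z = a then deriv f a else (f z - f a) / (z - a)) holomorphic_on S"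
    by (rule pole_lemma) (use assms in \<open>auto simp: interior_open\<close>)
qed (use assms in auto)

text \<open>Dividing out a zero in the disc of radius \<open>r\<close> gains a factor \<open>2\<close> in the growth bound on the
  disc of radius \<open>3 * r\<close>; this replaces Jensen's formula.\<close>

lemma factor_growth:
  assumes S: "open S" "cball z0 (3 * r) \<subseteq> S" "0 < r"
    and g: "g holomorphic_on S" and f0: "f z0 \<noteq> 0"
    and bound: "\<And>z. z \<in> cball z0 (3 * r) \<Longrightarrow> norm (f z) \<le> M * norm (f z0)"
    and fg: "\<And>z. z \<in> S \<Longrightarrow> f z = (\<Prod>\<rho>\<leftarrow>\<rho>s. z - \<rho>) * g z"
    and \<rho>s: "set \<rho>s \<subseteq> cball z0 r" and z: "z \<in> cball z0 (3 * r)"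
  shows "2 ^ length \<rho>s * norm (g z) \<le> M * norm (g z0)"
proof -
  let ?n = "length \<rho>s"
  have z0: "z0 \<in> S" using S by auto
  have M: "1 \<le> M" using bound[of z0] f0 S by simp
  \<comment> \<open>A zero in the inner disc is at distance at least 2r from the outer circle and at
    most r from the centre; this ratio is the factor 2 gained per zero.\<close>
  have low: "(2 * r) ^ length xs \<le> norm (\<Prod>\<rho>\<leftarrow>xs. u - \<rho>)"
    if "set xs \<subseteq> cball z0 r" "dist z0 u = 3 * r" for xs u
    using that(1)
  proof (induction xs)
    case (Cons x xs)
    have "dist z0 u \<le> dist z0 x + dist x u" by (rule dist_triangle)
    then have "2 * r \<le> norm (u - x)" using Cons.prems that by (simp add: dist_norm norm_minus_commute)
    then show ?case using Cons \<open>0 < r\<close> by (simp add: norm_mult mult_mono)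
  qed simp
  have up: "norm (\<Prod>\<rho>\<leftarrow>xs. z0 - \<rho>) \<le> r ^ length xs" if "set xs \<subseteq> cball z0 r" for xs
    using that
  proof (induction xs)
    case (Cons x xs)
    then show ?case using \<open>0 < r\<close> by (simp add: norm_mult mult_mono dist_norm)
  qed simp
  have "norm (f z0) \<le> r ^ ?n * norm (g z0)"
    unfolding fg[OF z0] norm_mult using up[OF \<rho>s] by (intro mult_right_mono) auto
  then have f0': "M * norm (f z0) \<le> M * (r ^ ?n * norm (g z0))" using M by simp
  have "norm (g z) \<le> M * norm (g z0) / 2 ^ ?n"
  proof (rule maximum_modulus_frontier[of g "cball z0 (3 * r)"])
    show "g holomorphic_on interior (cball z0 (3 * r))"
      using g S by (meson holomorphic_on_subset interior_subset)
    show "continuous_on (closure (cball z0 (3 * r))) g"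
      using g S by (simp add: holomorphic_on_imp_continuous_on holomorphic_on_subset)
    fix u assume "u \<in> frontier (cball z0 (3 * r))"
    then have u: "dist z0 u = 3 * r" using S by (simp add: frontier_cball sphere_def)
    then have uS: "u \<in> cball z0 (3 * r)" "u \<in> S" using S by auto
    have "(2 * r) ^ ?n * norm (g u) \<le> norm (f u)"
      unfolding fg[OF uS(2)] norm_mult using low[OF \<rho>s u] by (intro mult_right_mono) auto
    also have "\<dots> \<le> M * (r ^ ?n * norm (g z0))" using bound[OF uS(1)] f0' by simp
    finally have "r ^ ?n * (2 ^ ?n * norm (g u)) \<le> r ^ ?n * (M * norm (g z0))"
      by (simp add: power_mult_distrib mult_ac)
    then show "norm (g u) \<le> M * norm (g z0) / 2 ^ ?n"
      using \<open>0 < r\<close> by (simp add: field_simps)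
  qed (use z in auto)
  then show ?thesis by (simp add: field_simps)
qed

text \<open>Zeros of the inner disc are divided out one at a time. By \<open>factor_growth\<close>
  at the centre, n divided zeros force 2^n \<le> M, so the process stops, and it can only stop at a
  cofactor without zeros in that disc.\<close>

lemma factor_zeros_disc:
  assumes S: "open S" "cball z0 (3 * r) \<subseteq> S" "0 < r"
    and f: "f holomorphic_on S" and f0: "f z0 \<noteq> 0"
    and bound: "\<And>z. z \<in> cball z0 (3 * r) \<Longrightarrow> norm (f z) \<le> M * norm (f z0)"
  shows "\<exists>\<rho>s g. g holomorphic_on S \<and> (\<forall>z\<in>S. f z = (\<Prod>\<rho>\<leftarrow>\<rho>s. z - \<rho>) * g z) \<and>
    (\<forall>z\<in>cball z0 r. g z \<noteq> 0) \<and> 2 ^ length \<rho>s \<le> M \<and>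
    (\<forall>z\<in>cball z0 r. norm (g z) \<le> M * norm (g z0))"
proof -
  have z0: "z0 \<in> S" using S by auto
  have bound': "z0 \<in> cball z0 (3 * r)" using S by simp
  define fact where "fact = (\<lambda>\<rho>s g. g holomorphic_on S \<and> set \<rho>s \<subseteq> cball z0 r \<and>
    (\<forall>z\<in>S. f z = (\<Prod>\<rho>\<leftarrow>\<rho>s. z - \<rho>) * g z))"
  have growth: "2 ^ length \<rho>s * norm (g z) \<le> M * norm (g z0)"
    if "fact \<rho>s g" "z \<in> cball z0 (3 * r)" for \<rho>s g z
  proof (rule factor_growth[where f = f and S = S and r = r and g = g and z = z and ?z0.0 = z0])
    show "norm (f z) \<le> M * norm (f z0)" if "z \<in> cball z0 (3 * r)" for z by (rule bound[OF that])
  qed (use that S f0 in \<open>auto simp: fact_def\<close>)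
  have len: "2 ^ length \<rho>s \<le> M" if "fact \<rho>s g" for \<rho>s g
  proof -
    have "g z0 \<noteq> 0" using that f0 z0 by (auto simp: fact_def)
    then show ?thesis using growth[OF that bound'] by simp
  qed
  have step: "(\<exists>\<rho>s g. fact \<rho>s g \<and> length \<rho>s = n) \<or> (\<exists>\<rho>s g. fact \<rho>s g \<and> (\<forall>z\<in>cball z0 r. g z \<noteq> 0))" for n
  proof (induction n)
    case 0
    have "fact [] f" using f by (simp add: fact_def)
    then show ?case by (metis list.size(3))
  next
    case (Suc n)
    show ?case
    proof (cases "\<exists>\<rho>s g. fact \<rho>s g \<and> (\<forall>z\<in>cball z0 r. g z \<noteq> 0)")
      case False
      with Suc obtain \<rho>s g where g: "fact \<rho>s g" "length \<rho>s = n" by blast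
      with False obtain a where a: "a \<in> cball z0 r" "g a = 0" by blast
      then have "a \<in> S" using S by (auto simp: subset_eq)
      then obtain h where h: "h holomorphic_on S" "\<And>z. z \<in> S \<Longrightarrow> g z = (z - a) * h z"
        using holomorphic_divide_zero[of g S a] g a S by (auto simp: fact_def)
      have "fact (a # \<rho>s) h" using g h a by (auto simp: fact_def mult_ac)
      then show ?thesis using g by (metis length_Cons)
    qed simp
  qed
  obtain n where "M < 2 ^ n" using real_arch_pow[of 2 M] by auto
  then have "\<not> (\<exists>\<rho>s g. fact \<rho>s g \<and> length \<rho>s = n)" using len by (metis not_le)
  with step[of n] obtain \<rho>s g where g: "fact \<rho>s g" "\<forall>z\<in>cball z0 r. g z \<noteq> 0" by blast
  have "norm (g z) \<le> M * norm (g z0)" if "z \<in> cball z0 r" for z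
  proof -
    have "1 * norm (g z) \<le> 2 ^ length \<rho>s * norm (g z)" by (intro mult_right_mono) auto
    also have "\<dots> \<le> M * norm (g z0)" using growth[OF g(1)] that S by auto
    finally show ?thesis by simp
  qed
  then show ?thesis
    using g len[OF g(1)] unfolding fact_def by (intro exI[of _ \<rho>s] exI[of _ g]) simp
qed

text \<open>Seen from a point off it, a segment subtends an angle of at most pi: the real part of
  its winding number is below 1/2 in absolute value. So each linear factor contributes at most
  pi.\<close>

lemma arg_variation_prod_linear:
  assumes "\<And>\<rho>. \<rho> \<in> set \<rho>s \<Longrightarrow> \<rho> \<notin> closed_segment a b"
  obtains I where "((\<lambda>z. \<Sum>\<rho>\<leftarrow>\<rho>s. 1 / (z - \<rho>)) has_contour_integral I) (linepath a b)"
    "\<bar>Im I\<bar> \<le> pi * length \<rho>s"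
proof -
  have "\<exists>I. ((\<lambda>z. \<Sum>\<rho>\<leftarrow>\<rho>s. 1 / (z - \<rho>)) has_contour_integral I) (linepath a b) \<and> \<bar>Im I\<bar> \<le> pi * length \<rho>s"
    using assms
  proof (induction \<rho>s)
    case Nil
    show ?case by (intro exI[of _ 0]) (auto intro: has_contour_integral_0)
  next
    case (Cons \<rho> \<rho>s)
    then obtain I where I: "((\<lambda>z. \<Sum>\<rho>\<leftarrow>\<rho>s. 1 / (z - \<rho>)) has_contour_integral I) (linepath a b)"
      "\<bar>Im I\<bar> \<le> pi * length \<rho>s" by auto
    have \<rho>: "\<rho> \<notin> path_image (linepath a b)" using Cons.prems by simp
    let ?J = "2 * of_real pi * \<i> * winding_number (linepath a b) \<rho>"
    have J: "((\<lambda>z. 1 / (z - \<rho>)) has_contour_integral ?J) (linepath a b)"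
      using has_contour_integral_winding_number[OF _ \<rho>] by simp
    have "\<bar>Re (winding_number (linepath a b) \<rho>)\<bar> < 1 / 2"
      by (rule winding_number_lt_half_linepath) (use \<rho> in simp)
    then have "\<bar>Im ?J\<bar> \<le> pi" by (simp add: abs_mult)
    then have "\<bar>Im (?J + I)\<bar> \<le> pi * length (\<rho> # \<rho>s)"
      using I(2) by (simp add: algebra_simps)
    then show ?case using has_contour_integral_add[OF J I(1)] by auto
  qed
  then show ?thesis using that by blast
qed

lemma prod_linear_has_derivative:
  assumes "\<And>\<rho>. \<rho> \<in> set \<rho>s \<Longrightarrow> z \<noteq> \<rho>"
  shows "((\<lambda>z::complex. \<Prod>\<rho>\<leftarrow>\<rho>s. z - \<rho>) has_field_derivative
    (\<Sum>\<rho>\<leftarrow>\<rho>s. 1 / (z - \<rho>)) * (\<Prod>\<rho>\<leftarrow>\<rho>s. z - \<rho>)) (at z)"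
  using assms
proof (induction \<rho>s)
  case (Cons \<rho> \<rho>s)
  then have "z \<noteq> \<rho>" by simp
  let ?p = "\<lambda>z. \<Prod>\<rho>\<leftarrow>\<rho>s. z - \<rho>"
  have "((\<lambda>z. z - \<rho>) has_field_derivative 1) (at z)" by (auto intro!: derivative_eq_intros)
  from DERIV_mult[OF this Cons.IH]
  have "((\<lambda>z. (z - \<rho>) * ?p z) has_field_derivative
      1 * ?p z + (\<Sum>\<rho>\<leftarrow>\<rho>s. 1 / (z - \<rho>)) * ?p z * (z - \<rho>)) (at z)" using Cons.prems by simp
  moreover have "1 * ?p z + (\<Sum>\<rho>\<leftarrow>\<rho>s. 1 / (z - \<rho>)) * ?p z * (z - \<rho>) =
      (\<Sum>\<rho>\<leftarrow>\<rho> # \<rho>s. 1 / (z - \<rho>)) * (\<Prod>\<rho>\<leftarrow>\<rho> # \<rho>s. z - \<rho>)"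
  proof -
    have "1 * P + U * P * (z - \<rho>) = (1 / (z - \<rho>) + U) * ((z - \<rho>) * P)" for P U
      using \<open>z \<noteq> \<rho>\<close> by (simp add: field_simps)
    then show ?thesis by simp
  qed
  ultimately show ?case by simp
qed simp

text \<open>Write f as a product of linear factors times a cofactor g that is zero-free on the disc
  of radius r. There are at most log2 M factors, each costing pi. The cofactor is g(z0) exp(h) with
  Re h \<le> ln M on the disc, and Borel-Caratheodory turns this one-sided bound into |h| \<le> 2(ln
  M + 1) at half the radius, hence at both endpoints.\<close>

lemma arg_variation_segment:
  assumes S: "open S" "cball z0 (3 * r) \<subseteq> S" "0 < r"
    and f: "f holomorphic_on S" and f0: "f z0 \<noteq> 0"
    and bound: "\<And>z. z \<in> cball z0 (3 * r) \<Longrightarrow> norm (f z) \<le> M * norm (f z0)"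
    and ab: "a \<in> cball z0 (r / 2)" "b \<in> cball z0 (r / 2)"
    and nz: "\<And>z. z \<in> closed_segment a b \<Longrightarrow> f z \<noteq> 0"
  shows "\<bar>Im (contour_integral (linepath a b) (\<lambda>z. deriv f z / f z))\<bar> \<le> pi * log 2 M + 4 * (ln M + 1)"
proof -
  have bound': "\<forall>z\<in>cball z0 (3 * r). norm (f z) \<le> M * norm (f z0)" using bound by blast
  from factor_zeros_disc[OF S f f0 bspec[OF bound']] obtain \<rho>s g where g: "g holomorphic_on S" "\<And>z. z \<in> S \<Longrightarrow> f z = (\<Prod>\<rho>\<leftarrow>\<rho>s. z - \<rho>) * g z"
    "\<And>z. z \<in> cball z0 r \<Longrightarrow> g z \<noteq> 0" "2 ^ length \<rho>s \<le> M"
    "\<And>z. z \<in> cball z0 r \<Longrightarrow> norm (g z) \<le> M * norm (g z0)"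
    by blast
  have M: "1 \<le> M" using bound[of z0] f0 S by simp
  have bS: "ball z0 r \<subseteq> S" "ball z0 r \<subseteq> cball z0 r" using S by (auto simp: subset_eq)
  have g0: "g z0 \<noteq> 0" using g(3)[of z0] S by simp
  have seg: "closed_segment a b \<subseteq> cball z0 (r / 2)" using ab by (simp add: closed_segment_subset)
  also have "\<dots> \<subseteq> ball z0 r" using S by auto
  finally have segb: "closed_segment a b \<subseteq> ball z0 r" .
  have "\<exists>h. h holomorphic_on ball z0 r \<and> (\<forall>z\<in>ball z0 r. g z / g z0 = exp (h z))"
  proof -
    have "(\<lambda>z. g z / g z0) holomorphic_on ball z0 r"
      using g0 by (intro holomorphic_intros holomorphic_on_subset[OF g(1) bS(1)]) auto
    moreover have "g z / g z0 \<noteq> 0" if "z \<in> ball z0 r" for z using g(3) g0 that bS by auto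
    ultimately obtain h where "h holomorphic_on ball z0 r" "\<And>z. z \<in> ball z0 r \<Longrightarrow> exp (h z) = g z / g z0"
      using holomorphic_logarithm_exists[of "ball z0 r" "\<lambda>z. g z / g z0" z0] S
      by (metis centre_in_ball convex_ball open_ball)
    then show ?thesis by metis
  qed
  then obtain h0 where h0: "h0 holomorphic_on ball z0 r" "\<And>z. z \<in> ball z0 r \<Longrightarrow> g z / g z0 = exp (h0 z)" by auto
  define h where "h = (\<lambda>z. h0 z - h0 z0)"
  have hh: "h holomorphic_on ball z0 r" unfolding h_def by (intro holomorphic_intros h0)
  have "exp (h0 z0) = 1" using h0(2)[of z0] g0 S by simp
  then have he: "g z / g z0 = exp (h z)" if "z \<in> ball z0 r" for z
    using h0(2)[OF that] by (simp add: h_def exp_diff)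
  \<comment> \<open>The summand 1 makes the bound on Re h strict, and positive even when M =
    1.\<close>
  have hb: "norm (h z) \<le> 2 * (ln M + 1)" if "z \<in> cball z0 (r / 2)" for z
  proof (rule borel_caratheodory[OF hh])
    show "Re (h z) < ln M + 1" if z: "z \<in> ball z0 r" for z
    proof -
      have "exp (Re (h z)) = norm (g z) / norm (g z0)" using he[OF z] by (metis norm_divide norm_exp_eq_Re)
      also have "\<dots> \<le> M" using g(5)[of z] z bS g0 by (auto simp: divide_le_eq)
      also have "\<dots> = exp (ln M)" using M by simp
      finally show ?thesis by simp
    qed
    show "0 < ln M + 1" using ln_ge_zero[OF M] by linarith
  qed (use that S in \<open>auto simp: h_def\<close>)
  have hd: "(h has_field_derivative deriv g z / g z) (at z within closed_segment a b)"
    if z: "z \<in> closed_segment a b" for z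
  proof -
    have zb: "z \<in> ball z0 r" using z segb by auto
    have 1: "(h has_field_derivative deriv h z) (at z)"
      using hh zb by (meson holomorphic_derivI open_ball)
    have "((\<lambda>z. g z0 * exp (h z)) has_field_derivative g z0 * (exp (h z) * deriv h z)) (at z)"
      by (auto intro!: derivative_eq_intros 1)
    then have "(g has_field_derivative g z0 * (exp (h z) * deriv h z)) (at z)"
    proof (rule has_field_derivative_transform_within_open[OF _ open_ball zb])
      fix w assume "w \<in> ball z0 r"
      then show "g z0 * exp (h w) = g w" using he[of w] g0 by (simp add: field_simps)
    qed
    then have "deriv g z = g z0 * (exp (h z) * deriv h z)" by (rule DERIV_imp_deriv)
    then have "deriv g z / g z = deriv h z"
      using he[OF zb] g0 g(3)[of z] zb by (auto simp: field_simps)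
    then show ?thesis using 1 by (metis has_field_derivative_at_within)
  qed
  have I1: "((\<lambda>z. deriv g z / g z) has_contour_integral (h b - h a)) (linepath a b)"
    using contour_integral_primitive[OF hd, of "linepath a b"] by simp
  have nz\<rho>: "\<rho> \<notin> closed_segment a b" if "\<rho> \<in> set \<rho>s" for \<rho>
  proof
    assume "\<rho> \<in> closed_segment a b"
    then have "f \<rho> \<noteq> 0" "\<rho> \<in> S" using nz segb bS by auto
    moreover have "(\<Prod>x\<leftarrow>\<rho>s. \<rho> - x) = 0" using that by (induction \<rho>s) auto
    ultimately show False using g(2)[of \<rho>] by simp
  qed
  obtain I where I: "((\<lambda>z. \<Sum>\<rho>\<leftarrow>\<rho>s. 1 / (z - \<rho>)) has_contour_integral I) (linepath a b)"
    "\<bar>Im I\<bar> \<le> pi * length \<rho>s" using arg_variation_prod_linear[of \<rho>s a b] nz\<rho> by blast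
  have "((\<lambda>z. deriv f z / f z) has_contour_integral (I + (h b - h a))) (linepath a b)"
  proof (rule has_contour_integral_eq[OF has_contour_integral_add[OF I(1) I1]])
    fix z assume z: "z \<in> path_image (linepath a b)"
    then have zS: "z \<in> S" using segb bS by auto
    have fz: "f z \<noteq> 0" using nz z by simp
    let ?p = "\<lambda>z. \<Prod>\<rho>\<leftarrow>\<rho>s. z - \<rho>"
    have "(?p has_field_derivative (\<Sum>\<rho>\<leftarrow>\<rho>s. 1 / (z - \<rho>)) * ?p z) (at z)"
      by (rule prod_linear_has_derivative) (use nz\<rho> z in auto)
    moreover have "(g has_field_derivative deriv g z) (at z)"
      using g(1) S zS by (meson holomorphic_derivI)
    ultimately have "((\<lambda>z. ?p z * g z) has_field_derivative
        (\<Sum>\<rho>\<leftarrow>\<rho>s. 1 / (z - \<rho>)) * ?p z * g z + deriv g z * ?p z) (at z)"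
      by (rule DERIV_mult)
    then have "(f has_field_derivative
        (\<Sum>\<rho>\<leftarrow>\<rho>s. 1 / (z - \<rho>)) * ?p z * g z + deriv g z * ?p z) (at z)"
      by (rule has_field_derivative_transform_within_open[OF _ S(1) zS]) (use g(2) in auto)
    then have "deriv f z = (\<Sum>\<rho>\<leftarrow>\<rho>s. 1 / (z - \<rho>)) * ?p z * g z + deriv g z * ?p z"
      by (rule DERIV_imp_deriv)
    then show "(\<Sum>\<rho>\<leftarrow>\<rho>s. 1 / (z - \<rho>)) + deriv g z / g z = deriv f z / f z"
      using fz g(2)[OF zS] by (simp add: add_divide_distrib mult.assoc)
  qed
  then have eq: "contour_integral (linepath a b) (\<lambda>z. deriv f z / f z) = I + (h b - h a)"
    by (rule contour_integral_unique)
  have "\<bar>Im (h b - h a)\<bar> \<le> 4 * (ln M + 1)"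
    using abs_Im_le_cmod[of "h b"] abs_Im_le_cmod[of "h a"] hb[OF ab(1)] hb[OF ab(2)] by simp
  moreover have "real (length \<rho>s) \<le> log 2 M"
    using g(4) M by (simp add: le_log_iff powr_realpow)
  then have "pi * length \<rho>s \<le> pi * log 2 M" by (intro mult_left_mono) auto
  moreover have "\<bar>Im (I + (h b - h a))\<bar> \<le> \<bar>Im I\<bar> + \<bar>Im (h b - h a)\<bar>"
    unfolding plus_complex.sel by (rule abs_triangle_ineq)
  ultimately show ?thesis unfolding eq using I(2) by linarith
qed

section \<open>Functional equations on an upper half-plane\<close>

text \<open>The reflection \<open>s \<mapsto> 1 - cnj s\<close> is antiholomorphic, and the outer
  conjugation restores holomorphy. The minus sign comes from \<open>1 - w\<close>.\<close>

lemma has_field_derivative_reflect: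
  assumes "(g has_field_derivative D) (at (1 - cnj s))"
  shows "((\<lambda>s. cnj (g (1 - cnj s))) has_field_derivative - cnj D) (at s)"
proof -
  have "((\<lambda>w. g (1 - w)) has_field_derivative D * (- 1)) (at (cnj s))"
    by (rule DERIV_chain2[where f = g]) (use assms in \<open>auto intro!: derivative_eq_intros\<close>)
  then have "(cnj \<circ> (\<lambda>w. g (1 - w)) \<circ> cnj has_field_derivative cnj (D * (- 1))) (at s)"
    by (rule has_field_derivative_cnj_cnj)
  then show ?thesis by (simp add: o_def)
qed

text \<open>Everything is restricted to a half-plane \<open>Im s > T0\<close> free of poles and of gamma factor
  singularities; it is stable under the reflection \<open>s \<mapsto> 1 - cnj s\<close>.\<close>

locale upper_functional_equation =
  fixes F H \<psi> :: "complex \<Rightarrow> complex" and T0 d C0 :: real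
  assumes T0: "1 \<le> T0"
    and F_holo: "F holomorphic_on {s. T0 < Im s}"
    and \<psi>_holo: "\<psi> holomorphic_on {s. T0 < Im s}"
    and H_deriv: "\<And>s. T0 < Im s \<Longrightarrow> (H has_field_derivative \<psi> s * H s) (at s)"
    and H_nz: "\<And>s. T0 < Im s \<Longrightarrow> H s \<noteq> 0"
    and H_line: "\<And>s. T0 < Im s \<Longrightarrow> Re s = 1 / 2 \<Longrightarrow> norm (H s) = 1"
    and \<psi>_refl: "\<And>s. T0 < Im s \<Longrightarrow> \<psi> (1 - cnj s) = cnj (\<psi> s)"
    and FE: "\<And>s. T0 < Im s \<Longrightarrow> F s = H s * cnj (F (1 - cnj s))"
    and \<psi>_asymp: "\<And>B. \<exists>C T1. \<forall>s. \<bar>Re s\<bar> \<le> B \<longrightarrow> T1 \<le> Im s \<longrightarrow>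
      norm (\<psi> s + of_real (d * ln (Im s) + C0)) \<le> C / Im s"
    and F_right: "\<And>\<epsilon>. 0 < \<epsilon> \<Longrightarrow> \<exists>\<sigma>1. \<forall>s. \<sigma>1 \<le> Re s \<longrightarrow> T0 < Im s \<longrightarrow> norm (F s - 1) \<le> \<epsilon>"
    and F_order: "\<exists>R A. \<forall>s. T0 < Im s \<longrightarrow> R \<le> norm s \<longrightarrow> norm (F s) \<le> exp (norm s powr A)"
    and d0: "0 \<le> d" and nontriv: "d \<noteq> 0 \<or> C0 \<noteq> 0"
begin

abbreviation "Fk \<equiv> F_iter \<psi> F"

text \<open>With this factor the recursion becomes F_(k+1) = F_k' + P F_k, so \<open>P ^ k\<close>
  is the expected size of \<open>Fk k\<close> to the right.\<close>

definition "P s = - \<psi> s / 2"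

lemma open_U: "open {s. T0 < Im s}"
  by (rule open_halfspace_Im_gt)

lemma Fk_holo: "Fk k holomorphic_on {s. T0 < Im s}"
  by (induction k) (auto intro!: holomorphic_intros F_holo \<psi>_holo holomorphic_deriv open_U)

lemma Fk_deriv: "T0 < Im s \<Longrightarrow> (Fk k has_field_derivative deriv (Fk k) s) (at s)"
  using holomorphic_derivI[OF Fk_holo open_U] by simp

lemma P_deriv: "T0 < Im s \<Longrightarrow> (P has_field_derivative deriv P s) (at s)"
  unfolding P_def[abs_def]
  by (rule holomorphic_derivI[OF _ open_U]) (auto intro!: holomorphic_intros \<psi>_holo)

lemma Fk_Suc: "Fk (Suc k) s = deriv (Fk k) s + P s * Fk k s"
  by (simp add: P_def)

lemma Fk_refl_deriv:
  assumes s: "T0 < Im s" and FEk: "\<And>s. T0 < Im s \<Longrightarrow> Fk k s = (-1) ^ k * (H s * cnj (Fk k (1 - cnj s)))"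
  shows "deriv (Fk k) s = (-1) ^ k * (\<psi> s * H s * cnj (Fk k (1 - cnj s)) - H s * cnj (deriv (Fk k) (1 - cnj s)))"
proof -
  have "((\<lambda>s. cnj (Fk k (1 - cnj s))) has_field_derivative - cnj (deriv (Fk k) (1 - cnj s))) (at s)"
    by (rule has_field_derivative_reflect[OF Fk_deriv]) (use s in simp)
  from DERIV_cmult[OF DERIV_mult[OF H_deriv[OF s] this], of "(-1) ^ k"]
  have "(Fk k has_field_derivative (-1) ^ k * (\<psi> s * H s * cnj (Fk k (1 - cnj s)) +
      - cnj (deriv (Fk k) (1 - cnj s)) * H s)) (at s)"
    by (rule has_field_derivative_transform_within_open[OF _ open_U]) (simp add: s, rule FEk[symmetric], simp)
  then show ?thesis by (auto dest!: DERIV_imp_deriv simp: algebra_simps)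
qed

text \<open>This is where the coefficient 1/2 in the recursion matters. Differentiating the
  functional equation produces a full term \<open>\<psi>\<close>; subtracting half of it leaves the
  other half, and since \<open>\<psi>\<close> is symmetric under the reflection, what remains is -H
  times the conjugate of the reflected F_(k+1).\<close>

lemma Fk_FE: "T0 < Im s \<Longrightarrow> Fk k s = (-1) ^ k * (H s * cnj (Fk k (1 - cnj s)))"
proof (induction k arbitrary: s)
  case 0
  then show ?case using FE[of s] by simp
next
  case (Suc k)
  show ?case
    using Fk_refl_deriv[OF Suc.prems Suc.IH] Suc.IH[OF Suc.prems] \<psi>_refl[OF Suc.prems]
    by (simp add: algebra_simps)
qed

text \<open>The half-plane is convex and \<open>H\<close> has no zeros there. The imaginary part of
  \<open>h\<close> serves as a continuous argument of \<open>H\<close>, its real part as the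
  logarithm of the modulus.\<close>

lemma H_log:
  obtains h where "\<And>s. T0 < Im s \<Longrightarrow> H s = exp (h s)"
    "\<And>s. T0 < Im s \<Longrightarrow> (h has_field_derivative \<psi> s) (at s)"
proof -
  let ?U = "{s. T0 < Im s}"
  have "H holomorphic_on ?U"
    using H_deriv by (auto simp: holomorphic_on_open[OF open_U])
  moreover have "convex ?U" by (rule convex_halfspace_Im_gt)
  moreover have "Complex 0 (T0 + 1) \<in> ?U" by simp
  ultimately obtain h where h: "h holomorphic_on ?U" "\<And>s. s \<in> ?U \<Longrightarrow> exp (h s) = H s"
    using holomorphic_logarithm_exists[of ?U H] open_U H_nz by (metis mem_Collect_eq)
  have "(h has_field_derivative \<psi> s) (at s)" if s: "T0 < Im s" for s
  proof -
    have hs: "(h has_field_derivative deriv h s) (at s)"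
      using holomorphic_derivI[OF h(1) open_U] s by simp
    then have "((\<lambda>s. exp (h s)) has_field_derivative exp (h s) * deriv h s) (at s)"
      by (auto intro!: derivative_eq_intros)
    then have "(H has_field_derivative exp (h s) * deriv h s) (at s)"
      by (rule has_field_derivative_transform_within_open[OF _ open_U]) (use s h in auto)
    then have "exp (h s) * deriv h s = \<psi> s * H s" using H_deriv[OF s] DERIV_unique by blast
    then have "deriv h s = \<psi> s" using h(2)[of s] H_nz[OF s] s by auto
    then show ?thesis using hs by simp
  qed
  then show ?thesis using that h by (metis mem_Collect_eq)
qed

section \<open>Polynomial growth in vertical strips\<close>

lemma \<psi>_bound:
  "\<exists>K T1. 0 \<le> K \<and> T0 < T1 \<and> 3 \<le> T1 \<and>
    (\<forall>s. \<bar>Re s\<bar> \<le> B \<longrightarrow> T1 \<le> Im s \<longrightarrow> norm (\<psi> s) \<le> K * ln (Im s))"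
proof -
  obtain C T1 where C: "\<And>s. \<bar>Re s\<bar> \<le> B \<Longrightarrow> T1 \<le> Im s \<Longrightarrow>
      norm (\<psi> s + of_real (d * ln (Im s) + C0)) \<le> C / Im s"
    using \<psi>_asymp by metis
  have "norm (\<psi> s) \<le> (\<bar>C\<bar> + d + \<bar>C0\<bar>) * ln (Im s)" if s: "\<bar>Re s\<bar> \<le> B" "max (max T1 3) (T0 + 1) \<le> Im s" for s
  proof -
    have t: "Im s \<ge> 3" "Im s \<ge> T1" using s by auto
    \<comment> \<open>Heights of at least 3 > e are taken here and below so that ln is at least 1
      and additive constants can be absorbed into multiples of ln.\<close>
    have "exp 1 \<le> Im s" using exp_le t by linarith
    then have l1: "1 \<le> ln (Im s)" using t by (subst ln_ge_iff) auto
    have "norm (\<psi> s) \<le> C / Im s + norm (of_real (d * ln (Im s) + C0) :: complex)"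
      using C[OF s(1) t(2)] norm_triangle_ineq4[of "\<psi> s + of_real (d * ln (Im s) + C0)" "of_real (d * ln (Im s) + C0)"]
      by simp
    also have "norm (of_real (d * ln (Im s) + C0) :: complex) = \<bar>d * ln (Im s) + C0\<bar>" by (rule norm_of_real)
    also have "\<bar>d * ln (Im s) + C0\<bar> \<le> d * ln (Im s) + \<bar>C0\<bar>" using d0 l1
      by (metis abs_of_nonneg abs_triangle_ineq mult_nonneg_nonneg order_trans zero_le_one)
    also have "C / Im s \<le> \<bar>C\<bar> / 1" using t by (intro frac_le) auto
    also have "\<bar>C\<bar> / 1 + (d * ln (Im s) + \<bar>C0\<bar>) \<le> \<bar>C\<bar> * ln (Im s) + (d * ln (Im s) + \<bar>C0\<bar> * ln (Im s))"
      using mult_left_mono[OF l1, of "\<bar>C\<bar>"] mult_left_mono[OF l1, of "\<bar>C0\<bar>"] by simp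
    finally show ?thesis by (simp add: algebra_simps)
  qed
  then show ?thesis
    by (intro exI[of _ "\<bar>C\<bar> + d + \<bar>C0\<bar>"] exI[of _ "max (max T1 3) (T0 + 1)"]) (use d0 in auto)
qed

text \<open>The exponent may depend on the strip. There is no implied constant, because raising the
  exponent by one and the threshold \<open>T1\<close> suitably swallows it.\<close>

definition poly_growth :: "(complex \<Rightarrow> complex) \<Rightarrow> bool" where
  "poly_growth f \<longleftrightarrow> (\<forall>B. \<exists>N::nat. \<exists>T1>T0. 3 \<le> T1 \<and>
    (\<forall>s. \<bar>Re s\<bar> \<le> B \<longrightarrow> T1 \<le> Im s \<longrightarrow> norm (f s) \<le> Im s ^ N))"

text \<open>On the critical line Re h = 0. Moving horizontally from there by a bounded distance
  changes h by O(log t), since h' = \<psi> = O(log t); exponentiating gives a power of t.\<close>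

lemma H_growth: "poly_growth H"
  unfolding poly_growth_def
proof
  fix B0 :: real
  define B where "B = \<bar>B0\<bar> + 1"
  obtain h where h: "\<And>s. T0 < Im s \<Longrightarrow> H s = exp (h s)"
    "\<And>s. T0 < Im s \<Longrightarrow> (h has_field_derivative \<psi> s) (at s)" using H_log by blast
  obtain K T1 where K: "0 \<le> K" "T0 < T1" "3 \<le> T1"
    "\<And>s. \<bar>Re s\<bar> \<le> B \<Longrightarrow> T1 \<le> Im s \<Longrightarrow> norm (\<psi> s) \<le> K * ln (Im s)"
    using \<psi>_bound[of B] by blast
  define N where "N = nat \<lceil>2 * K * B\<rceil>"
  have "norm (H s) \<le> Im s ^ N" if s: "\<bar>Re s\<bar> \<le> B0" "T1 \<le> Im s" for s
  proof -
    define z where "z = Complex (1 / 2) (Im s)"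
    define X where "X = {w. \<bar>Re w\<bar> \<le> B \<and> Im w = Im s}"
    have X: "convex X"
    proof -
      have "X = {w. Re w \<le> B} \<inter> {w. Re w \<ge> - B} \<inter> {w. Im w \<le> Im s} \<inter> {w. Im w \<ge> Im s}"
        by (auto simp: X_def)
      then show ?thesis
        by (simp add: convex_Int convex_halfspace_Re_le convex_halfspace_Re_ge
            convex_halfspace_Im_le convex_halfspace_Im_ge)
    qed
    have t: "0 < Im s" "T0 < Im s" using s K by auto
    have "norm (h s - h z) \<le> K * ln (Im s) * norm (s - z)"
    proof (rule field_differentiable_bound[OF X])
      fix w assume "w \<in> X"
      then have w: "\<bar>Re w\<bar> \<le> B" "Im w = Im s" by (auto simp: X_def)
      show "(h has_field_derivative \<psi> w) (at w within X)"
        by (rule has_field_derivative_at_within[OF h(2)]) (use w t in simp)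
      show "norm (\<psi> w) \<le> K * ln (Im s)" using K(4)[OF w(1)] w s by simp
    qed (use s in \<open>auto simp: X_def B_def z_def\<close>)
    also have "norm (s - z) \<le> 2 * B"
    proof -
      have "s - z = of_real (Re s - 1 / 2)" by (simp add: z_def complex_eq_iff)
      then have "norm (s - z) = \<bar>Re s - 1 / 2\<bar>" by (metis norm_of_real)
      then show ?thesis using s by (simp add: B_def)
    qed
    finally have b: "norm (h s - h z) \<le> K * ln (Im s) * (2 * B)"
      using K s by (simp add: mult_left_mono)
    have "norm (H z) = 1" by (rule H_line) (use t in \<open>auto simp: z_def\<close>)
    then have "Re (h z) = 0" using h(1)[of z] t by (simp add: z_def)
    then have "Re (h s) \<le> norm (h s - h z)" using complex_Re_le_cmod[of "h s - h z"] by simp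
    also note b
    also have "K * ln (Im s) * (2 * B) = 2 * K * B * ln (Im s)" by simp
    also have "\<dots> \<le> real N * ln (Im s)"
      using K s real_nat_ceiling_ge[of "2 * K * B"] by (intro mult_right_mono) (auto simp: N_def)
    finally have "exp (Re (h s)) \<le> exp (real N * ln (Im s))" by simp
    also have "\<dots> = Im s ^ N" using t by (simp add: exp_of_nat_mult)
    finally show ?thesis using h(1) t by simp
  qed
  then show "\<exists>N::nat. \<exists>T1>T0. 3 \<le> T1 \<and> (\<forall>s. \<bar>Re s\<bar> \<le> B0 \<longrightarrow> T1 \<le> Im s \<longrightarrow> norm (H s) \<le> Im s ^ N)"
    using K by blast
qed

text \<open>F is bounded by 2 far to the right, where it is close to 1; on the reflected line the
  functional equation transfers this with the factor \<open>H\<close>, a power of t.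
  Phragmen-Lindelof fills in the strip, finite order being its a priori growth hypothesis.\<close>

lemma F_growth: "poly_growth F"
  unfolding poly_growth_def
proof
  fix B :: real
  obtain \<sigma>1 where \<sigma>1: "\<And>s. \<sigma>1 \<le> Re s \<Longrightarrow> T0 < Im s \<Longrightarrow> norm (F s - 1) \<le> 1"
    using F_right[of 1] by auto
  define b where "b = max \<bar>\<sigma>1\<bar> \<bar>B\<bar> + 1"
  define a where "a = 1 - b"
  have b: "b \<ge> 1" "\<sigma>1 \<le> b" "B < b" "a \<le> - B" "a < b" by (auto simp: b_def a_def)
  have F2: "norm (F s) \<le> 2" if "Re s = b" "T0 < Im s" for s
    using \<sigma>1[of s] that b norm_triangle_ineq[of "F s - 1" 1] by simp
  obtain N T1 where N: "T0 < T1" "3 \<le> T1"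
    "\<And>s. \<bar>Re s\<bar> \<le> b \<Longrightarrow> T1 \<le> Im s \<Longrightarrow> norm (H s) \<le> Im s ^ N"
    using H_growth unfolding poly_growth_def by metis
  have FN: "norm (F s) \<le> 2 * Im s ^ N" if s: "Re s = a" "T1 \<le> Im s" for s
  proof -
    have 1: "norm (F (1 - cnj s)) \<le> 2" using s N by (intro F2) (auto simp: a_def)
    have 2: "norm (H s) \<le> Im s ^ N" using s b by (intro N(3)) (auto simp: a_def)
    have "norm (F s) = norm (H s) * norm (F (1 - cnj s))"
      using s N by (subst FE) (simp_all add: norm_mult)
    also have "\<dots> \<le> Im s ^ N * 2" using 1 2 s N by (intro mult_mono) auto
    finally show ?thesis by simp
  qed
  let ?K = "closed_segment (Complex a T1) (Complex b T1)"
  have "continuous_on {s. T0 < Im s} F" using F_holo by (rule holomorphic_on_imp_continuous_on)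
  then have "continuous_on ?K F"
    by (rule continuous_on_subset) (use N in \<open>simp add: closed_segment_subset convex_halfspace_Im_gt\<close>)
  then have "bounded (F ` ?K)" by (intro compact_imp_bounded compact_continuous_image) auto
  then obtain C1 where C1: "\<And>s. s \<in> ?K \<Longrightarrow> norm (F s) \<le> C1" by (auto simp: bounded_iff)
  define C where "C = max 2 C1"
  obtain R A where RA: "\<And>s. T0 < Im s \<Longrightarrow> R \<le> norm s \<Longrightarrow> norm (F s) \<le> exp (norm s powr A)"
    using F_order by blast
  \<comment> \<open>Division by \<open>s ^ N\<close> makes the function bounded on the left edge. As
    |s| \<ge> 3 in the half-strip, it only decreases the modulus, so the finite-order bound for F is
    inherited.\<close>
  define f where "f = (\<lambda>s. F s / s ^ N)"
  have strip: "norm (f s) \<le> C" if s: "a \<le> Re s" "Re s \<le> b" "T1 \<le> Im s" for s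
  proof (rule phragmen_lindelof_half_strip[where f = f and S = "{s. T0 < Im s}" and a = a and b = b and ?t0.0 = T1 and R = R and A = A])
    have nz: "s \<noteq> 0" if "T0 < Im s" for s using that T0 by auto
    show "f holomorphic_on {s. T0 < Im s}"
      unfolding f_def using nz by (intro holomorphic_intros F_holo) auto
    have n1: "1 \<le> norm s ^ N" "Im s ^ N \<le> norm s ^ N" if "T1 \<le> Im s" for s
      using that N abs_Im_le_cmod[of s] by (auto intro!: one_le_power power_mono)
    show "norm (f s) \<le> exp (norm s powr A)" if "T1 \<le> Im s" "R \<le> norm s" for s
    proof -
      have "norm (f s) \<le> norm (F s)" using n1[OF that(1)] divide_left_mono[of 1 "norm s ^ N" "norm (F s)"]
        by (simp add: f_def norm_divide norm_power zero_less_mult_iff)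
      also have "\<dots> \<le> exp (norm s powr A)" using RA that N by simp
      finally show ?thesis .
    qed
    show "norm (f s) \<le> C" if s: "a \<le> Re s" "Re s \<le> b" "T1 \<le> Im s" "Re s = a \<or> Re s = b \<or> Im s = T1" for s
    proof -
      have "norm (F s) \<le> C * norm s ^ N"
      proof (cases "Re s = a")
        case True
        then have "norm (F s) \<le> 2 * Im s ^ N" using FN s by simp
        also have "\<dots> \<le> C * norm s ^ N" using n1[of s] s N by (intro mult_mono) (auto simp: C_def)
        finally show ?thesis .
      next
        case False
        have "norm (F s) \<le> C"
        proof (cases "Re s = b")
          case True
          then show ?thesis using F2[of s] s N by (simp add: C_def)
        next
          case False
          with s \<open>Re s \<noteq> a\<close> have "Im s = T1" by auto
          define u where "u = (Re s - a) / (b - a)"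
          have u: "0 \<le> u" "u \<le> 1" "u * (b - a) = Re s - a" using s b by (auto simp: u_def field_simps)
          have "s = (1 - u) *\<^sub>R Complex a T1 + u *\<^sub>R Complex b T1"
            using u(3) \<open>Im s = T1\<close> by (simp add: complex_eq_iff algebra_simps)
          then have "s \<in> ?K" using u by (auto simp: in_segment)
          then show ?thesis using C1[of s] by (simp add: C_def)
        qed
        also have "C * 1 \<le> C * norm s ^ N" using n1 s by (intro mult_left_mono) (auto simp: C_def)
        finally show ?thesis by simp
      qed
      moreover have "norm s ^ N > 0" using n1[OF s(3)] by simp
      ultimately show ?thesis by (simp add: f_def norm_divide norm_power divide_le_eq)
    qed
  qed (use b N s in \<open>auto simp: C_def\<close>)
  \<comment> \<open>Above this height |s| \<le> 2 Im s, and the constant \<open>C * 2 ^ N\<close> is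
    absorbed by one extra power of \<open>Im s\<close>.\<close>
  define T2 where "T2 = max T1 (max (\<bar>a\<bar> + \<bar>b\<bar>) (C * 2 ^ N))"
  have "norm (F s) \<le> Im s ^ Suc N" if s: "\<bar>Re s\<bar> \<le> B" "T2 \<le> Im s" for s
  proof -
    have t: "T1 \<le> Im s" "\<bar>a\<bar> + \<bar>b\<bar> \<le> Im s" "C * 2 ^ N \<le> Im s" using s by (auto simp: T2_def)
    then have tp: "0 < Im s" using N by simp
    have sn: "s \<noteq> 0" using tp by auto
    have "a \<le> Re s" "Re s \<le> b" using s b by auto
    then have "norm (f s) \<le> C" "norm s \<le> 2 * Im s"
      using strip[of s] t tp cmod_le[of s] by auto
    then have "norm (F s) \<le> C * norm s ^ N"
      using sn by (simp add: f_def norm_divide norm_power divide_le_eq)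
    also have "\<dots> \<le> C * (2 * Im s) ^ N"
      using \<open>norm s \<le> 2 * Im s\<close> by (intro mult_left_mono power_mono) (auto simp: C_def)
    also have "\<dots> = (C * 2 ^ N) * Im s ^ N" by (simp add: power_mult_distrib)
    also have "\<dots> \<le> Im s * Im s ^ N" using t tp by (intro mult_right_mono) auto
    finally show ?thesis by simp
  qed
  then show "\<exists>N::nat. \<exists>T1>T0. 3 \<le> T1 \<and> (\<forall>s. \<bar>Re s\<bar> \<le> B \<longrightarrow> T1 \<le> Im s \<longrightarrow> norm (F s) \<le> Im s ^ N)"
    using N by (intro exI[of _ "Suc N"] exI[of _ T2]) (auto simp: T2_def)
qed

text \<open>Cauchy's estimate after subtracting a constant, so that a function nearly constant on
  the disc has a small derivative. It is used with c = 0 for growth, c = 1 for \<open>R k\<close>,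
  and the local main term for \<open>P\<close>.\<close>

lemma deriv_bound_unit_disc:
  assumes "f holomorphic_on cball s 1" "\<And>z. z \<in> cball s 1 \<Longrightarrow> norm (f z - c) \<le> M"
  shows "norm (deriv f s) \<le> M"
proof -
  have *: "(\<lambda>z. f z - c) holomorphic_on cball s 1" by (intro holomorphic_intros assms)
  have fd: "f field_differentiable at s"
    by (rule holomorphic_on_imp_differentiable_at[of _ "ball s 1"])
      (auto intro: holomorphic_on_subset[OF assms(1)])
  have "norm ((deriv ^^ 1) (\<lambda>z. f z - c) s) \<le> fact 1 * M / 1 ^ 1"
    by (rule Cauchy_inequality)
      (use assms(2) * in \<open>auto simp: dist_norm norm_minus_commute intro: holomorphic_on_subset holomorphic_on_imp_continuous_on\<close>)
  then show ?thesis using fd by simp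
qed

lemma in_unit_disc:
  assumes "z \<in> cball s 1"
  shows "\<bar>Re z\<bar> \<le> \<bar>Re s\<bar> + 1" "Im s - 1 \<le> Im z" "Im z \<le> Im s + 1" "Re s - 1 \<le> Re z" "Re z \<le> Re s + 1"
  using assms abs_Re_le_cmod[of "s - z"] abs_Im_le_cmod[of "s - z"] by (auto simp: dist_norm)

text \<open>Cauchy's estimate on unit discs controls the derivative at the price of a strip wider by
  1, which is harmless since the induction hypothesis covers every strip. Each step costs two
  powers: one for \<open>P\<close> and the doubling of heights, one for the constant.\<close>

lemma Fk_growth: "poly_growth (Fk k)"
proof (induction k)
  case 0
  then show ?case using F_growth by simp
next
  case (Suc k)
  show ?case unfolding poly_growth_def
  proof
    fix B :: real
    obtain N T1 where N: "T0 < T1" "3 \<le> T1"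
      "\<And>s. \<bar>Re s\<bar> \<le> B + 1 \<Longrightarrow> T1 \<le> Im s \<Longrightarrow> norm (Fk k s) \<le> Im s ^ N"
      using Suc unfolding poly_growth_def by metis
    obtain K T2 where K: "0 \<le> K" "T0 < T2" "3 \<le> T2"
      "\<And>s. \<bar>Re s\<bar> \<le> B \<Longrightarrow> T2 \<le> Im s \<Longrightarrow> norm (\<psi> s) \<le> K * ln (Im s)"
      using \<psi>_bound[of B] by blast
    define T3 where "T3 = max (max (T1 + 1) T2) (2 ^ N + K)"
    have "norm (Fk (Suc k) s) \<le> Im s ^ (N + 2)" if s: "\<bar>Re s\<bar> \<le> B" "T3 \<le> Im s" for s
    proof -
      have t: "T1 + 1 \<le> Im s" "T2 \<le> Im s" "2 ^ N + K \<le> Im s" using s by (auto simp: T3_def)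
      then have t3: "3 \<le> Im s" using K by simp
      have "norm (deriv (Fk k) s) \<le> (Im s + 1) ^ N"
      proof (rule deriv_bound_unit_disc[where c = 0])
        have "cball s 1 \<subseteq> {s. T0 < Im s}" using in_unit_disc(2)[of _ s] t N by fastforce
        then show "Fk k holomorphic_on cball s 1" using Fk_holo holomorphic_on_subset by blast
        fix z assume z: "z \<in> cball s 1"
        have "norm (Fk k z) \<le> Im z ^ N"
          using in_unit_disc[OF z] s t N by (intro N(3)) auto
        also have "\<dots> \<le> (Im s + 1) ^ N" using in_unit_disc[OF z] t t3 N by (intro power_mono) auto
        finally show "norm (Fk k z - 0) \<le> (Im s + 1) ^ N" by simp
      qed
      also have "\<dots> \<le> (2 * Im s) ^ N" using t3 by (intro power_mono) auto
      also have "\<dots> \<le> 2 ^ N * Im s ^ Suc N"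
        using t3 by (simp add: power_mult_distrib mult_left_mono)
      finally have 1: "norm (deriv (Fk k) s) \<le> 2 ^ N * Im s ^ Suc N" .
      have "norm (P s) \<le> K * ln (Im s)"
        using K(4)[OF s(1) t(2)] by (simp add: P_def norm_divide) (use norm_ge_zero[of "\<psi> s"] in linarith)
      also have "\<dots> \<le> K * Im s" using ln_bound[of "Im s"] t3 K by (intro mult_left_mono) auto
      finally have "norm (P s * Fk k s) \<le> (K * Im s) * Im s ^ N"
        unfolding norm_mult using s t N K t3 by (intro mult_mono N(3)) auto
      then have 2: "norm (P s * Fk k s) \<le> K * Im s ^ Suc N" by simp
      have "norm (Fk (Suc k) s) \<le> (2 ^ N + K) * Im s ^ Suc N"
        using norm_triangle_ineq[of "deriv (Fk k) s" "P s * Fk k s"] 1 2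
        unfolding Fk_Suc distrib_right by linarith
      also have "\<dots> \<le> Im s * Im s ^ Suc N" using t t3 by (intro mult_right_mono) auto
      finally show ?thesis by simp
    qed
    then show "\<exists>N::nat. \<exists>T1>T0. 3 \<le> T1 \<and> (\<forall>s. \<bar>Re s\<bar> \<le> B \<longrightarrow> T1 \<le> Im s \<longrightarrow> norm (Fk (Suc k) s) \<le> Im s ^ N)"
      using N by (intro exI[of _ "N + 2"] exI[of _ T3]) (auto simp: T3_def)
  qed
qed

section \<open>Comparison of \<open>F_k\<close> with a power of \<open>P\<close> far to the
  right\<close>

lemma P_lower:
  obtains p \<epsilon> where "0 < p" "\<epsilon> = 1 \<or> \<epsilon> = -1"
    "\<And>B. \<exists>T1>T0. \<forall>s. \<bar>Re s\<bar> \<le> B \<longrightarrow> T1 \<le> Im s \<longrightarrow> p \<le> \<epsilon> * Re (P s)"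
proof -
  \<comment> \<open>\<open>P\<close> behaves like (d ln t + C0)/2. For d > 0 its real part tends to
    infinity; for d = 0 it tends to C0/2, which may be negative, hence the sign. The bound
    \<open>p\<close> is then half of the limit |C0|/2.\<close>
  define \<epsilon> :: real where "\<epsilon> = (if d = 0 \<and> C0 < 0 then -1 else 1)"
  define p where "p = (if d = 0 then \<bar>C0\<bar> / 4 else 1)"
  have p: "0 < p" using nontriv by (auto simp: p_def)
  show ?thesis
  proof
    show "0 < p" "\<epsilon> = 1 \<or> \<epsilon> = -1" using p by (auto simp: \<epsilon>_def)
    fix B :: real
    obtain C T1 where C: "\<And>s. \<bar>Re s\<bar> \<le> B \<Longrightarrow> T1 \<le> Im s \<Longrightarrow>
        norm (\<psi> s + of_real (d * ln (Im s) + C0)) \<le> C / Im s"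
      using \<psi>_asymp by metis
    have "\<forall>\<^sub>F t in at_top. p \<le> \<epsilon> * (d * ln t + C0) / 2 - C / t / 2"
    proof (cases "d = 0")
      case True
      have "((\<lambda>t. \<bar>C0\<bar> / 2 - C / t / 2) \<longlongrightarrow> \<bar>C0\<bar> / 2) at_top" by real_asymp
      moreover have "\<bar>C0\<bar> / 4 < \<bar>C0\<bar> / 2" using True nontriv by simp
      ultimately have "\<forall>\<^sub>F t in at_top. \<bar>C0\<bar> / 4 < \<bar>C0\<bar> / 2 - C / t / 2" by (rule order_tendstoD(1))
      then show ?thesis
        by eventually_elim (use True nontriv in \<open>auto simp: p_def \<epsilon>_def abs_if split: if_splits\<close>)
    next
      case False
      then have "d > 0" using d0 by simp
      then have "filterlim (\<lambda>t. (d * ln t + C0) / 2 - C / t / 2) at_top at_top" by real_asymp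
      then have "\<forall>\<^sub>F t in at_top. 1 \<le> (d * ln t + C0) / 2 - C / t / 2" by (simp add: filterlim_at_top)
      then show ?thesis using False by (simp add: p_def \<epsilon>_def)
    qed
    then obtain T2 where T2: "\<And>t. T2 \<le> t \<Longrightarrow> p \<le> \<epsilon> * (d * ln t + C0) / 2 - C / t / 2"
      by (auto simp: eventually_at_top_linorder)
    have "p \<le> \<epsilon> * Re (P s)" if s: "\<bar>Re s\<bar> \<le> B" "max (max T1 T2) (T0 + 1) \<le> Im s" for s
    proof -
      have t: "T1 \<le> Im s" "T2 \<le> Im s" using s by auto
      have "\<bar>Re (\<psi> s) + (d * ln (Im s) + C0)\<bar> \<le> C / Im s"
        using C[OF s(1) t(1)] abs_Re_le_cmod[of "\<psi> s + of_real (d * ln (Im s) + C0)"] by simp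
      then have "\<epsilon> * (Re (\<psi> s) + (d * ln (Im s) + C0)) \<le> C / Im s" (is "?a \<le> _")
        by (auto simp: \<epsilon>_def)
      moreover have "p \<le> \<epsilon> * (d * ln (Im s) + C0) / 2 - C / Im s / 2" (is "_ \<le> ?b / 2 - _")
        by (rule T2[OF t(2)])
      ultimately have "p \<le> - ?a / 2 + ?b / 2" by argo
      also have "\<dots> = \<epsilon> * Re (P s)" by (simp add: P_def field_simps)
      finally show ?thesis .
    qed
    then show "\<exists>T1>T0. \<forall>s. \<bar>Re s\<bar> \<le> B \<longrightarrow> T1 \<le> Im s \<longrightarrow> p \<le> \<epsilon> * Re (P s)"
      by (intro exI[of _ "max (max T1 T2) (T0 + 1)"]) auto
  qed
qed

text \<open>On the unit disc about s the logarithm of the height varies by at most 1/(Im s - 1), so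
  \<open>P\<close> is within O(1/Im s) of the constant (d ln(Im s) + C0)/2, and Cauchy's estimate
  applies.\<close>

lemma P_deriv_small:
  assumes "0 < \<epsilon>"
  shows "\<exists>T1>T0. \<forall>s. \<bar>Re s\<bar> \<le> B \<longrightarrow> T1 \<le> Im s \<longrightarrow> norm (deriv P s) \<le> \<epsilon>"
proof -
  obtain C T1 where C: "\<And>s. \<bar>Re s\<bar> \<le> B + 1 \<Longrightarrow> T1 \<le> Im s \<Longrightarrow>
      norm (\<psi> s + of_real (d * ln (Im s) + C0)) \<le> C / Im s"
    using \<psi>_asymp by metis
  define T2 where "T2 = max (max (T1 + 1) (T0 + 2)) ((\<bar>C\<bar> + d) / \<epsilon> + 1)"
  have "norm (deriv P s) \<le> \<epsilon>" if s: "\<bar>Re s\<bar> \<le> B" "T2 \<le> Im s" for s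
  proof (rule deriv_bound_unit_disc)
    have t: "T1 + 1 \<le> Im s" "T0 + 2 \<le> Im s" "(\<bar>C\<bar> + d) / \<epsilon> + 1 \<le> Im s" using s by (auto simp: T2_def)
    then have t1: "Im s - 1 > 0" using T0 by simp
    have "cball s 1 \<subseteq> {s. T0 < Im s}" using in_unit_disc(2)[of _ s] t by fastforce
    then show "P holomorphic_on cball s 1"
      unfolding P_def[abs_def] by (intro holomorphic_intros holomorphic_on_subset[OF \<psi>_holo]) auto
    fix z assume "z \<in> cball s 1"
    note z = in_unit_disc[OF this]
    define c where "c = d * ln (Im s) + C0"
    have zt: "Im z > 0" using z t1 by linarith
    have "norm (\<psi> z + of_real (d * ln (Im z) + C0)) \<le> C / Im z" using z s t by (intro C) auto
    also have "\<dots> \<le> \<bar>C\<bar> / (Im s - 1)" using z t1 by (intro frac_le) auto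
    finally have 1: "norm (\<psi> z + of_real (d * ln (Im z) + C0)) \<le> \<bar>C\<bar> / (Im s - 1)" .
    have "\<bar>ln (Im z) - ln (Im s)\<bar> \<le> 1 / (Im s - 1)"
    proof -
      have "ln (Im z) - ln (Im s) \<le> (Im z - Im s) / Im s" using ln_diff_le[of "Im z" "Im s"] zt t1 by simp
      also have "\<dots> \<le> 1 / (Im s - 1)" using z t1 by (intro frac_le) auto
      finally have a: "ln (Im z) - ln (Im s) \<le> 1 / (Im s - 1)" .
      have "ln (Im s) - ln (Im z) \<le> (Im s - Im z) / Im z" using ln_diff_le[of "Im s" "Im z"] zt t1 by simp
      also have "\<dots> \<le> 1 / (Im s - 1)" using z t1 by (intro frac_le) auto
      finally show ?thesis using a by simp
    qed
    then have "d * \<bar>ln (Im z) - ln (Im s)\<bar> \<le> d * (1 / (Im s - 1))" using d0 by (intro mult_left_mono)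
    then have 2: "norm (of_real (d * ln (Im z) - d * ln (Im s)) :: complex) \<le> d / (Im s - 1)"
      unfolding norm_of_real using d0 by (simp add: right_diff_distrib[symmetric] abs_mult)
    have "P z - of_real (c / 2) = - ((\<psi> z + of_real (d * ln (Im z) + C0)) - of_real (d * ln (Im z) - d * ln (Im s))) / 2"
      by (simp add: P_def c_def field_simps)
    also have "norm \<dots> \<le> (\<bar>C\<bar> / (Im s - 1) + d / (Im s - 1)) / 2"
      using norm_triangle_ineq4[of "\<psi> z + of_real (d * ln (Im z) + C0)" "of_real (d * ln (Im z) - d * ln (Im s))"] 1 2
      unfolding norm_divide norm_minus_cancel by simp
    also have "\<dots> \<le> \<bar>C\<bar> / (Im s - 1) + d / (Im s - 1)"
    proof -
      have "0 \<le> \<bar>C\<bar> / (Im s - 1) + d / (Im s - 1)" using d0 t1 by simp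
      moreover have "x / 2 \<le> x" if "0 \<le> x" for x :: real using that by simp
      ultimately show ?thesis by blast
    qed
    also have "\<dots> = (\<bar>C\<bar> + d) / (Im s - 1)" by (simp add: add_divide_distrib)
    also have "\<dots> \<le> \<epsilon>" using t(3) t1 assms by (simp add: field_simps)
    finally show "norm (P z - of_real (c / 2)) \<le> \<epsilon>" .
  qed
  then show ?thesis by (intro exI[of _ T2]) (auto simp: T2_def)
qed

text \<open>\<open>Fk k\<close> normalised by its expected leading factor; the aim is that it is
  close to 1 to the right.\<close>

definition "R k s = Fk k s / P s ^ k"

lemma R_has_derivative:
  assumes "T0 < Im s" "P s \<noteq> 0"
  shows "(R k has_field_derivative deriv (Fk k) s / P s ^ k - of_nat k * R k s * deriv P s / P s) (at s)"
proof -
  have "((\<lambda>s. Fk k s / P s ^ k) has_field_derivative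
      (deriv (Fk k) s * P s ^ k - Fk k s * (of_nat k * (deriv P s * P s ^ (k - Suc 0)))) / (P s ^ k * P s ^ k)) (at s)"
    by (rule DERIV_divide[OF Fk_deriv DERIV_power[OF P_deriv]]) (use assms in auto)
  moreover have "(deriv (Fk k) s * P s ^ k - Fk k s * (of_nat k * (deriv P s * P s ^ (k - Suc 0)))) / (P s ^ k * P s ^ k)
      = deriv (Fk k) s / P s ^ k - of_nat k * R k s * deriv P s / P s"
    using assms by (cases k) (simp_all add: R_def field_simps)
  ultimately show ?thesis by (simp add: R_def[abs_def])
qed

text \<open>Both correction terms contain a derivative, of \<open>R k\<close> or of
  \<open>P\<close>, divided by a power of \<open>P\<close>. They are small because
  \<open>R k\<close> and \<open>P\<close> are locally almost constant and \<open>P\<close> is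
  bounded below.\<close>

lemma R_Suc:
  assumes "T0 < Im s" "P s \<noteq> 0"
  shows "R (Suc k) s - 1 = (R k s - 1) + deriv (R k) s / P s + of_nat k * R k s * deriv P s / P s ^ 2"
proof -
  have "deriv (R k) s = deriv (Fk k) s / P s ^ k - of_nat k * R k s * deriv P s / P s"
    by (rule DERIV_imp_deriv[OF R_has_derivative[OF assms]])
  moreover have "R (Suc k) s = deriv (Fk k) s / P s ^ k / P s + R k s"
    using assms unfolding R_def Fk_Suc by (simp add: field_simps)
  ultimately show ?thesis by (simp add: diff_divide_distrib power2_eq_square)
qed

text \<open>The order of quantifiers is essential: \<open>\<sigma>1\<close> serves every
  \<open>\<sigma>2\<close>, whereas \<open>T1\<close> depends on \<open>\<sigma>2\<close>, since
  \<open>P\<close> is controlled only in bounded strips. Each induction step moves the left boundary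
  by 1 to make room for the Cauchy discs.\<close>

lemma R_right:
  assumes "0 < \<epsilon>"
  shows "\<exists>\<sigma>1. \<forall>\<sigma>2. \<exists>T1>T0. \<forall>s. \<sigma>1 \<le> Re s \<longrightarrow> Re s \<le> \<sigma>2 \<longrightarrow> T1 \<le> Im s \<longrightarrow> norm (R k s - 1) \<le> \<epsilon>"
  using assms
proof (induction k arbitrary: \<epsilon>)
  case 0
  obtain \<sigma>1 where "\<And>s. \<sigma>1 \<le> Re s \<Longrightarrow> T0 < Im s \<Longrightarrow> norm (F s - 1) \<le> \<epsilon>"
    using F_right[OF 0] by auto
  then show ?case by (intro exI[of _ \<sigma>1] allI exI[of _ "T0 + 1"]) (auto simp: R_def)
next
  case (Suc k)
  obtain p e where p: "0 < p" "e = 1 \<or> e = -1"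
    "\<And>B. \<exists>T1>T0. \<forall>s. \<bar>Re s\<bar> \<le> B \<longrightarrow> T1 \<le> Im s \<longrightarrow> p \<le> e * Re (P s)" using P_lower by blast
  \<comment> \<open>Chosen so that |R_k - 1| + |R_k'|/p is at most \<epsilon>/2, the cap 1 giving
    |R_k| \<le> 2. Then \<open>\<epsilon>2\<close>, as a bound for the derivative of
    \<open>P\<close>, makes the last term of \<open>R_Suc\<close> at most \<epsilon>/2;
    \<open>Suc k\<close> in it avoids a zero denominator.\<close>
  define \<epsilon>1 where "\<epsilon>1 = min 1 (\<epsilon> / (2 * (1 + 1 / p)))"
  define \<epsilon>2 where "\<epsilon>2 = \<epsilon> * p\<^sup>2 / (4 * real (Suc k))"
  have \<epsilon>1: "0 < \<epsilon>1" "\<epsilon>1 \<le> 1" "\<epsilon>1 * (1 + 1 / p) \<le> \<epsilon> / 2"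
  proof -
    have q: "1 + 1 / p > 0" using p by (simp add: add_pos_pos)
    then show "0 < \<epsilon>1" "\<epsilon>1 \<le> 1" using Suc.prems by (simp_all add: \<epsilon>1_def)
    have "\<epsilon>1 * (1 + 1 / p) \<le> \<epsilon> / (2 * (1 + 1 / p)) * (1 + 1 / p)"
      using q by (intro mult_right_mono) (auto simp: \<epsilon>1_def)
    also have "\<dots> = \<epsilon> / 2" using q by (simp add: field_simps)
    finally show "\<epsilon>1 * (1 + 1 / p) \<le> \<epsilon> / 2" .
  qed
  have \<epsilon>2: "0 < \<epsilon>2" using Suc.prems p by (simp add: \<epsilon>2_def)
  obtain \<sigma>1 where \<sigma>1: "\<And>\<sigma>2. \<exists>T1>T0. \<forall>s. \<sigma>1 \<le> Re s \<longrightarrow> Re s \<le> \<sigma>2 \<longrightarrow> T1 \<le> Im s \<longrightarrow> norm (R k s - 1) \<le> \<epsilon>1"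
    using Suc.IH[OF \<epsilon>1(1)] by auto
  show ?case
  proof (rule exI[of _ "\<sigma>1 + 1"], rule allI)
    fix \<sigma>2 :: real
    define B where "B = \<bar>\<sigma>1\<bar> + \<bar>\<sigma>2\<bar> + 2"
    obtain T1 where T1: "T0 < T1" "\<And>s. \<sigma>1 \<le> Re s \<Longrightarrow> Re s \<le> \<sigma>2 + 1 \<Longrightarrow> T1 \<le> Im s \<Longrightarrow> norm (R k s - 1) \<le> \<epsilon>1"
      using \<sigma>1[of "\<sigma>2 + 1"] by blast
    obtain T2 where T2: "T0 < T2" "\<And>s. \<bar>Re s\<bar> \<le> B \<Longrightarrow> T2 \<le> Im s \<Longrightarrow> p \<le> e * Re (P s)"
      using p(3)[of B] by blast
    obtain T3 where T3: "T0 < T3" "\<And>s. \<bar>Re s\<bar> \<le> B \<Longrightarrow> T3 \<le> Im s \<Longrightarrow> norm (deriv P s) \<le> \<epsilon>2"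
      using P_deriv_small[OF \<epsilon>2, of B] by blast
    define T4 where "T4 = max T1 (max T2 T3) + 1"
    have Pp: "p \<le> norm (P s)" if "\<bar>Re s\<bar> \<le> B" "T2 \<le> Im s" for s
      using T2(2)[OF that] p(2) abs_Re_le_cmod[of "P s"] by auto
    have "norm (R (Suc k) s - 1) \<le> \<epsilon>" if s: "\<sigma>1 + 1 \<le> Re s" "Re s \<le> \<sigma>2" "T4 \<le> Im s" for s
    proof -
      have t: "T1 + 1 \<le> Im s" "T2 + 1 \<le> Im s" "T3 + 1 \<le> Im s" using s by (auto simp: T4_def)
      have sB: "\<bar>Re s\<bar> \<le> B" using s by (auto simp: B_def)
      have ps: "p \<le> norm (P s)" using Pp[OF sB] t by simp
      then have P0: "P s \<noteq> 0" using p by auto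
      have Rs: "norm (R k s - 1) \<le> \<epsilon>1" using T1(2)[of s] s t by simp
      have "norm (deriv (R k) s) \<le> \<epsilon>1"
      proof (rule deriv_bound_unit_disc)
        show "R k holomorphic_on cball s 1"
        proof (rule holomorphic_onI)
          fix z assume "z \<in> cball s 1"
          note z = in_unit_disc[OF this]
          have "\<bar>Re z\<bar> \<le> B" unfolding B_def using z(4,5) s(1,2) by linarith
          then have "P z \<noteq> 0" using Pp[of z] z t p by auto
          then have "R k field_differentiable at z"
            using R_has_derivative[of z k] z t T1 by (auto simp: field_differentiable_def)
          then show "R k field_differentiable at z within cball s 1"
            by (rule field_differentiable_at_within)
        qed
        fix z assume "z \<in> cball s 1"
        note z = in_unit_disc[OF this]
        show "norm (R k z - 1) \<le> \<epsilon>1" using z s t by (intro T1(2)) auto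
      qed
      then have "norm (deriv (R k) s / P s) \<le> \<epsilon>1 / p"
        unfolding norm_divide using ps p \<epsilon>1 by (intro frac_le) auto
      moreover have "norm (of_nat k * R k s * deriv P s / P s ^ 2) \<le> \<epsilon> / 2"
      proof -
        have "norm (R k s) \<le> 2" using Rs \<epsilon>1 norm_triangle_ineq[of "R k s - 1" 1] by simp
        then have "norm (of_nat k * R k s * deriv P s / P s ^ 2) \<le> real k * 2 * \<epsilon>2 / p\<^sup>2"
          unfolding norm_divide norm_mult norm_power norm_of_nat
          using T3(2)[OF sB] t ps p(1) \<epsilon>2 by (intro frac_le mult_mono power_mono) auto
        also have "\<dots> = \<epsilon> / 2 * (real k / real (Suc k))" using p(1) by (simp add: \<epsilon>2_def field_simps del: of_nat_Suc)
        also have "\<dots> \<le> \<epsilon> / 2 * 1" using Suc.prems by (intro mult_left_mono) auto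
        finally show ?thesis by simp
      qed
      moreover have "\<epsilon>1 + \<epsilon>1 / p \<le> \<epsilon> / 2" using \<epsilon>1(3) by (simp add: distrib_left)
      moreover have "norm (R (Suc k) s - 1) \<le> norm (R k s - 1) + norm (deriv (R k) s / P s)
          + norm (of_nat k * R k s * deriv P s / P s ^ 2)"
      proof -
        have "T0 < Im s" using t T1 by linarith
        have tri: "norm (x + y + z) \<le> norm x + norm y + norm z" for x y z :: complex
          using norm_triangle_ineq[of "x + y" z] norm_triangle_ineq[of x y] by linarith
        show ?thesis unfolding R_Suc[OF \<open>T0 < Im s\<close> P0] by (rule tri)
      qed
      ultimately show ?thesis using Rs by linarith
    qed
    then show "\<exists>T1>T0. \<forall>s. \<sigma>1 + 1 \<le> Re s \<longrightarrow> Re s \<le> \<sigma>2 \<longrightarrow> T1 \<le> Im s \<longrightarrow> norm (R (Suc k) s - 1) \<le> \<epsilon>"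
      using T1 T2 T3 by (intro exI[of _ T4]) (auto simp: T4_def)
  qed
qed

lemma right_region:
  obtains p \<epsilon> \<sigma>1 where "0 < p" "\<epsilon> = 1 \<or> \<epsilon> = -1"
    "\<And>\<sigma>. \<exists>T1>T0. \<forall>s. \<sigma>1 \<le> Re s \<longrightarrow> Re s \<le> \<sigma> \<longrightarrow> T1 \<le> Im s \<longrightarrow>
       p \<le> \<epsilon> * Re (P s) \<and> norm (R k s - 1) \<le> 1 / 2"
proof -
  obtain p e where p: "0 < p" "e = 1 \<or> e = -1"
    "\<And>B. \<exists>T1>T0. \<forall>s. \<bar>Re s\<bar> \<le> B \<longrightarrow> T1 \<le> Im s \<longrightarrow> p \<le> e * Re (P s)" using P_lower by blast
  obtain \<sigma>1 where \<sigma>1: "\<And>\<sigma>2. \<exists>T1>T0. \<forall>s. \<sigma>1 \<le> Re s \<longrightarrow> Re s \<le> \<sigma>2 \<longrightarrow> T1 \<le> Im s \<longrightarrow> norm (R k s - 1) \<le> 1 / 2"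
    using R_right[of "1 / 2" k] by auto
  show ?thesis
  proof (rule that[OF p(1,2)])
    fix \<sigma> :: real
    obtain T1 where T1: "T0 < T1" "\<And>s. \<sigma>1 \<le> Re s \<Longrightarrow> Re s \<le> \<sigma> \<Longrightarrow> T1 \<le> Im s \<Longrightarrow> norm (R k s - 1) \<le> 1 / 2"
      using \<sigma>1[of \<sigma>] by blast
    obtain T2 where T2: "T0 < T2" "\<And>s. \<bar>Re s\<bar> \<le> \<bar>\<sigma>1\<bar> + \<bar>\<sigma>\<bar> \<Longrightarrow> T2 \<le> Im s \<Longrightarrow> p \<le> e * Re (P s)"
      using p(3)[of "\<bar>\<sigma>1\<bar> + \<bar>\<sigma>\<bar>"] by blast
    show "\<exists>T1>T0. \<forall>s. \<sigma>1 \<le> Re s \<longrightarrow> Re s \<le> \<sigma> \<longrightarrow> T1 \<le> Im s \<longrightarrow>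
       p \<le> e * Re (P s) \<and> norm (R k s - 1) \<le> 1 / 2"
    proof (intro exI[of _ "max T1 T2"] conjI allI impI)
      fix s assume s: "\<sigma>1 \<le> Re s" "Re s \<le> \<sigma>" "max T1 T2 \<le> Im s"
      show "norm (R k s - 1) \<le> 1 / 2" using T1(2)[OF s(1,2)] s by simp
      show "p \<le> e * Re (P s)" by (rule T2(2)) (use s in auto)
    qed (use T1 in auto)
  qed
qed

section \<open>The logarithmic derivative on the sides of the rectangle\<close>

definition "L k s = deriv (Fk k) s / Fk k s"

lemma Fk_eq_R: "P s \<noteq> 0 \<Longrightarrow> Fk k s = P s ^ k * R k s"
  by (simp add: R_def)

text \<open>Both \<open>\<epsilon> * P\<close> and \<open>R k\<close> lie in the right half-plane,
  so principal logarithms are holomorphic and no branch has to be followed. The constant sign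
  \<open>\<epsilon>\<close> does not affect the derivative.\<close>

lemma L_primitive_right:
  assumes "T0 < Im s" "0 < \<epsilon> * Re (P s)" "norm (R k s - 1) \<le> 1 / 2" "\<epsilon> = 1 \<or> \<epsilon> = (-1 :: real)"
  shows "((\<lambda>s. of_nat k * Ln (of_real \<epsilon> * P s) + Ln (R k s)) has_field_derivative L k s) (at s)"
proof -
  have P0: "P s \<noteq> 0" using assms by auto
  have \<epsilon>: "of_real \<epsilon> \<noteq> (0::complex)" using assms by auto
  have n1: "of_real \<epsilon> * P s \<notin> \<real>\<^sub>\<le>\<^sub>0" using assms(2) by (auto simp: complex_nonpos_Reals_iff)
  have "\<bar>Re (R k s) - 1\<bar> \<le> 1 / 2" using abs_Re_le_cmod[of "R k s - 1"] assms by simp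
  then have Rp: "Re (R k s) > 0" by linarith
  then have n2: "R k s \<notin> \<real>\<^sub>\<le>\<^sub>0" and R0: "R k s \<noteq> 0" by (auto simp: complex_nonpos_Reals_iff)
  have F0: "Fk k s \<noteq> 0" using R0 P0 Fk_eq_R by simp
  let ?R' = "deriv (Fk k) s / P s ^ k - of_nat k * R k s * deriv P s / P s"
  have "((\<lambda>s. of_nat k * Ln (of_real \<epsilon> * P s) + Ln (R k s)) has_field_derivative
      of_nat k * (inverse (of_real \<epsilon> * P s) * (of_real \<epsilon> * deriv P s)) + inverse (R k s) * ?R') (at s)"
  proof (intro DERIV_add DERIV_cmult)
    show "((\<lambda>s. Ln (of_real \<epsilon> * P s)) has_field_derivative
        inverse (of_real \<epsilon> * P s) * (of_real \<epsilon> * deriv P s)) (at s)"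
      by (rule DERIV_chain2[where f = Ln and g = "\<lambda>s. of_real \<epsilon> * P s", OF has_field_derivative_Ln[OF n1]])
        (intro DERIV_cmult P_deriv assms)
    show "((\<lambda>s. Ln (R k s)) has_field_derivative inverse (R k s) * ?R') (at s)"
      by (rule DERIV_chain2[where f = Ln and g = "R k", OF has_field_derivative_Ln[OF n2]])
        (intro R_has_derivative assms P0)
  qed
  moreover have "of_nat k * (inverse (of_real \<epsilon> * P s) * (of_real \<epsilon> * deriv P s)) + inverse (R k s) * ?R' = L k s"
  proof -
    have "inverse (R k s) * (deriv (Fk k) s / P s ^ k) = L k s"
      using P0 F0 by (simp add: L_def R_def field_simps)
    then show ?thesis using P0 R0 \<epsilon> by (simp add: field_simps)
  qed
  ultimately show ?thesis by simp
qed

lemma abs_Im_Ln_le: "z \<noteq> 0 \<Longrightarrow> \<bar>Im (Ln z)\<bar> \<le> pi"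
  using mpi_less_Im_Ln[of z] Im_Ln_le_pi[of z] by auto

text \<open>Logarithmic derivative of \<open>Fk_FE\<close>: the sign (-1)^k drops out,
  \<open>H\<close> contributes \<open>\<psi>\<close>, and the reflected factor contributes with a
  minus sign.\<close>

lemma L_reflect:
  assumes s: "T0 < Im s" "Fk k (1 - cnj s) \<noteq> 0"
  shows "L k s = \<psi> s - cnj (L k (1 - cnj s))"
  unfolding L_def
  by (subst Fk_refl_deriv[OF s(1) Fk_FE], assumption, subst Fk_FE[OF s(1)])
    (use s H_nz[OF s(1)] in \<open>simp add: field_simps\<close>)

text \<open>The derivative of the expression inside the absolute value is Re \<psi> + d ln t + C0 =
  O(1/t), because d(t ln t - t) + C0 t is a primitive of d ln t + C0. Comparing with \<plusminus> C
  ln t by monotonicity gives the bound.\<close>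

lemma log_H_asymp:
  assumes h: "\<And>s. T0 < Im s \<Longrightarrow> (h has_field_derivative \<psi> s) (at s)"
  shows "\<exists>K T1. \<forall>t\<ge>T1. \<bar>Im (h (Complex x t)) + (d * (t * ln t - t) + C0 * t)\<bar> \<le> K * ln t"
proof -
  obtain C T1 where C: "\<And>s. \<bar>Re s\<bar> \<le> \<bar>x\<bar> \<Longrightarrow> T1 \<le> Im s \<Longrightarrow>
      norm (\<psi> s + of_real (d * ln (Im s) + C0)) \<le> C / Im s"
    using \<psi>_asymp by metis
  define T2 where "T2 = max (max T1 3) (T0 + 1)"
  define D where "D = (\<lambda>t. Im (h (Complex x t)) + (d * (t * ln t - t) + C0 * t))"
  have D: "(D has_real_derivative (Re (\<psi> (Complex x t)) + (d * ln t + C0))) (at t)" if t: "T2 \<le> t" for t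
  proof -
    have t': "T0 < t" "0 < t" using t by (auto simp: T2_def)
    have "((\<lambda>t. h (Complex x t)) has_vector_derivative \<i> * \<psi> (Complex x t)) (at t)"
    proof -
      have "((\<lambda>t. Complex x t) has_vector_derivative \<i>) (at t)"
        unfolding Complex_eq by (auto intro!: derivative_eq_intros simp: has_vector_derivative_def scaleR_conv_of_real mult.commute)
      then show ?thesis
        using field_vector_diff_chain_at[of "\<lambda>t. Complex x t" \<i> t h "\<psi> (Complex x t)"] h[of "Complex x t"] t'
        by (simp add: o_def)
    qed
    then have "((\<lambda>t. Im (h (Complex x t))) has_real_derivative Im (\<i> * \<psi> (Complex x t))) (at t)"
      unfolding has_real_derivative_iff_has_vector_derivative by (rule bounded_linear.has_vector_derivative[OF bounded_linear_Im])
    then show ?thesis unfolding D_def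
      by (rule DERIV_add[THEN DERIV_cong]) (use t' in \<open>auto intro!: derivative_eq_intros simp: algebra_simps\<close>)
  qed
  have bd: "\<bar>Re (\<psi> (Complex x t)) + (d * ln t + C0)\<bar> \<le> C / t" if "T2 \<le> t" for t
    using C[of "Complex x t"] that abs_Re_le_cmod[of "\<psi> (Complex x t) + of_real (d * ln t + C0)"]
    by (simp add: T2_def)
  have "\<bar>D t\<bar> \<le> (\<bar>D T2\<bar> + \<bar>C\<bar>) * ln t" if t: "T2 \<le> t" for t
  proof -
    have pos: "u > 0" if "T2 \<le> u" for u using that by (simp add: T2_def)
    have "D t - C * ln t \<le> D T2 - C * ln T2"
    proof (rule DERIV_nonpos_imp_nonincreasing[OF t])
      fix u assume u: "T2 \<le> u" "u \<le> t"
      have "((\<lambda>u. D u - C * ln u) has_real_derivative (Re (\<psi> (Complex x u)) + (d * ln u + C0)) - C * (1 / u)) (at u)"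
        using pos[OF u(1)] by (intro DERIV_diff D DERIV_cmult u DERIV_ln_divide)
      then show "\<exists>y. ((\<lambda>u. D u - C * ln u) has_real_derivative y) (at u) \<and> y \<le> 0"
        using bd[OF u(1)] by (intro exI conjI) auto
    qed
    moreover have "D T2 + C * ln T2 \<le> D t + C * ln t"
    proof (rule DERIV_nonneg_imp_nondecreasing[OF t])
      fix u assume u: "T2 \<le> u" "u \<le> t"
      have "((\<lambda>u. D u + C * ln u) has_real_derivative (Re (\<psi> (Complex x u)) + (d * ln u + C0)) + C * (1 / u)) (at u)"
        using pos[OF u(1)] by (intro DERIV_add D DERIV_cmult u DERIV_ln_divide)
      then show "\<exists>y. ((\<lambda>u. D u + C * ln u) has_real_derivative y) (at u) \<and> 0 \<le> y"
        using bd[OF u(1)] by (intro exI conjI) auto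
    qed
    moreover have C0': "C \<ge> 0" using bd[of T2] pos[of T2] by (smt (verit) divide_less_0_iff order_refl)
    have "exp 1 \<le> T2" using exp_le by (simp add: T2_def)
    then have l: "1 \<le> ln T2" using pos[of T2] by (subst ln_ge_iff) auto
    have l2: "ln T2 \<le> ln t" using t pos[of T2] by simp
    have "0 \<le> C * ln T2" using C0' l by simp
    moreover have "\<bar>D T2\<bar> * 1 \<le> \<bar>D T2\<bar> * ln t" using l l2 by (intro mult_left_mono) auto
    ultimately show ?thesis using C0' by (simp add: distrib_right abs_le_iff)
  qed
  then show ?thesis unfolding D_def by blast
qed

text \<open>This is (d(t ln t - t) + C0 t)/(2 pi), that is, up to O(log t), minus the argument of
  \<open>H\<close> divided by 2 pi. It exhibits c_F as (C0 - d)/(2 pi).\<close>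

definition "main_term t = d / (2 * pi) * t * ln t + (C0 - d) / (2 * pi) * t"

text \<open>The discs are centred at the right end of the side, where \<open>Fk k\<close> is bounded
  below by c. Polynomial growth then makes the ratio M in \<open>arg_variation_segment\<close> a
  constant times a power of T, and its logarithm is O(log T).\<close>

lemma horizontal_side:
  assumes \<sigma>: "1 \<le> \<sigma>" and c: "0 < c" "T0 < T1" "\<And>s. Re s = \<sigma> \<Longrightarrow> T1 \<le> Im s \<Longrightarrow> c \<le> norm (Fk k s)"
  shows "\<exists>K T2. \<forall>T\<ge>T2. (\<forall>z\<in>closed_segment (Complex \<sigma> T) (Complex (1 - \<sigma>) T). Fk k z \<noteq> 0) \<longrightarrow>
    \<bar>Im (contour_integral (linepath (Complex \<sigma> T) (Complex (1 - \<sigma>) T)) (L k))\<bar> \<le> K * ln T"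
proof -
  \<comment> \<open>Twice the length 2\<sigma> - 1 of the side, so that the far endpoint lies in the
    disc of radius r/2.\<close>
  define r where "r = 2 * (2 * \<sigma> - 1)"
  have r: "r \<ge> 2" using \<sigma> by (simp add: r_def)
  obtain N T3 where N: "T0 < T3" "3 \<le> T3"
    "\<And>s. \<bar>Re s\<bar> \<le> \<sigma> + 3 * r \<Longrightarrow> T3 \<le> Im s \<Longrightarrow> norm (Fk k s) \<le> Im s ^ N"
    using Fk_growth[of k] unfolding poly_growth_def by metis
  define A where "A = 2 * real N + \<bar>ln c\<bar>"
  define K where "K = pi / ln 2 * A + 4 * (A + 1)"
  define T2 where "T2 = max T1 (T3 + 3 * r)"
  have "\<bar>Im (contour_integral (linepath (Complex \<sigma> T) (Complex (1 - \<sigma>) T)) (L k))\<bar> \<le> K * ln T"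
    if T: "T2 \<le> T" and nz: "\<forall>z\<in>closed_segment (Complex \<sigma> T) (Complex (1 - \<sigma>) T). Fk k z \<noteq> 0" for T
  proof -
    have t: "T1 \<le> T" "T3 + 3 * r \<le> T" using T by (auto simp: T2_def)
    then have t3: "3 \<le> T" "3 * r \<le> T" using N r by auto
    have "exp 1 \<le> T" using exp_le t3 by linarith
    then have l1: "1 \<le> ln T" using t3 by (subst ln_ge_iff) auto
    define M where "M = (2 * T) ^ N / c"
    let ?z = "Complex \<sigma> T"
    have F0: "c \<le> norm (Fk k ?z)" using c t by simp
    have disc: "Re z \<le> \<sigma> + 3 * r" "\<sigma> - 3 * r \<le> Re z" "T3 \<le> Im z" "Im z \<le> 2 * T"
      if "z \<in> cball ?z (3 * r)" for z
      using that abs_Re_le_cmod[of "?z - z"] abs_Im_le_cmod[of "?z - z"] t t3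
      by (auto simp: dist_norm)
    have M: "norm (Fk k z) \<le> M * norm (Fk k ?z)" if z: "z \<in> cball ?z (3 * r)" for z
    proof -
      have "\<bar>Re z\<bar> \<le> \<sigma> + 3 * r" using disc(1,2)[OF z] \<sigma> by (simp add: abs_le_iff)
      then have "norm (Fk k z) \<le> Im z ^ N" using disc(3)[OF z] by (rule N(3))
      also have "\<dots> \<le> (2 * T) ^ N" using disc[OF z] N by (intro power_mono) auto
      also have "\<dots> = M * c" using c by (simp add: M_def)
      also have "\<dots> \<le> M * norm (Fk k ?z)" using F0 c t3 by (intro mult_left_mono) (auto simp: M_def)
      finally show ?thesis .
    qed
    have "\<bar>Im (contour_integral (linepath ?z (Complex (1 - \<sigma>) T)) (\<lambda>z. deriv (Fk k) z / Fk k z))\<bar>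
        \<le> pi * log 2 M + 4 * (ln M + 1)"
    proof (rule arg_variation_segment[OF open_U _ _ Fk_holo _ M])
      show "cball ?z (3 * r) \<subseteq> {s. T0 < Im s}" using disc(3) N by fastforce
      show "Fk k ?z \<noteq> 0" using F0 c by auto
      have "?z - Complex (1 - \<sigma>) T = of_real (2 * \<sigma> - 1)" by (simp add: complex_eq_iff)
      then have "dist ?z (Complex (1 - \<sigma>) T) = \<bar>2 * \<sigma> - 1\<bar>" by (metis dist_norm norm_of_real)
      then show "Complex (1 - \<sigma>) T \<in> cball ?z (r / 2)" using \<sigma> by (simp add: r_def)
    qed (use r nz in auto)
    also have "\<dots> = pi / ln 2 * ln M + 4 * (ln M + 1)" by (simp add: log_def)
    also have "\<dots> \<le> pi / ln 2 * (A * ln T) + 4 * (A * ln T + ln T)"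
    proof -
      have "ln M = real N * (ln 2 + ln T) - ln c"
        using c t3 by (simp add: M_def ln_div ln_realpow ln_mult distrib_left)
      also have "\<dots> \<le> real N * (2 * ln T) + \<bar>ln c\<bar> * ln T"
      proof -
        have "ln 2 \<le> ln T" using t3 by simp
        then have "real N * (ln 2 + ln T) \<le> real N * (2 * ln T)" by (intro mult_left_mono) auto
        moreover have "\<bar>ln c\<bar> * 1 \<le> \<bar>ln c\<bar> * ln T" using l1 by (intro mult_left_mono) auto
        ultimately show ?thesis by linarith
      qed
      also have "\<dots> = A * ln T" by (simp add: A_def algebra_simps)
      finally have "ln M \<le> A * ln T" .
      moreover have "0 \<le> pi / ln 2" by simp
      ultimately show ?thesis using l1 by (intro add_mono mult_left_mono) auto
    qed
    also have "\<dots> = K * ln T" by (simp add: K_def algebra_simps)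
    finally show ?thesis by (simp add: L_def[abs_def])
  qed
  then show ?thesis by blast
qed

lemma right_primitive_bound:
  assumes "0 < \<epsilon> * Re (P s)" "norm (R k s - 1) \<le> 1 / 2" "\<epsilon> = 1 \<or> \<epsilon> = (-1 :: real)"
  shows "\<bar>Im (of_nat k * Ln (of_real \<epsilon> * P s) + Ln (R k s))\<bar> \<le> (real k + 1) * pi"
proof -
  have "of_real \<epsilon> * P s \<noteq> 0" using assms by auto
  moreover have "R k s \<noteq> 0" using assms(2) by auto
  ultimately have "\<bar>Im (Ln (of_real \<epsilon> * P s))\<bar> \<le> pi" and 2: "\<bar>Im (Ln (R k s))\<bar> \<le> pi"
    using abs_Im_Ln_le by auto
  then have "real k * \<bar>Im (Ln (of_real \<epsilon> * P s))\<bar> \<le> real k * pi" by (intro mult_left_mono) auto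
  then have "\<bar>Im (of_nat k * Ln (of_real \<epsilon> * P s))\<bar> \<le> real k * pi" by (simp add: abs_mult)
  then show ?thesis using 2 by (simp add: distrib_right)
qed

lemma right_side:
  assumes "\<epsilon> = 1 \<or> \<epsilon> = (-1 :: real)" "T0 < T1" "T1 \<le> T"
    and reg: "\<And>s. Re s = \<sigma> \<Longrightarrow> T1 \<le> Im s \<Longrightarrow> 0 < \<epsilon> * Re (P s) \<and> norm (R k s - 1) \<le> 1 / 2"
  obtains I where "(L k has_contour_integral I) (linepath (Complex \<sigma> T1) (Complex \<sigma> T))"
    "\<bar>Im I\<bar> \<le> 2 * ((real k + 1) * pi)"
proof -
  let ?\<Phi> = "\<lambda>s. of_nat k * Ln (of_real \<epsilon> * P s) + Ln (R k s)"
  let ?S = "closed_segment (Complex \<sigma> T1) (Complex \<sigma> T)"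
  have S: "Re s = \<sigma>" "T1 \<le> Im s" if "s \<in> ?S" for s
    using that \<open>T1 \<le> T\<close> by (auto simp: closed_segment_same_Re closed_segment_eq_real_ivl)
  have "(?\<Phi> has_field_derivative L k s) (at s within ?S)" if "s \<in> ?S" for s
    by (rule has_field_derivative_at_within[OF L_primitive_right])
      (use S[OF that] reg[OF S[OF that]] assms in auto)
  then have "(L k has_contour_integral (?\<Phi> (Complex \<sigma> T) - ?\<Phi> (Complex \<sigma> T1))) (linepath (Complex \<sigma> T1) (Complex \<sigma> T))"
    using contour_integral_primitive[of ?S ?\<Phi> "L k" "linepath (Complex \<sigma> T1) (Complex \<sigma> T)"] by simp
  moreover have "\<bar>Im (?\<Phi> (Complex \<sigma> t))\<bar> \<le> (real k + 1) * pi" if "T1 \<le> t" for t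
    by (rule right_primitive_bound) (use reg[of "Complex \<sigma> t"] that assms in auto)
  from this[of T] this[of T1] have "\<bar>Im (?\<Phi> (Complex \<sigma> T) - ?\<Phi> (Complex \<sigma> T1))\<bar> \<le> 2 * ((real k + 1) * pi)"
    using \<open>T1 \<le> T\<close> unfolding minus_complex.sel by linarith
  ultimately show ?thesis using that by blast
qed

text \<open>By \<open>L_reflect\<close> a primitive on the left is \<open>h\<close> plus the
  reflected primitive from the right. The latter has bounded imaginary part, so only the argument of
  \<open>H\<close> remains; the side is traversed downwards, which makes the main term
  positive.\<close>

lemma left_side:
  assumes "\<epsilon> = 1 \<or> \<epsilon> = (-1 :: real)" "T0 < T1"
    and reg: "\<And>s. Re s = \<sigma> \<Longrightarrow> T1 \<le> Im s \<Longrightarrow> 0 < \<epsilon> * Re (P s) \<and> norm (R k s - 1) \<le> 1 / 2"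
  shows "\<exists>K T2. \<forall>T\<ge>T2. \<exists>I. (L k has_contour_integral I) (linepath (Complex (1 - \<sigma>) T) (Complex (1 - \<sigma>) T1)) \<and>
    \<bar>Im I - 2 * pi * main_term T\<bar> \<le> K * ln T"
proof -
  obtain h where hH: "\<And>s. T0 < Im s \<Longrightarrow> H s = exp (h s)"
    "\<And>s. T0 < Im s \<Longrightarrow> (h has_field_derivative \<psi> s) (at s)"
    using H_log by blast
  note h = hH(2)
  obtain K T3 where K: "\<And>t. T3 \<le> t \<Longrightarrow>
      \<bar>Im (h (Complex (1 - \<sigma>) t)) + (d * (t * ln t - t) + C0 * t)\<bar> \<le> K * ln t"
    using log_H_asymp[OF h, of "1 - \<sigma>"] by blast
  let ?\<Phi> = "\<lambda>s. of_nat k * Ln (of_real \<epsilon> * P s) + Ln (R k s)"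
  let ?\<Psi> = "\<lambda>s. h s + cnj (?\<Phi> (1 - cnj s))"
  define c where "c = \<bar>Im (h (Complex (1 - \<sigma>) T1))\<bar> + 2 * ((real k + 1) * pi)"
  have "\<exists>I. (L k has_contour_integral I) (linepath (Complex (1 - \<sigma>) T) (Complex (1 - \<sigma>) T1)) \<and>
      \<bar>Im I - 2 * pi * main_term T\<bar> \<le> (K + c) * ln T" if T: "max (max T1 3) T3 \<le> T" for T
  proof -
    let ?a = "Complex (1 - \<sigma>) T" and ?b = "Complex (1 - \<sigma>) T1"
    have t: "T1 \<le> T" "3 \<le> T" "T3 \<le> T" using T by auto
    have "exp 1 \<le> T" using exp_le t by linarith
    then have l1: "1 \<le> ln T" using t by (subst ln_ge_iff) auto
    have S: "Re s = 1 - \<sigma>" "T1 \<le> Im s" if "s \<in> closed_segment ?a ?b" for s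
      using that t by (auto simp: closed_segment_same_Re closed_segment_eq_real_ivl split: if_splits)
    have "(?\<Psi> has_field_derivative L k s) (at s within closed_segment ?a ?b)" if s: "s \<in> closed_segment ?a ?b" for s
    proof (rule has_field_derivative_at_within)
      have im: "T0 < Im s" using S[OF s] assms by simp
      define w where "w = 1 - cnj s"
      have w: "Re w = \<sigma>" "T1 \<le> Im w" "T0 < Im w" using S[OF s] im by (auto simp: w_def)
      have "(?\<Phi> has_field_derivative L k w) (at w)"
        by (rule L_primitive_right) (use reg[OF w(1,2)] w assms in auto)
      then have "((\<lambda>s. cnj (?\<Phi> (1 - cnj s))) has_field_derivative - cnj (L k w)) (at s)"
        unfolding w_def by (rule has_field_derivative_reflect)
      from DERIV_add[OF h[OF im] this]
      have "(?\<Psi> has_field_derivative (\<psi> s - cnj (L k w))) (at s)" by simp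
      moreover have "Fk k w \<noteq> 0"
      proof -
        have "P w \<noteq> 0" using reg[OF w(1,2)] by auto
        moreover have "R k w \<noteq> 0" using reg[OF w(1,2)] by auto
        ultimately show ?thesis using Fk_eq_R by simp
      qed
      ultimately show "(?\<Psi> has_field_derivative L k s) (at s)"
        using L_reflect[OF im] unfolding w_def by simp
    qed
    then have I: "(L k has_contour_integral (?\<Psi> ?b - ?\<Psi> ?a)) (linepath ?a ?b)"
      using contour_integral_primitive[of "closed_segment ?a ?b" ?\<Psi> "L k" "linepath ?a ?b"] by simp
    have b: "\<bar>Im (?\<Phi> (1 - cnj (Complex (1 - \<sigma>) t)))\<bar> \<le> (real k + 1) * pi" if "T1 \<le> t" for t
      by (rule right_primitive_bound) (use reg[of "1 - cnj (Complex (1 - \<sigma>) t)"] that assms in auto)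
    have main: "2 * pi * main_term T = d * (T * ln T - T) + C0 * T"
      by (simp add: main_term_def field_simps)
    have "Im (?\<Psi> ?b - ?\<Psi> ?a) = Im (h ?b) - Im (h ?a) - Im (?\<Phi> (1 - cnj ?b)) + Im (?\<Phi> (1 - cnj ?a))"
      by simp
    then have "\<bar>Im (?\<Psi> ?b - ?\<Psi> ?a) - 2 * pi * main_term T\<bar> \<le> K * ln T + c"
      unfolding main c_def using K[OF t(3)] b[OF t(1)] b[OF order_refl] by linarith
    also have "c \<le> c * ln T" using l1 mult_left_mono[OF l1, of c] by (simp add: c_def)
    finally show ?thesis using I by (auto simp: distrib_right)
  qed
  then show ?thesis by blast
qed

section \<open>The argument principle and the count above a fixed height\<close>

lemma zeros_finite:
  assumes K: "compact K" "K \<subseteq> {s. T0 < Im s}" and w: "T0 < Im w" "Fk k w \<noteq> 0"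
  shows "finite {z\<in>K. Fk k z = 0}"
proof (rule ccontr)
  assume inf: "infinite {z\<in>K. Fk k z = 0}"
  have "{z\<in>K. Fk k z = 0} \<subseteq> K" by blast
  with inf K(1) obtain x where x: "x \<in> K" "x islimpt {z\<in>K. Fk k z = 0}"
    unfolding compact_eq_Bolzano_Weierstrass by meson
  have "Fk k w = 0"
  proof (rule analytic_continuation[OF Fk_holo open_U])
    show "connected {s. T0 < Im s}" by (rule convex_connected[OF convex_halfspace_Im_gt])
    show "{z\<in>K. Fk k z = 0} \<subseteq> {s. T0 < Im s}" "x \<in> {s. T0 < Im s}" using K(2) x(1) by auto
    show "x islimpt {z\<in>K. Fk k z = 0}" by (rule x(2))
  qed (use w in auto)
  then show False using w by simp
qed

text \<open>The argument principle is applied on a slightly larger open rectangle still above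
  \<open>T0\<close>. Zeros in it but outside the contour have winding number 0, those inside have
  winding number 1.\<close>

lemma argument_principle_rect:
  assumes \<sigma>: "1 \<le> \<sigma>" "T0 < T1" "T1 < T"
    and nz: "\<And>z. z \<in> cbox (Complex (1 - \<sigma>) T1) (Complex \<sigma> T) - box (Complex (1 - \<sigma>) T1) (Complex \<sigma> T) \<Longrightarrow> Fk k z \<noteq> 0"
  shows "contour_integral (rectpath (Complex (1 - \<sigma>) T1) (Complex \<sigma> T)) (L k) =
    2 * pi * \<i> * of_int (\<Sum>\<rho> | 1 - \<sigma> < Re \<rho> \<and> Re \<rho> < \<sigma> \<and> T1 < Im \<rho> \<and> Im \<rho> < T \<and> Fk k \<rho> = 0. zorder (Fk k) \<rho>)"
proof -
  let ?a = "Complex (1 - \<sigma>) T1" and ?b = "Complex \<sigma> T"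
  let ?g = "rectpath ?a ?b"
  define u where "u = Complex (- \<sigma>) ((T0 + T1) / 2)"
  define v where "v = Complex (\<sigma> + 1) (T + 1)"
  define S where "S = box u v"
  \<comment> \<open>The disjunct \<open>w \<in> {}\<close> is the empty set of poles; likewise the
    factor 1 below is the constant weight in the general argument principle.\<close>
  define pz where "pz = {w \<in> S. Fk k w = 0 \<or> w \<in> {}}"
  define Z where "Z = {\<rho>. 1 - \<sigma> < Re \<rho> \<and> Re \<rho> < \<sigma> \<and> T1 < Im \<rho> \<and> Im \<rho> < T \<and> Fk k \<rho> = 0}"
  have cU: "cbox u v \<subseteq> {s. T0 < Im s}"
    using \<sigma> by (auto simp: in_cbox_complex_iff u_def v_def)
  have Fa: "Fk k ?a \<noteq> 0" by (rule nz) (use \<sigma> in \<open>auto simp: in_cbox_complex_iff in_box_complex_iff\<close>)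
  have SU: "S \<subseteq> {s. T0 < Im s}" using cU box_subset_cbox unfolding S_def by blast
  have cS: "cbox ?a ?b \<subseteq> S"
    using \<sigma> by (auto simp: in_cbox_complex_iff in_box_complex_iff S_def u_def v_def)
  have fin: "finite pz"
  proof (rule finite_subset)
    show "pz \<subseteq> {z \<in> cbox u v. Fk k z = 0}" unfolding pz_def S_def using box_subset_cbox by blast
    show "finite {z \<in> cbox u v. Fk k z = 0}"
      by (rule zeros_finite[OF compact_cbox cU _ Fa]) (use \<sigma> in auto)
  qed
  have "contour_integral ?g (\<lambda>x. deriv (Fk k) x * 1 / Fk k x) =
      2 * pi * \<i> * (\<Sum>p\<in>pz. winding_number ?g p * 1 * zorder (Fk k) p)"
    unfolding pz_def
  proof (rule argument_principle)
    show "open S" "connected S" by (simp_all add: S_def convex_connected open_box)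
    show "Fk k holomorphic_on S - {}" using Fk_holo SU by (auto intro: holomorphic_on_subset)
    show "path_image ?g \<subseteq> S - {w \<in> S. Fk k w = 0 \<or> w \<in> {}}"
      using nz cS \<sigma> by (auto simp: path_image_rectpath_cbox_minus_box)
    show "\<forall>z. z \<notin> S \<longrightarrow> winding_number ?g z = 0"
      using cS \<sigma> by (intro allI impI winding_number_rectpath_outside) auto
    show "finite {w \<in> S. Fk k w = 0 \<or> w \<in> {}}" using fin by (simp add: pz_def)
  qed auto
  also have "(\<Sum>p\<in>pz. winding_number ?g p * 1 * zorder (Fk k) p) = (\<Sum>p\<in>Z. of_int (zorder (Fk k) p))"
  proof (rule sum.mono_neutral_cong_right[OF fin])
    have "Z \<subseteq> box ?a ?b" by (auto simp: Z_def in_box_complex_iff)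
    then show "Z \<subseteq> pz" using cS box_subset_cbox[of ?a ?b] by (auto simp: pz_def Z_def)
    show "winding_number ?g p * 1 * zorder (Fk k) p = of_int (zorder (Fk k) p)" if "p \<in> Z" for p
    proof -
      have "winding_number ?g p = 1"
        by (rule winding_number_rectpath) (use that in \<open>auto simp: Z_def in_box_complex_iff\<close>)
      then show ?thesis by simp
    qed
    show "\<forall>p\<in>pz - Z. winding_number ?g p * 1 * zorder (Fk k) p = 0"
    proof
      fix p assume p: "p \<in> pz - Z"
      then have "p \<notin> box ?a ?b" "Fk k p = 0" by (auto simp: Z_def pz_def in_box_complex_iff)
      then have "p \<notin> cbox ?a ?b" using nz by auto
      then have "winding_number ?g p = 0"
        by (intro winding_number_rectpath_outside) (use \<sigma> in auto)
      then show "winding_number ?g p * 1 * zorder (Fk k) p = 0" by simp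
    qed
  qed
  finally show ?thesis by (simp add: Z_def L_def[abs_def])
qed

text \<open>Adds up the four sides for heights T without zeros on the top edge. The bottom side is
  fixed, the right side bounded, the top O(log T), and the left side carries the main term.\<close>

lemma zero_count_generic:
  assumes \<sigma>: "1 \<le> \<sigma>" "T0 < T1" and \<epsilon>: "\<epsilon> = 1 \<or> \<epsilon> = (-1 :: real)" "0 < p"
    and reg: "\<And>s. Re s = \<sigma> \<Longrightarrow> T1 \<le> Im s \<Longrightarrow> p \<le> \<epsilon> * Re (P s) \<and> norm (R k s - 1) \<le> 1 / 2"
    and bot: "\<And>z. 1 - \<sigma> \<le> Re z \<Longrightarrow> Re z \<le> \<sigma> \<Longrightarrow> Im z = T1 \<Longrightarrow> Fk k z \<noteq> 0"
  shows "\<exists>K T2. \<forall>T\<ge>T2. (\<forall>z. 1 - \<sigma> \<le> Re z \<longrightarrow> Re z \<le> \<sigma> \<longrightarrow> Im z = T \<longrightarrow> Fk k z \<noteq> 0) \<longrightarrow>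
    \<bar>of_int (\<Sum>\<rho> | 1 - \<sigma> < Re \<rho> \<and> Re \<rho> < \<sigma> \<and> T1 < Im \<rho> \<and> Im \<rho> < T \<and> Fk k \<rho> = 0. zorder (Fk k) \<rho>)
      - main_term T\<bar> \<le> K * ln T"
proof -
  have reg': "0 < \<epsilon> * Re (P s) \<and> norm (R k s - 1) \<le> 1 / 2" if "Re s = \<sigma>" "T1 \<le> Im s" for s
    using reg[OF that] \<epsilon>(2) by auto
  have low: "p ^ k / 2 \<le> norm (Fk k s)" if "Re s = \<sigma>" "T1 \<le> Im s" for s
  proof -
    have a: "p \<le> norm (P s)" using reg[OF that] \<epsilon>(1) abs_Re_le_cmod[of "P s"] by auto
    have b: "1 / 2 \<le> norm (R k s)" using reg[OF that] norm_triangle_ineq2[of 1 "1 - R k s"]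
      by (simp add: norm_minus_commute)
    have "p ^ k * (1 / 2) \<le> norm (P s) ^ k * norm (R k s)"
      using a b \<epsilon>(2) by (intro mult_mono power_mono) auto
    moreover have "P s \<noteq> 0" using a \<epsilon>(2) by auto
    ultimately show ?thesis by (simp add: Fk_eq_R norm_mult norm_power)
  qed
  have low0: "0 < p ^ k / 2" using \<epsilon>(2) by simp
  obtain K1 T2 where K1: "\<And>T. T2 \<le> T \<Longrightarrow> (\<forall>z\<in>closed_segment (Complex \<sigma> T) (Complex (1 - \<sigma>) T). Fk k z \<noteq> 0) \<Longrightarrow>
      \<bar>Im (contour_integral (linepath (Complex \<sigma> T) (Complex (1 - \<sigma>) T)) (L k))\<bar> \<le> K1 * ln T"
    using horizontal_side[OF \<sigma>(1) low0 \<sigma>(2) low] by blast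
  obtain K2 T3 where K2: "\<And>T. T3 \<le> T \<Longrightarrow>
      \<exists>I. (L k has_contour_integral I) (linepath (Complex (1 - \<sigma>) T) (Complex (1 - \<sigma>) T1)) \<and>
      \<bar>Im I - 2 * pi * main_term T\<bar> \<le> K2 * ln T"
    using left_side[OF \<epsilon>(1) \<sigma>(2) reg'] by blast
  \<comment> \<open>The reflected point lies on the right edge, where \<open>low\<close> applies,
    and \<open>H\<close> has no zeros.\<close>
  have Fk_left: "Fk k s \<noteq> 0" if "Re s = 1 - \<sigma>" "T1 \<le> Im s" for s
  proof -
    have "p ^ k / 2 \<le> norm (Fk k (1 - cnj s))" by (rule low) (use that in auto)
    then have "Fk k (1 - cnj s) \<noteq> 0" using low0 by auto
    moreover have s: "T0 < Im s" using that \<sigma> by simp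
    ultimately show ?thesis using Fk_FE[OF s] H_nz[OF s] by auto
  qed
  have cont: "L k contour_integrable_on (linepath (Complex x t) (Complex y t))"
    if "T1 \<le> t" "\<forall>z\<in>closed_segment (Complex x t) (Complex y t). Fk k z \<noteq> 0" for x y t
  proof (rule contour_integrable_continuous_linepath)
    have "closed_segment (Complex x t) (Complex y t) \<subseteq> {s. T0 < Im s}"
      using that(1) \<sigma> by (simp add: closed_segment_subset convex_halfspace_Im_gt)
    then have "L k holomorphic_on closed_segment (Complex x t) (Complex y t)"
      unfolding L_def[abs_def] using that(2) Fk_holo
      by (intro holomorphic_on_divide holomorphic_on_subset[OF holomorphic_deriv[OF Fk_holo open_U]]
          holomorphic_on_subset[OF Fk_holo]) auto
    then show "continuous_on (closed_segment (Complex x t) (Complex y t)) (L k)"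
      by (rule holomorphic_on_imp_continuous_on)
  qed
  define I0 where "I0 = contour_integral (linepath (Complex (1 - \<sigma>) T1) (Complex \<sigma> T1)) (L k)"
  define c where "c = \<bar>Im I0\<bar> + 2 * ((real k + 1) * pi)"
  have "\<bar>of_int (\<Sum>\<rho> | 1 - \<sigma> < Re \<rho> \<and> Re \<rho> < \<sigma> \<and> T1 < Im \<rho> \<and> Im \<rho> < T \<and> Fk k \<rho> = 0. zorder (Fk k) \<rho>)
      - main_term T\<bar> \<le> (K1 + K2 + c) / (2 * pi) * ln T"
    if T: "max (max T2 T3) (max (T1 + 1) 3) \<le> T"
      and top: "\<forall>z. 1 - \<sigma> \<le> Re z \<longrightarrow> Re z \<le> \<sigma> \<longrightarrow> Im z = T \<longrightarrow> Fk k z \<noteq> 0" for T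
  proof -
    have t: "T2 \<le> T" "T3 \<le> T" "T1 < T" "3 \<le> T" using T by auto
    have "exp 1 \<le> T" using exp_le t by linarith
    then have l1: "1 \<le> ln T" using t by (subst ln_ge_iff) auto
    define n where "n = (\<Sum>\<rho> | 1 - \<sigma> < Re \<rho> \<and> Re \<rho> < \<sigma> \<and> T1 < Im \<rho> \<and> Im \<rho> < T \<and> Fk k \<rho> = 0. zorder (Fk k) \<rho>)"
    have segh: "Fk k z \<noteq> 0" if "z \<in> closed_segment (Complex \<sigma> T) (Complex (1 - \<sigma>) T)" for z
      using that top \<sigma> by (auto simp: closed_segment_same_Im closed_segment_eq_real_ivl split: if_splits)
    have segb: "Fk k z \<noteq> 0" if "z \<in> closed_segment (Complex (1 - \<sigma>) T1) (Complex \<sigma> T1)" for z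
      using that bot \<sigma> by (auto simp: closed_segment_same_Im closed_segment_eq_real_ivl split: if_splits)
    have i0: "(L k has_contour_integral I0) (linepath (Complex (1 - \<sigma>) T1) (Complex \<sigma> T1))"
      unfolding I0_def by (intro has_contour_integral_integral cont) (use segb in auto)
    obtain I1 where i1: "(L k has_contour_integral I1) (linepath (Complex \<sigma> T1) (Complex \<sigma> T))"
      "\<bar>Im I1\<bar> \<le> 2 * ((real k + 1) * pi)"
      using right_side[OF \<epsilon>(1) \<sigma>(2) less_imp_le[OF t(3)] reg'] by blast
    define I2 where "I2 = contour_integral (linepath (Complex \<sigma> T) (Complex (1 - \<sigma>) T)) (L k)"
    have i2: "(L k has_contour_integral I2) (linepath (Complex \<sigma> T) (Complex (1 - \<sigma>) T))"
      unfolding I2_def by (intro has_contour_integral_integral cont) (use segh t in auto)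
    have i2': "\<bar>Im I2\<bar> \<le> K1 * ln T" unfolding I2_def by (rule K1[OF t(1)]) (use segh in auto)
    obtain I3 where i3: "(L k has_contour_integral I3) (linepath (Complex (1 - \<sigma>) T) (Complex (1 - \<sigma>) T1))"
      "\<bar>Im I3 - 2 * pi * main_term T\<bar> \<le> K2 * ln T" using K2[OF t(2)] by blast
    have "(L k has_contour_integral (I0 + (I1 + (I2 + I3)))) (rectpath (Complex (1 - \<sigma>) T1) (Complex \<sigma> T))"
      unfolding rectpath_def Let_def complex.sel
      by (intro has_contour_integral_join i0 i1 i2 i3 valid_path_join) auto
    then have "I0 + (I1 + (I2 + I3)) = contour_integral (rectpath (Complex (1 - \<sigma>) T1) (Complex \<sigma> T)) (L k)"
      by (rule contour_integral_unique[symmetric])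
    also have "\<dots> = 2 * pi * \<i> * of_int n"
      unfolding n_def
    proof (rule argument_principle_rect[OF \<sigma> t(3)])
      fix z assume "z \<in> cbox (Complex (1 - \<sigma>) T1) (Complex \<sigma> T) - box (Complex (1 - \<sigma>) T1) (Complex \<sigma> T)"
      then have z: "1 - \<sigma> \<le> Re z" "Re z \<le> \<sigma>" "T1 \<le> Im z" "Im z \<le> T"
        and "Re z = 1 - \<sigma> \<or> Re z = \<sigma> \<or> Im z = T1 \<or> Im z = T"
        by (auto simp: in_cbox_complex_iff in_box_complex_iff)
      then consider "Re z = 1 - \<sigma>" | "Re z = \<sigma>" | "Im z = T1" | "Im z = T" by blast
      then show "Fk k z \<noteq> 0"
      proof cases
        case 1 then show ?thesis using Fk_left z by blast
      next
        case 2 then show ?thesis using low[of z] low0 z by auto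
      next
        case 3 then show ?thesis using bot z by blast
      next
        case 4 then show ?thesis using top z by blast
      qed
    qed
    finally have "Im (I0 + (I1 + (I2 + I3))) = 2 * pi * of_int n" by simp
    then have "2 * pi * of_int n = Im I0 + (Im I1 + (Im I2 + Im I3))" by simp
    then have "\<bar>2 * pi * of_int n - 2 * pi * main_term T\<bar> \<le> c + K1 * ln T + K2 * ln T"
      unfolding c_def using i1(2) i2' i3(2) by linarith
    also have "c \<le> c * ln T" using mult_left_mono[OF l1, of c] by (simp add: c_def)
    finally have "\<bar>2 * pi * of_int n - 2 * pi * main_term T\<bar> \<le> (K1 + K2 + c) * ln T"
      by (simp add: algebra_simps)
    moreover have "\<bar>2 * pi * of_int n - 2 * pi * main_term T\<bar> = 2 * pi * \<bar>of_int n - main_term T\<bar>"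
      by (simp add: right_diff_distrib[symmetric] abs_mult)
    ultimately show ?thesis unfolding n_def by (simp add: field_simps)
  qed
  then show ?thesis by blast
qed

text \<open>Zeros on the top edge are avoided by lowering T slightly. The count involves the strict
  inequality Im \<rho> < T, so it does not change if no zero is passed, and \<open>main_term\<close>
  changes by less than 1 by continuity.\<close>

theorem zero_count_upper:
  "\<exists>\<sigma>0\<ge>1. \<forall>\<sigma>\<ge>\<sigma>0. \<exists>T1>T0. \<exists>K T2. (\<exists>w. T0 < Im w \<and> Fk k w \<noteq> 0) \<and>
    (\<forall>z. 1 - \<sigma> \<le> Re z \<longrightarrow> Re z \<le> \<sigma> \<longrightarrow> Im z = T1 \<longrightarrow> Fk k z \<noteq> 0) \<and>
    (\<forall>T\<ge>T2. \<bar>of_int (\<Sum>\<rho> | 1 - \<sigma> < Re \<rho> \<and> Re \<rho> < \<sigma> \<and> T1 < Im \<rho> \<and> Im \<rho> < T \<and> Fk k \<rho> = 0. zorder (Fk k) \<rho>)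
      - main_term T\<bar> \<le> K * ln T)"
proof -
  obtain p \<epsilon> \<sigma>1 where p: "0 < p" and \<epsilon>: "\<epsilon> = 1 \<or> \<epsilon> = (-1::real)"
    and reg: "\<And>\<sigma>. \<exists>T1>T0. \<forall>s. \<sigma>1 \<le> Re s \<longrightarrow> Re s \<le> \<sigma> \<longrightarrow> T1 \<le> Im s \<longrightarrow>
       p \<le> \<epsilon> * Re (P s) \<and> norm (R k s - 1) \<le> 1 / 2"
    using right_region[of k] by blast
  have "\<exists>T1>T0. \<exists>K T2. (\<exists>w. T0 < Im w \<and> Fk k w \<noteq> 0) \<and>
    (\<forall>z. 1 - \<sigma> \<le> Re z \<longrightarrow> Re z \<le> \<sigma> \<longrightarrow> Im z = T1 \<longrightarrow> Fk k z \<noteq> 0) \<and>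
    (\<forall>T\<ge>T2. \<bar>of_int (\<Sum>\<rho> | 1 - \<sigma> < Re \<rho> \<and> Re \<rho> < \<sigma> \<and> T1 < Im \<rho> \<and> Im \<rho> < T \<and> Fk k \<rho> = 0. zorder (Fk k) \<rho>)
      - main_term T\<bar> \<le> K * ln T)" if \<sigma>': "max 1 \<sigma>1 \<le> \<sigma>" for \<sigma>
  proof -
    have \<sigma>: "1 \<le> \<sigma>" "\<sigma>1 \<le> \<sigma>" using \<sigma>' by auto
    obtain T' where T': "T0 < T'" and reg': "\<And>s. Re s = \<sigma> \<Longrightarrow> T' \<le> Im s \<Longrightarrow>
       p \<le> \<epsilon> * Re (P s) \<and> norm (R k s - 1) \<le> 1 / 2"
      using reg[of \<sigma>] \<sigma> by blast
    define w where "w = Complex \<sigma> T'"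
    have w: "T0 < Im w" "Fk k w \<noteq> 0"
    proof -
      have "P w \<noteq> 0" "R k w \<noteq> 0" using reg'[of w] p by (auto simp: w_def)
      then show "Fk k w \<noteq> 0" by (simp add: Fk_eq_R)
    qed (use T' in \<open>simp add: w_def\<close>)
    have fin: "finite {z \<in> cbox (Complex (1 - \<sigma>) a) (Complex \<sigma> b). Fk k z = 0}" if "T0 < a" for a b
      by (rule zeros_finite[OF compact_cbox _ w]) (use that in \<open>auto simp: in_cbox_complex_iff\<close>)
    \<comment> \<open>Only finitely many heights in an interval carry zeros, so a zero-free bottom
      edge exists within distance 1.\<close>
    have "infinite ({T'..T' + 1} - Im ` {z \<in> cbox (Complex (1 - \<sigma>) T') (Complex \<sigma> (T' + 1)). Fk k z = 0})"
      using fin[OF T'] by (intro Diff_infinite_finite finite_imageI) auto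
    then obtain T1 where T1: "T' \<le> T1" "T1 \<le> T' + 1"
      "T1 \<notin> Im ` {z \<in> cbox (Complex (1 - \<sigma>) T') (Complex \<sigma> (T' + 1)). Fk k z = 0}"
      by (metis (no_types, lifting) Diff_iff atLeastAtMost_iff ex_in_conv finite.emptyI)
    have bot: "Fk k z \<noteq> 0" if "1 - \<sigma> \<le> Re z" "Re z \<le> \<sigma>" "Im z = T1" for z
      using that T1 by (auto simp: in_cbox_complex_iff image_iff)
    have T01: "T0 < T1" using T' T1 by simp
    define n where "n = (\<lambda>T. real_of_int (\<Sum>\<rho> | 1 - \<sigma> < Re \<rho> \<and> Re \<rho> < \<sigma> \<and> T1 < Im \<rho> \<and> Im \<rho> < T \<and> Fk k \<rho> = 0. zorder (Fk k) \<rho>))"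
    have "\<exists>K T2. \<forall>T\<ge>T2. (\<forall>z. 1 - \<sigma> \<le> Re z \<longrightarrow> Re z \<le> \<sigma> \<longrightarrow> Im z = T \<longrightarrow> Fk k z \<noteq> 0) \<longrightarrow>
        \<bar>n T - main_term T\<bar> \<le> K * ln T"
      unfolding n_def
      by (rule zero_count_generic[OF \<sigma>(1) T01 \<epsilon> p _ bot]) (use reg' T1 in auto)
    then obtain K T2 where K: "\<And>T. T2 \<le> T \<Longrightarrow> \<forall>z. 1 - \<sigma> \<le> Re z \<longrightarrow> Re z \<le> \<sigma> \<longrightarrow> Im z = T \<longrightarrow> Fk k z \<noteq> 0 \<Longrightarrow>
        \<bar>n T - main_term T\<bar> \<le> K * ln T" by blast
    have "\<bar>n T - main_term T\<bar> \<le> (\<bar>K\<bar> + 1) * ln T" if T: "max (max (T2 + 1) (T1 + 1)) 4 \<le> T" for T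
    proof -
      have t: "T2 < T" "T1 < T" "4 \<le> T" using T by auto
      \<comment> \<open>Zeros strictly below T. Any t' < T above all of them gives the same count
        and a zero-free top edge.\<close>
      define Zs where "Zs = {z \<in> cbox (Complex (1 - \<sigma>) T1) (Complex \<sigma> T). Fk k z = 0} \<inter> {z. Im z < T}"
      have finZ: "finite Zs" unfolding Zs_def using fin[OF T01] by blast
      have ev1: "\<forall>\<^sub>F t in at_left T. \<forall>z\<in>Zs. Im z < t"
        by (intro eventually_ball_finite finZ ballI eventually_at_left_field[THEN iffD2])
          (auto simp: Zs_def)
      have "(main_term \<longlongrightarrow> main_term T) (at_left T)"
        unfolding main_term_def[abs_def] using t by (intro tendsto_intros) auto
      then have ev2: "\<forall>\<^sub>F t in at_left T. dist (main_term t) (main_term T) < 1"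
        by (rule tendstoD) simp
      have ev3: "\<forall>\<^sub>F t in at_left T. max (max T1 T2) 3 < t \<and> t < T"
        using eventually_at_left_real[of "max (max T1 T2) 3" T] t by (auto elim: eventually_mono)
      obtain t' where t': "\<forall>z\<in>Zs. Im z < t'" "dist (main_term t') (main_term T) < 1"
        "max (max T1 T2) 3 < t'" "t' < T"
        using eventually_happens[OF eventually_conj[OF ev1 eventually_conj[OF ev2 ev3]]] by auto
      have "n t' = n T"
      proof -
        have "{\<rho>. 1 - \<sigma> < Re \<rho> \<and> Re \<rho> < \<sigma> \<and> T1 < Im \<rho> \<and> Im \<rho> < t' \<and> Fk k \<rho> = 0} =
            {\<rho>. 1 - \<sigma> < Re \<rho> \<and> Re \<rho> < \<sigma> \<and> T1 < Im \<rho> \<and> Im \<rho> < T \<and> Fk k \<rho> = 0}"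
          using t'(1,4) by (auto simp: Zs_def in_cbox_complex_iff)
        then show ?thesis by (simp add: n_def)
      qed
      moreover have "\<bar>n t' - main_term t'\<bar> \<le> K * ln t'"
      proof (rule K)
        show "\<forall>z. 1 - \<sigma> \<le> Re z \<longrightarrow> Re z \<le> \<sigma> \<longrightarrow> Im z = t' \<longrightarrow> Fk k z \<noteq> 0"
        proof (intro allI impI notI)
          fix z assume "1 - \<sigma> \<le> Re z" "Re z \<le> \<sigma>" "Im z = t'" "Fk k z = 0"
          then have "z \<in> Zs" using t' by (auto simp: Zs_def in_cbox_complex_iff)
          then show False using t'(1) \<open>Im z = t'\<close> by auto
        qed
      qed (use t' in auto)
      moreover have "K * ln t' \<le> \<bar>K\<bar> * ln T"
        using t' by (intro mult_mono) auto
      moreover have "exp 1 \<le> T" using exp_le t by linarith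
      then have "1 \<le> ln T" using t by (subst ln_ge_iff) auto
      ultimately show ?thesis using t'(2) by (simp add: dist_real_def distrib_right)
    qed
    then show ?thesis unfolding n_def using T01 w bot by blast
  qed
  then show ?thesis by (intro exI[of _ "max 1 \<sigma>1"]) auto
qed

end

section \<open>The gamma factors\<close>

lemma DERIV_prod_log:
  fixes f g :: "'i \<Rightarrow> complex \<Rightarrow> complex"
  assumes "finite A" "\<And>j. j \<in> A \<Longrightarrow> (f j has_field_derivative f j s * g j s) (at s)"
  shows "((\<lambda>s. \<Prod>j\<in>A. f j s) has_field_derivative (\<Prod>j\<in>A. f j s) * (\<Sum>j\<in>A. g j s)) (at s)"
  using assms
proof (induction A rule: finite_induct)
  case (insert a A)
  have "((\<lambda>s. f a s * (\<Prod>j\<in>A. f j s)) has_field_derivative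
      f a s * g a s * (\<Prod>j\<in>A. f j s) + (\<Prod>j\<in>A. f j s) * (\<Sum>j\<in>A. g j s) * f a s) (at s)"
    using insert by (intro DERIV_mult) auto
  moreover have "f a s * g a s * (\<Prod>j\<in>A. f j s) + (\<Prod>j\<in>A. f j s) * (\<Sum>j\<in>A. g j s) * f a s =
      (\<Prod>j\<in>insert a A. f j s) * (\<Sum>j\<in>insert a A. g j s)"
    using insert.hyps by (simp add: algebra_simps)
  ultimately show ?case using insert.hyps by simp
qed simp

lemma sum_inverse_Im_bound:
  fixes f :: "'i \<Rightarrow> complex \<Rightarrow> complex"
  assumes "finite A" "\<And>j. j \<in> A \<Longrightarrow> \<exists>C T. \<forall>s. \<bar>Re s\<bar> \<le> B \<longrightarrow> T \<le> Im s \<longrightarrow> norm (f j s) \<le> C / Im s"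
  shows "\<exists>C T. \<forall>s. \<bar>Re s\<bar> \<le> B \<longrightarrow> T \<le> Im s \<longrightarrow> norm (\<Sum>j\<in>A. f j s) \<le> C / Im s"
  using assms
proof (induction A rule: finite_induct)
  case empty
  show ?case by (intro exI[of _ 0]) auto
next
  case (insert a A)
  then obtain C T C' T' where
    1: "\<And>s. \<bar>Re s\<bar> \<le> B \<Longrightarrow> T \<le> Im s \<Longrightarrow> norm (\<Sum>j\<in>A. f j s) \<le> C / Im s" and
    2: "\<And>s. \<bar>Re s\<bar> \<le> B \<Longrightarrow> T' \<le> Im s \<Longrightarrow> norm (f a s) \<le> C' / Im s"
    by (metis insert_iff)
  have "norm (\<Sum>j\<in>insert a A. f j s) \<le> (C' + C) / Im s" if "\<bar>Re s\<bar> \<le> B" "max T T' \<le> Im s" for s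
    using 1[of s] 2[of s] that insert.hyps norm_triangle_ineq[of "f a s" "\<Sum>j\<in>A. f j s"]
    by (simp add: add_divide_distrib)
  then show ?case by blast
qed

locale gamma_data =
  fixes r :: nat and Q :: real and lam :: "nat \<Rightarrow> real" and mu :: "nat \<Rightarrow> complex" and \<omega> :: complex
  assumes Q: "Q > 0" and lam: "\<And>j. j \<in> {1..r} \<Longrightarrow> lam j > 0" and \<omega>: "norm \<omega> = 1"
begin

abbreviation "\<gamma> \<equiv> gamma_factor r Q lam mu"
abbreviation "H \<equiv> H_fun r Q lam mu \<omega>"
abbreviation "\<psi> \<equiv> psi_fun r Q lam mu \<omega>"

text \<open>Above this height all arguments of the gamma factors lie in the upper half-plane.\<close>

definition "T0 = 1 + (\<Sum>j=1..r. \<bar>Im (mu j)\<bar> / lam j)"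

definition "\<gamma>_log s = of_real (ln Q) + (\<Sum>j=1..r. of_real (lam j) * Digamma (of_real (lam j) * s + mu j))"

text \<open>The constant C0: twice the constant term in the real part of
  \<open>\<gamma>_log\<close>, the logarithmic derivative of the gamma factor. Each j contributes
  lam j times the logarithm of lam j through \<open>Digamma_affine_strip\<close>.\<close>

definition "\<psi>_const = 2 * ln Q + 2 * (\<Sum>j=1..r. lam j * ln (lam j))"

lemma lam_nonneg: "j \<in> {1..r} \<Longrightarrow> 0 \<le> lam j"
  by (rule less_imp_le[OF lam])

lemma T0_ge_1: "1 \<le> T0"
proof -
  have "0 \<le> (\<Sum>j=1..r. \<bar>Im (mu j)\<bar> / lam j)"
    by (intro sum_nonneg divide_nonneg_nonneg lam_nonneg abs_ge_zero)
  then show ?thesis by (simp add: T0_def)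
qed

lemma Im_gamma_arg_pos:
  assumes "T0 < Im s" "j \<in> {1..r}"
  shows "0 < Im (of_real (lam j) * s + mu j)"
proof -
  have "\<bar>Im (mu j)\<bar> / lam j \<le> (\<Sum>j=1..r. \<bar>Im (mu j)\<bar> / lam j)"
    using assms by (intro member_le_sum divide_nonneg_nonneg lam_nonneg) auto
  also have "\<dots> < Im s" using assms by (simp add: T0_def)
  finally have "\<bar>Im (mu j)\<bar> < lam j * Im s" using lam[OF assms(2)] by (simp add: divide_less_eq mult.commute)
  then show ?thesis by simp
qed

lemma gamma_arg_not_pole:
  assumes "T0 < Im s" "j \<in> {1..r}"
  shows "of_real (lam j) * s + mu j \<notin> \<int>\<^sub>\<le>\<^sub>0"
proof
  assume "of_real (lam j) * s + mu j \<in> \<int>\<^sub>\<le>\<^sub>0"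
  then obtain n where "of_real (lam j) * s + mu j = of_int n" by (auto elim!: nonpos_Ints_cases)
  then have "Im (of_real (lam j) * s + mu j) = Im (of_int n)" by (rule arg_cong)
  then show False using Im_gamma_arg_pos[OF assms] by simp
qed

lemma \<gamma>_nz: "T0 < Im s \<Longrightarrow> \<gamma> s \<noteq> 0"
  using Q gamma_arg_not_pole by (auto simp: gamma_factor_def Gamma_eq_zero_iff)

lemma \<gamma>_deriv:
  assumes s: "T0 < Im s"
  shows "(\<gamma> has_field_derivative \<gamma> s * \<gamma>_log s) (at s)"
proof -
  have 1: "((\<lambda>s. of_real Q powr s) has_field_derivative Ln (of_real Q) * of_real Q powr s) (at s)"
    using Q by (intro has_field_derivative_powr_right) auto
  have "((\<lambda>s. \<Prod>j=1..r. Gamma (of_real (lam j) * s + mu j)) has_field_derivative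
      (\<Prod>j=1..r. Gamma (of_real (lam j) * s + mu j)) * (\<Sum>j=1..r. of_real (lam j) * Digamma (of_real (lam j) * s + mu j))) (at s)"
  proof (rule DERIV_prod_log)
    fix j assume j: "j \<in> {1..r}"
    show "((\<lambda>s. Gamma (of_real (lam j) * s + mu j)) has_field_derivative
        Gamma (of_real (lam j) * s + mu j) * (of_real (lam j) * Digamma (of_real (lam j) * s + mu j))) (at s)"
    proof -
      have "((\<lambda>s. of_real (lam j) * s + mu j) has_field_derivative of_real (lam j)) (at s)"
        by (auto intro!: derivative_eq_intros)
      from DERIV_chain2[where f = Gamma and g = "\<lambda>s. of_real (lam j) * s + mu j",
          OF has_field_derivative_Gamma[OF gamma_arg_not_pole[OF s j]] this]
      show ?thesis by (simp add: mult_ac)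
    qed
  qed simp
  from DERIV_mult[OF 1 this] show ?thesis
    unfolding gamma_factor_def[abs_def] \<gamma>_log_def
    using Ln_of_real[OF Q] by (simp add: algebra_simps)
qed

lemma H_deriv':
  assumes s: "T0 < Im s"
  shows "(H has_field_derivative (- \<gamma>_log s - cnj (\<gamma>_log (1 - cnj s))) * H s) (at s)"
proof -
  have "((\<lambda>s. cnj (\<gamma> (1 - cnj s))) has_field_derivative - cnj (\<gamma> (1 - cnj s) * \<gamma>_log (1 - cnj s))) (at s)"
    by (rule has_field_derivative_reflect[OF \<gamma>_deriv]) (use s in simp)
  from DERIV_divide[OF DERIV_cmult[OF this, of \<omega>] \<gamma>_deriv[OF s] \<gamma>_nz[OF s]]
  have "(H has_field_derivative (\<omega> * - cnj (\<gamma> (1 - cnj s) * \<gamma>_log (1 - cnj s)) * \<gamma> s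
      - \<omega> * cnj (\<gamma> (1 - cnj s)) * (\<gamma> s * \<gamma>_log s)) / (\<gamma> s * \<gamma> s)) (at s)"
    by (simp add: H_fun_def[abs_def])
  moreover have "(\<omega> * - cnj (\<gamma> (1 - cnj s) * \<gamma>_log (1 - cnj s)) * \<gamma> s
      - \<omega> * cnj (\<gamma> (1 - cnj s)) * (\<gamma> s * \<gamma>_log s)) / (\<gamma> s * \<gamma> s)
      = (- \<gamma>_log s - cnj (\<gamma>_log (1 - cnj s))) * H s"
    using \<gamma>_nz[OF s] by (simp add: H_fun_def field_simps)
  ultimately show ?thesis by simp
qed

lemma H_nz: "T0 < Im s \<Longrightarrow> H s \<noteq> 0"
  using \<gamma>_nz[of s] \<gamma>_nz[of "1 - cnj s"] \<omega> by (auto simp: H_fun_def)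

lemma \<psi>_eq: "T0 < Im s \<Longrightarrow> \<psi> s = - \<gamma>_log s - cnj (\<gamma>_log (1 - cnj s))"
  unfolding psi_fun_def using DERIV_imp_deriv[OF H_deriv'] H_nz by simp

lemma H_holo: "H holomorphic_on {s. T0 < Im s}"
  using H_deriv' by (auto simp: holomorphic_on_open[OF open_halfspace_Im_gt])

lemma \<psi>_holo: "\<psi> holomorphic_on {s. T0 < Im s}"
  unfolding psi_fun_def[abs_def] using H_nz
  by (intro holomorphic_intros holomorphic_deriv H_holo open_halfspace_Im_gt) auto

lemma \<gamma>_log_asymp:
  "\<exists>C T1. \<forall>s. \<bar>Re s\<bar> \<le> B \<longrightarrow> T1 \<le> Im s \<longrightarrow>
    norm (\<gamma>_log s - (of_real ((gamma_degree r lam * ln (Im s) + \<psi>_const) / 2) +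
      \<i> * of_real (pi / 2 * (\<Sum>j=1..r. lam j)))) \<le> C / Im s"
proof -
  let ?E = "\<lambda>j s. of_real (lam j) * (Digamma (of_real (lam j) * s + mu j) -
    (of_real (ln (Im s) + ln (lam j)) + \<i> * of_real (pi / 2)))"
  have "\<exists>C T. \<forall>s. \<bar>Re s\<bar> \<le> B \<longrightarrow> T \<le> Im s \<longrightarrow> norm (\<Sum>j=1..r. ?E j s) \<le> C / Im s"
  proof (rule sum_inverse_Im_bound)
    fix j assume j: "j \<in> {1..r}"
    obtain C T where C: "\<And>s. \<bar>Re s\<bar> \<le> B \<Longrightarrow> T \<le> Im s \<Longrightarrow>
        norm (Digamma (of_real (lam j) * s + mu j) - (of_real (ln (Im s) + ln (lam j)) + \<i> * of_real (pi/2))) \<le> C / Im s"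
      using Digamma_affine_strip[OF lam[OF j]] by metis
    have "norm (?E j s) \<le> (lam j * C) / Im s" if "\<bar>Re s\<bar> \<le> B" "T \<le> Im s" for s
      using mult_left_mono[OF C[OF that], of "lam j"] lam[OF j] unfolding norm_mult by simp
    then show "\<exists>C T. \<forall>s. \<bar>Re s\<bar> \<le> B \<longrightarrow> T \<le> Im s \<longrightarrow> norm (?E j s) \<le> C / Im s" by blast
  qed simp
  moreover have "(\<Sum>j=1..r. ?E j s) = \<gamma>_log s - (of_real ((gamma_degree r lam * ln (Im s) + \<psi>_const) / 2) +
      \<i> * of_real (pi / 2 * (\<Sum>j=1..r. lam j)))" for s
  proof -
    have "(\<Sum>j=1..r. ?E j s) = (\<Sum>j=1..r. of_real (lam j) * Digamma (of_real (lam j) * s + mu j))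
        - (\<Sum>j=1..r. of_real (lam j * ln (Im s) + lam j * ln (lam j)) + \<i> * of_real (pi / 2 * lam j))"
      by (simp add: sum_subtractf[symmetric] algebra_simps)
    also have "(\<Sum>j=1..r. of_real (lam j * ln (Im s) + lam j * ln (lam j)) + \<i> * of_real (pi / 2 * lam j)) =
        of_real (\<Sum>j=1..r. lam j * ln (Im s) + lam j * ln (lam j)) + \<i> * of_real (\<Sum>j=1..r. pi / 2 * lam j)"
      by (simp add: sum.distrib sum_distrib_left)
    also have "(\<Sum>j=1..r. lam j * ln (Im s) + lam j * ln (lam j)) =
        (\<Sum>j=1..r. lam j) * ln (Im s) + (\<Sum>j=1..r. lam j * ln (lam j))"
      by (simp only: sum.distrib sum_distrib_right)
    also have "(\<Sum>j=1..r. pi / 2 * lam j) = pi / 2 * (\<Sum>j=1..r. lam j)"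
      by (simp only: sum_distrib_left)
    also have "(\<Sum>j=1..r. lam j) * ln (Im s) + (\<Sum>j=1..r. lam j * ln (lam j)) =
        (gamma_degree r lam * ln (Im s) + \<psi>_const) / 2 - ln Q"
      by (simp add: gamma_degree_def \<psi>_const_def field_simps)
    finally show ?thesis by (simp add: \<gamma>_log_def)
  qed
  ultimately show ?thesis by simp
qed

text \<open>\<open>- \<psi>\<close> is the sum of \<open>\<gamma>_log\<close> at s and its conjugate
  at the reflected point of the same height. The real main terms double and the imaginary ones, pi/2
  times the sum of the lam j, cancel.\<close>

lemma \<psi>_asymp:
  "\<exists>C T1. \<forall>s. \<bar>Re s\<bar> \<le> B \<longrightarrow> T1 \<le> Im s \<longrightarrow>
    norm (\<psi> s + of_real (gamma_degree r lam * ln (Im s) + \<psi>_const)) \<le> C / Im s"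
proof -
  define M where "M = (\<lambda>s::complex. of_real ((gamma_degree r lam * ln (Im s) + \<psi>_const) / 2) +
      \<i> * of_real (pi / 2 * (\<Sum>j=1..r. lam j)))"
  \<comment> \<open>The reflection can increase |Re s| by up to 1, hence the wider strip.\<close>
  obtain C T1 where C: "\<And>s. \<bar>Re s\<bar> \<le> B + 1 \<Longrightarrow> T1 \<le> Im s \<Longrightarrow> norm (\<gamma>_log s - M s) \<le> C / Im s"
    using \<gamma>_log_asymp[of "B + 1"] unfolding M_def by metis
  have "norm (\<psi> s + of_real (gamma_degree r lam * ln (Im s) + \<psi>_const)) \<le> (C + C) / Im s"
    if s: "\<bar>Re s\<bar> \<le> B" "max T1 (T0 + 1) \<le> Im s" for s
  proof -
    have M: "M s + cnj (M (1 - cnj s)) = of_real (gamma_degree r lam * ln (Im s) + \<psi>_const)"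
      by (simp add: M_def complex_eq_iff)
    have "\<psi> s + of_real (gamma_degree r lam * ln (Im s) + \<psi>_const) =
        - (\<gamma>_log s - M s) - cnj (\<gamma>_log (1 - cnj s) - M (1 - cnj s))"
    proof -
      have "T0 < Im s" using s by simp
      then show ?thesis unfolding M[symmetric] \<psi>_eq[OF \<open>T0 < Im s\<close>] by simp
    qed
    also have "norm \<dots> \<le> norm (\<gamma>_log s - M s) + norm (\<gamma>_log (1 - cnj s) - M (1 - cnj s))"
      using norm_triangle_ineq4[of "- (\<gamma>_log s - M s)" "cnj (\<gamma>_log (1 - cnj s) - M (1 - cnj s))"]
      unfolding complex_mod_cnj norm_minus_cancel .
    also have "\<dots> \<le> C / Im s + C / Im (1 - cnj s)"
      using s by (intro add_mono C) auto
    finally show ?thesis by (simp add: add_divide_distrib)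
  qed
  then show ?thesis by blast
qed

end

section \<open>From the axioms to the half-plane setting\<close>

lemma dirichlet_right:
  assumes "dirichlet_axiom F" "0 < \<epsilon>"
  shows "\<exists>\<sigma>1\<ge>2. \<forall>s. \<sigma>1 \<le> Re s \<longrightarrow> norm (F s - 1) \<le> \<epsilon>"
proof -
  from assms(1) obtain a :: "nat \<Rightarrow> complex" where a': "a 1 = 1 \<and> (\<forall>s. Re s > 1 \<longrightarrow>
      summable (\<lambda>n. norm (a (Suc n) * of_nat (Suc n) powr (- s))) \<and>
      (\<lambda>n. a (Suc n) * of_nat (Suc n) powr (- s)) sums F s)"
    unfolding dirichlet_axiom_def by (elim exE)
  then have a: "a 1 = 1"
    "\<And>s. Re s > 1 \<Longrightarrow> summable (\<lambda>n. norm (a (Suc n) * of_nat (Suc n) powr (- s)))"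
    "\<And>s. Re s > 1 \<Longrightarrow> (\<lambda>n. a (Suc n) * of_nat (Suc n) powr (- s)) sums F s"
    by simp_all
  \<comment> \<open>The absolutely convergent series at s = 2 is the majorant. For n \<ge> 2 and Re
    s \<ge> 2 the leftover factor n^(2 - Re s) is at most 2^(2 - Re s), which supplies the
    decay.\<close>
  define b where "b = (\<lambda>n. norm (a (Suc n) * of_nat (Suc n) powr (- 2)))"
  have b: "summable b" unfolding b_def using a(2)[of 2] by simp
  define C where "C = (\<Sum>n. b (Suc n))"
  have bS: "summable (\<lambda>n. b (Suc n))" using b by (simp only: summable_Suc_iff)
  have bound: "norm (F s - 1) \<le> C * 2 powr (2 - Re s)" if s: "2 \<le> Re s" for s
  proof -
    define f where "f = (\<lambda>n. a (Suc n) * of_nat (Suc n) powr (- s))"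
    have "f sums F s" unfolding f_def using a(3) s by simp
    then have "(\<lambda>n. f (Suc n)) sums (F s - f 0)" by (subst sums_Suc_iff) simp
    then have F: "F s - 1 = (\<Sum>n. f (Suc n))" using a(1) by (simp add: f_def sums_iff)
    have le: "norm (f (Suc n)) \<le> b (Suc n) * 2 powr (2 - Re s)" for n
    proof -
      have np: "norm (of_nat (Suc (Suc n)) powr z :: complex) = real (Suc (Suc n)) powr Re z" for z
        using norm_powr_real_powr[of "of_nat (Suc (Suc n))" z] by simp
      have "real (Suc (Suc n)) powr (- Re s) = real (Suc (Suc n)) powr (- 2) * real (Suc (Suc n)) powr (2 - Re s)"
        by (simp add: powr_add[symmetric])
      also have "\<dots> \<le> real (Suc (Suc n)) powr (- 2) * 2 powr (2 - Re s)"
        using s by (intro mult_left_mono powr_mono2') auto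
      finally have "norm (a (Suc (Suc n))) * real (Suc (Suc n)) powr (- Re s) \<le>
          norm (a (Suc (Suc n))) * (real (Suc (Suc n)) powr (- 2) * 2 powr (2 - Re s))"
        by (intro mult_left_mono) auto
      moreover have "norm (f (Suc n)) = norm (a (Suc (Suc n))) * real (Suc (Suc n)) powr (- Re s)"
        unfolding f_def norm_mult np by simp
      moreover have "b (Suc n) = norm (a (Suc (Suc n))) * real (Suc (Suc n)) powr (- 2)"
        unfolding b_def norm_mult np by simp
      ultimately show ?thesis by (simp add: mult.assoc)
    qed
    have "norm (\<Sum>n. f (Suc n)) \<le> (\<Sum>n. b (Suc n) * 2 powr (2 - Re s))"
      by (rule norm_suminf_le[OF le summable_mult2[OF bS]])
    also have "\<dots> = C * 2 powr (2 - Re s)" unfolding C_def by (rule suminf_mult2[OF bS, symmetric])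
    finally show ?thesis by (simp add: F)
  qed
  have C0: "0 \<le> C" unfolding C_def b_def by (intro suminf_nonneg bS[unfolded b_def]) auto
  have "((\<lambda>x::real. C * 2 powr (2 - x)) \<longlongrightarrow> 0) at_top" by real_asymp
  then have "\<forall>\<^sub>F x in at_top. C * 2 powr (2 - x) < \<epsilon>" using assms(2) by (rule order_tendstoD)
  then obtain \<sigma>1 where "\<And>x. \<sigma>1 \<le> x \<Longrightarrow> C * 2 powr (2 - x) < \<epsilon>" by (auto simp: eventually_at_top_linorder)
  then have "norm (F s - 1) \<le> \<epsilon>" if "max \<sigma>1 2 \<le> Re s" for s
    using bound[of s] that by (meson less_imp_le max.boundedE order_trans)
  then show ?thesis by (intro exI[of _ "max \<sigma>1 2"]) auto
qed

lemma continuation_holomorphic: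
  assumes "continuation_exponent F m"
  shows "F holomorphic_on - {1}"
proof -
  obtain G where G: "G holomorphic_on UNIV" "\<And>s. s \<noteq> 1 \<Longrightarrow> G s = (s - 1) ^ m * F s"
    using assms unfolding continuation_exponent_def by blast
  have "(\<lambda>s. G s / (s - 1) ^ m) holomorphic_on - {1}"
    by (intro holomorphic_intros holomorphic_on_subset[OF G(1)]) auto
  then show ?thesis by (rule holomorphic_transform) (use G(2) in auto)
qed

lemma continuation_meromorphic:
  assumes "continuation_exponent F m"
  shows "F meromorphic_on UNIV"
proof -
  obtain G where G: "G holomorphic_on UNIV" "\<And>s. s \<noteq> 1 \<Longrightarrow> G s = (s - 1) ^ m * F s"
    using assms unfolding continuation_exponent_def by blast
  have "G analytic_on UNIV" using G(1) by (simp add: analytic_on_open)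
  then have "(\<lambda>s. G s / (s - 1) ^ m) meromorphic_on UNIV"
    by (intro meromorphic_intros analytic_on_imp_meromorphic_on analytic_intros)
  moreover have "\<forall>\<^sub>F s in cosparse UNIV. G s / (s - 1) ^ m = F s"
  proof (rule eventually_mono[of "\<lambda>s. s \<in> - {1}"])
    show "\<forall>\<^sub>F s in cosparse UNIV. s \<in> - {1::complex}"
      by (auto simp: eventually_cosparse)
  qed (use G(2) in auto)
  ultimately show ?thesis
    using meromorphic_on_cong'[of "\<lambda>s. G s / (s - 1) ^ m" F UNIV UNIV] by simp
qed

lemma continuation_order:
  assumes "continuation_exponent F m"
  shows "\<exists>R A. \<forall>s. 1 \<le> norm (s - 1) \<longrightarrow> R \<le> norm s \<longrightarrow> norm (F s) \<le> exp (norm s powr A)"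
proof -
  obtain G where G: "finite_order G" "\<And>s. s \<noteq> 1 \<Longrightarrow> G s = (s - 1) ^ m * F s"
    using assms unfolding continuation_exponent_def by blast
  obtain A R where R: "\<And>s. R \<le> norm s \<Longrightarrow> norm (G s) \<le> exp (norm s powr A)"
    using G(1) unfolding finite_order_def eventually_at_infinity by blast
  have "norm (F s) \<le> exp (norm s powr A)" if s: "1 \<le> norm (s - 1)" "R \<le> norm s" for s
  proof -
    have "1 * norm (F s) \<le> norm (s - 1) ^ m * norm (F s)"
      using s by (intro mult_right_mono one_le_power) auto
    also have "\<dots> = norm (G s)" using s by (subst G(2)) (auto simp: norm_mult norm_power)
    finally show ?thesis using R[OF s(2)] by simp
  qed
  then show ?thesis by blast
qed

lemma functional_equation_gamma_data:
  "functional_equation F r Q lam mu \<omega> \<Longrightarrow> gamma_data r Q lam \<omega>"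
  unfolding functional_equation_def by unfold_locales auto

text \<open>The polynomial factors of the completed function are invariant under the reflection, so they cancel.\<close>

lemma functional_equation_sparse:
  assumes "functional_equation F r Q lam mu \<omega>"
  shows "\<forall>\<^sub>F s in cosparse UNIV. gamma_factor r Q lam mu s * F s =
    \<omega> * cnj (gamma_factor r Q lam mu (1 - cnj s)) * cnj (F (1 - cnj s))"
proof -
  let ?m = "m_exponent F" and ?\<gamma> = "gamma_factor r Q lam mu"
  have "\<forall>\<^sub>F s in cosparse UNIV. s \<notin> {0, 1 :: complex}"
    unfolding eventually_cosparse by (intro finite_imp_sparse) simp
  moreover have "\<forall>\<^sub>F s in cosparse UNIV. xi_fun F r Q lam mu s = \<omega> * cnj (xi_fun F r Q lam mu (1 - cnj s))"
    using assms unfolding functional_equation_def by blast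
  ultimately show ?thesis
  proof eventually_elim
    case (elim s)
    have "(1 - s) ^ ?m * ((1 - s) - 1) ^ ?m = s ^ ?m * (s - 1) ^ ?m"
      unfolding power_mult_distrib[symmetric] by (simp add: algebra_simps)
    then have e: "(1 - s) ^ ?m * (- s) ^ ?m = s ^ ?m * (s - 1) ^ ?m" by simp
    have "s ^ ?m * (s - 1) ^ ?m * (?\<gamma> s * F s) =
        \<omega> * ((1 - s) ^ ?m * (- s) ^ ?m * (cnj (?\<gamma> (1 - cnj s)) * cnj (F (1 - cnj s))))"
      using elim(2) by (simp add: xi_fun_def mult.assoc)
    also have "\<dots> = s ^ ?m * (s - 1) ^ ?m * (\<omega> * cnj (?\<gamma> (1 - cnj s)) * cnj (F (1 - cnj s)))"
      unfolding e by (simp add: mult_ac)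
    finally show ?case using elim(1) by simp
  qed
qed

text \<open>The functional equation is given only off a sparse set. Above \<open>T0\<close> both
  sides are continuous, so it holds at every point by passing to the limit.\<close>

lemma upper_functional_equationI:
  assumes D: "dirichlet_axiom F" and m: "continuation_exponent F m"
    and fe: "functional_equation F r Q lam mu \<omega>" and nontriv: "r \<noteq> 0 \<or> Q \<noteq> 1"
  shows "upper_functional_equation F (H_fun r Q lam mu \<omega>) (psi_fun r Q lam mu \<omega>)
    (gamma_data.T0 r lam mu) (gamma_degree r lam) (gamma_data.\<psi>_const r Q lam)"
proof -
  interpret gamma_data r Q lam mu \<omega> by (rule functional_equation_gamma_data[OF fe])
  let ?U = "{s. T0 < Im s}"
  have U1: "?U \<subseteq> - {1}" using T0_ge_1 by auto
  have Fh: "F holomorphic_on ?U" by (rule holomorphic_on_subset[OF continuation_holomorphic[OF m] U1])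
  show ?thesis
  proof
    show "1 \<le> T0" by (rule T0_ge_1)
    show "F holomorphic_on ?U" by (rule Fh)
    show "\<psi> holomorphic_on ?U" by (rule \<psi>_holo)
    show "(H has_field_derivative \<psi> s * H s) (at s)" if "T0 < Im s" for s
      using H_deriv'[OF that] \<psi>_eq[OF that] by simp
    show "H s \<noteq> 0" if "T0 < Im s" for s by (rule H_nz[OF that])
    show "norm (H s) = 1" if "T0 < Im s" "Re s = 1 / 2" for s
    proof -
      have "1 - cnj s = s" using that by (simp add: complex_eq_iff)
      then show ?thesis using \<gamma>_nz[OF that(1)] \<omega> by (simp add: H_fun_def norm_divide norm_mult)
    qed
    show "\<psi> (1 - cnj s) = cnj (\<psi> s)" if "T0 < Im s" for s
      using that by (simp add: \<psi>_eq)
    show "F s = H s * cnj (F (1 - cnj s))" if s: "T0 < Im s" for s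
    proof -
      let ?D = "\<lambda>s. F s - H s * cnj (F (1 - cnj s))"
      have Fc: "isCont F s" if "T0 < Im s" for s
        using holomorphic_on_imp_continuous_on[OF Fh] that
        by (simp add: continuous_on_eq_continuous_at open_halfspace_Im_gt)
      have Hc: "isCont H s" using H_deriv'[OF s] by (rule DERIV_isCont)
      have "isCont ?D s"
        by (intro continuous_intros Fc Hc isCont_o2[where g = F]) (use s in auto)
      then have lim: "(?D \<longlongrightarrow> ?D s) (at s)" by (simp add: isCont_def)
      have "\<forall>\<^sub>F w in at s. w \<in> ?U" by (rule eventually_at_in_open') (use s in \<open>auto simp: open_halfspace_Im_gt\<close>)
      moreover have "\<forall>\<^sub>F w in at s. \<gamma> w * F w = \<omega> * cnj (\<gamma> (1 - cnj w)) * cnj (F (1 - cnj w))"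
        by (rule eventually_cosparse_imp_eventually_at[OF functional_equation_sparse[OF fe]]) simp
      ultimately have "\<forall>\<^sub>F w in at s. ?D w = 0"
      proof eventually_elim
        case (elim w)
        then show ?case using \<gamma>_nz[of w] by (simp add: H_fun_def field_simps)
      qed
      then have "(?D \<longlongrightarrow> 0) (at s)" by (simp add: tendsto_eventually)
      with lim have "?D s = 0" by (rule LIM_unique)
      then show ?thesis by simp
    qed
    show "\<exists>C T1. \<forall>s. \<bar>Re s\<bar> \<le> B \<longrightarrow> T1 \<le> Im s \<longrightarrow>
        norm (\<psi> s + of_real (gamma_degree r lam * ln (Im s) + \<psi>_const)) \<le> C / Im s" for B
      by (rule \<psi>_asymp)
    show "\<exists>\<sigma>1. \<forall>s. \<sigma>1 \<le> Re s \<longrightarrow> T0 < Im s \<longrightarrow> norm (F s - 1) \<le> \<epsilon>" if "0 < \<epsilon>" for \<epsilon>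
      using dirichlet_right[OF D that] by blast
    show "\<exists>R A. \<forall>s. T0 < Im s \<longrightarrow> R \<le> norm s \<longrightarrow> norm (F s) \<le> exp (norm s powr A)"
    proof -
      have "1 \<le> norm (s - 1)" if "T0 < Im s" for s
        using abs_Im_le_cmod[of "s - 1"] that T0_ge_1 by simp
      then show ?thesis using continuation_order[OF m] by blast
    qed
    show "0 \<le> gamma_degree r lam"
      unfolding gamma_degree_def by (intro mult_nonneg_nonneg sum_nonneg lam_nonneg) auto
    \<comment> \<open>Any gamma factor makes the degree positive; with none, C0 = 2 ln Q, which is
      nonzero for Q \<noteq> 1.\<close>
    show "gamma_degree r lam \<noteq> 0 \<or> \<psi>_const \<noteq> 0"
    proof (cases "r = 0")
      case True
      then show ?thesis unfolding \<psi>_const_def using nontriv Q by simp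
    next
      case False
      then have "0 < (\<Sum>j=1..r. lam j)" using lam by (intro sum_pos) auto
      then show ?thesis by (simp add: gamma_degree_def)
    qed
  qed
qed

section \<open>Zeros of bounded height and the trivial gamma factor\<close>

text \<open>Gamma is the reciprocal of the entire function \<open>rGamma\<close>. Arbitrary real
  \<open>lam\<close> are allowed because the reflected factor has negative ones.\<close>

lemma gamma_factor_meromorphic: "gamma_factor r Q lam mu meromorphic_on A"
proof -
  have "(\<lambda>s. of_real Q powr s) meromorphic_on A"
  proof -
    have "(\<lambda>s. of_real Q powr s) holomorphic_on UNIV"
      by (intro holomorphic_intros)
    then have "(\<lambda>s. of_real Q powr s) analytic_on A"
      by (meson analytic_on_holomorphic open_UNIV subset_UNIV)
    then show ?thesis by (rule analytic_on_imp_meromorphic_on)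
  qed
  moreover have "(\<lambda>s. \<Prod>j=1..r. Gamma (of_real (lam j) * s + mu j)) meromorphic_on A"
  proof -
    have "(\<lambda>s. rGamma (of_real (lam j) * s + mu j)) analytic_on A" for j
      by (intro analytic_intros)
    then have "(\<lambda>s. \<Prod>j=1..r. inverse (rGamma (of_real (lam j) * s + mu j))) meromorphic_on A"
      by (intro meromorphic_intros analytic_on_imp_meromorphic_on)
    then show ?thesis by (simp add: rGamma_inverse_Gamma)
  qed
  ultimately show ?thesis
    unfolding gamma_factor_def[abs_def] by (rule meromorphic_on_mult)
qed

text \<open>The two conjugations are eliminated so that meromorphy becomes visible: the reflected
  factor is again a gamma factor, with coefficients \<open>- lam j\<close>, up to the quotient that
  corrects the power of Q.\<close>

lemma cnj_gamma_factor_reflect: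
  assumes "Q > 0"
  shows "cnj (gamma_factor r Q lam mu (1 - cnj s)) = gamma_factor r Q (\<lambda>j. - lam j) (\<lambda>j. of_real (lam j) + cnj (mu j)) s
    * (of_real Q powr (1 - s) / of_real Q powr s)"
proof -
  have "cnj (of_real Q powr (1 - cnj s)) = of_real Q powr (1 - s)"
    using assms by (subst cnj_powr) auto
  moreover have "cnj (Gamma (of_real (lam j) * (1 - cnj s) + mu j)) =
      Gamma (of_real (- lam j) * s + (of_real (lam j) + cnj (mu j)))" for j
    by (simp add: cnj_Gamma algebra_simps)
  moreover have "of_real Q powr s \<noteq> (0::complex)" using assms by simp
  ultimately show ?thesis by (simp add: gamma_factor_def)
qed

lemma H_fun_meromorphic:
  assumes "Q > 0"
  shows "H_fun r Q lam mu \<omega> meromorphic_on A"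
proof -
  have *: "(\<lambda>s. of_real Q powr s) meromorphic_on A" "(\<lambda>s. of_real Q powr (1 - s)) meromorphic_on A"
  proof -
    have "(\<lambda>s. of_real Q powr s) holomorphic_on UNIV" "(\<lambda>s. of_real Q powr (1 - s)) holomorphic_on UNIV"
      by (intro holomorphic_intros)+
    then show "(\<lambda>s. of_real Q powr s) meromorphic_on A" "(\<lambda>s. of_real Q powr (1 - s)) meromorphic_on A"
      by (meson analytic_on_holomorphic open_UNIV subset_UNIV analytic_on_imp_meromorphic_on)+
  qed
  show ?thesis
    unfolding H_fun_def[abs_def] cnj_gamma_factor_reflect[OF assms]
    by (intro meromorphic_intros gamma_factor_meromorphic *)
qed

lemma F_iter_meromorphic:
  assumes "F meromorphic_on UNIV" "\<psi> meromorphic_on UNIV"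
  shows "F_iter \<psi> F k meromorphic_on UNIV"
  by (induction k) (auto intro!: meromorphic_intros assms)

text \<open>One nonzero value at a point of continuity excludes f = 0 off a sparse set, so f avoids
  0 off a sparse set. At points of analyticity the limit is the value; hence the points with limit 0
  are sparse, and a compact set contains finitely many.\<close>

lemma meromorphic_zeros_finite:
  assumes f: "f meromorphic_on UNIV" and w: "isCont f w" "f w \<noteq> 0" and K: "compact K"
  shows "finite {\<rho> \<in> K. (f \<longlongrightarrow> 0) (at \<rho>)}" "\<forall>\<^sub>F z in at \<rho>. f z \<noteq> 0"
proof -
  have "\<not> (\<forall>\<^sub>F z in cosparse UNIV. f z = 0)"
  proof
    assume "\<forall>\<^sub>F z in cosparse UNIV. f z = 0"
    then have "\<forall>\<^sub>F z in at w. f z = 0" by (rule eventually_cosparse_imp_eventually_at) simp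
    then have "(f \<longlongrightarrow> 0) (at w)" by (rule tendsto_eventually)
    moreover have "(f \<longlongrightarrow> f w) (at w)" using w by (simp add: isCont_def)
    ultimately have "f w = 0" using LIM_unique by blast
    then show False using w by simp
  qed
  then have nz: "\<forall>\<^sub>F z in cosparse UNIV. f z \<noteq> 0"
    using meromorphic_imp_constant_or_avoid[OF f, of 0] by auto
  then show "\<forall>\<^sub>F z in at \<rho>. f z \<noteq> 0" by (rule eventually_cosparse_imp_eventually_at) simp
  have "\<forall>\<^sub>F z in cosparse UNIV. \<not> (f \<longlongrightarrow> 0) (at z)"
    using nz meromorphic_on_imp_analytic_cosparse[OF f]
  proof eventually_elim
    case (elim z)
    then have "(f \<longlongrightarrow> f z) (at z)" by (metis analytic_at_imp_isCont isCont_def)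
    then show ?case using elim LIM_unique by blast
  qed
  then have "{z. (f \<longlongrightarrow> 0) (at z)} sparse_in UNIV" by (simp add: eventually_cosparse)
  then have "{z. (f \<longlongrightarrow> 0) (at z)} sparse_in K" by (rule sparse_in_subset) simp
  then have "finite (K \<inter> {z. (f \<longlongrightarrow> 0) (at z)})" using K by (rule sparse_in_compact_finite)
  then show "finite {\<rho> \<in> K. (f \<longlongrightarrow> 0) (at \<rho>)}" by (simp add: Int_def)
qed

section \<open>Passing to the full zero count\<close>

lemma zero_count_split:
  assumes f: "f meromorphic_on UNIV" "f holomorphic_on {s. T0 < Im s}" and w: "T0 < Im w" "f w \<noteq> 0"
    and T1: "T0 < T1" "0 \<le> T1" and bot: "\<forall>z. 1 - \<sigma> \<le> Re z \<longrightarrow> Re z \<le> \<sigma> \<longrightarrow> Im z = T1 \<longrightarrow> f z \<noteq> 0"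
  shows "\<exists>n0::nat. \<forall>T\<ge>T1. real (zero_count f \<sigma> T) = real n0 +
    of_int (\<Sum>\<rho> | 1 - \<sigma> < Re \<rho> \<and> Re \<rho> < \<sigma> \<and> T1 < Im \<rho> \<and> Im \<rho> < T \<and> f \<rho> = 0. zorder f \<rho>)"
proof -
  have U: "open {s. T0 < Im s}" by (rule open_halfspace_Im_gt)
  have cont: "isCont f z" if "T0 < Im z" for z
    using holomorphic_on_imp_continuous_on[OF f(2)] that U by (simp add: continuous_on_eq_continuous_at)
  note fin = meromorphic_zeros_finite[OF f(1) cont[OF w(1)] w(2)]
  have zero_iff: "(f \<longlongrightarrow> 0) (at z) \<longleftrightarrow> f z = 0" if "T0 < Im z" for z
  proof -
    have "(f \<longlongrightarrow> f z) (at z)" using cont[OF that] by (simp add: isCont_def)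
    then show ?thesis using LIM_unique by metis
  qed
  \<comment> \<open>The zeros up to height T1, where singularities of f may occur; their
    contribution is the constant \<open>n0\<close>, the same for all T.\<close>
  define A where "A = {\<rho>. 1 - \<sigma> < Re \<rho> \<and> Re \<rho> < \<sigma> \<and> 0 < Im \<rho> \<and> Im \<rho> \<le> T1 \<and> (f \<longlongrightarrow> 0) (at \<rho>)}"
  have "real (zero_count f \<sigma> T) = real (\<Sum>\<rho>\<in>A. nat (zorder f \<rho>)) +
    of_int (\<Sum>\<rho> | 1 - \<sigma> < Re \<rho> \<and> Re \<rho> < \<sigma> \<and> T1 < Im \<rho> \<and> Im \<rho> < T \<and> f \<rho> = 0. zorder f \<rho>)"
    if T: "T1 \<le> T" for T
  proof -
    define Z where "Z = {\<rho>. 1 - \<sigma> < Re \<rho> \<and> Re \<rho> < \<sigma> \<and> T1 < Im \<rho> \<and> Im \<rho> < T \<and> f \<rho> = 0}"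
    let ?K = "cbox (Complex (1 - \<sigma>) 0) (Complex \<sigma> T)"
    have finK: "finite {\<rho> \<in> ?K. (f \<longlongrightarrow> 0) (at \<rho>)}" by (rule fin(1)[OF compact_cbox])
    have "A \<subseteq> {\<rho> \<in> ?K. (f \<longlongrightarrow> 0) (at \<rho>)}" using T by (auto simp: A_def in_cbox_complex_iff)
    then have fA: "finite A" using finK finite_subset by blast
    have "Z \<subseteq> {\<rho> \<in> ?K. (f \<longlongrightarrow> 0) (at \<rho>)}"
      using T T1 zero_iff by (auto simp: Z_def in_cbox_complex_iff)
    then have fZ: "finite Z" using finK finite_subset by blast
    have eq: "{\<rho>. 1 - \<sigma> < Re \<rho> \<and> Re \<rho> < \<sigma> \<and> 0 < Im \<rho> \<and> Im \<rho> < T \<and> (f \<longlongrightarrow> 0) (at \<rho>)} = A \<union> Z"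
    proof (intro set_eqI)
      fix \<rho>
      have "\<not> (f \<longlongrightarrow> 0) (at \<rho>)" if "1 - \<sigma> < Re \<rho>" "Re \<rho> < \<sigma>" "Im \<rho> = T1"
        using zero_iff[of \<rho>] bot that T1 by simp
      then show "\<rho> \<in> {\<rho>. 1 - \<sigma> < Re \<rho> \<and> Re \<rho> < \<sigma> \<and> 0 < Im \<rho> \<and> Im \<rho> < T \<and> (f \<longlongrightarrow> 0) (at \<rho>)} \<longleftrightarrow> \<rho> \<in> A \<union> Z"
        using T T1 zero_iff[of \<rho>] unfolding A_def Z_def by (cases "Im \<rho>" T1 rule: linorder_cases) auto
    qed
    have "zero_count f \<sigma> T = (\<Sum>\<rho>\<in>A. nat (zorder f \<rho>)) + (\<Sum>\<rho>\<in>Z. nat (zorder f \<rho>))"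
      unfolding zero_count_def eq by (rule sum.union_disjoint[OF fA fZ]) (auto simp: A_def Z_def)
    moreover have "int (\<Sum>\<rho>\<in>Z. nat (zorder f \<rho>)) = (\<Sum>\<rho>\<in>Z. zorder f \<rho>)"
    proof -
      \<comment> \<open>Above T1 the function is analytic and not locally zero, so the truncation
        \<open>nat\<close> in \<open>zero_count\<close> loses nothing.\<close>
      have "zorder f \<rho> \<ge> 0" if "\<rho> \<in> Z" for \<rho>
      proof (rule zorder_ge_0)
        show "f analytic_on {\<rho>}"
          using f(2) U that T1 by (auto simp: analytic_at Z_def)
        show "\<exists>\<^sub>F z in at \<rho>. f z \<noteq> 0"
          by (rule eventually_frequently[OF _ fin(2)[OF compact_empty]]) simp
      qed
      then show ?thesis by simp
    qed
    ultimately have "int (zero_count f \<sigma> T) = int (\<Sum>\<rho>\<in>A. nat (zorder f \<rho>)) + (\<Sum>\<rho>\<in>Z. zorder f \<rho>)" by simp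
    then have "real_of_int (int (zero_count f \<sigma> T)) = real_of_int (int (\<Sum>\<rho>\<in>A. nat (zorder f \<rho>)) + (\<Sum>\<rho>\<in>Z. zorder f \<rho>))"
      by (rule arg_cong)
    then show ?thesis unfolding Z_def by (simp only: of_int_of_nat_eq of_int_add)
  qed
  then show ?thesis by blast
qed

text \<open>If the gamma factor is constant, then \<open>F\<close> extends to a bounded entire function.\<close>

lemma trivial_gamma_factor_imp_one:
  assumes D: "dirichlet_axiom F" and m: "continuation_exponent F m"
    and fe: "functional_equation F 0 1 lam mu \<omega>" and s: "s \<noteq> 1"
  shows "F s = 1"
proof -
  have \<omega>: "norm \<omega> = 1" using fe by (simp add: functional_equation_def)
  have Fh: "F holomorphic_on - {1}" by (rule continuation_holomorphic[OF m])
  have Fc: "isCont F z" if "z \<noteq> 1" for z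
    using holomorphic_on_imp_continuous_on[OF Fh] that by (simp add: continuous_on_eq_continuous_at open_Compl)
  have FE: "F z = \<omega> * cnj (F (1 - cnj z))" if "z \<noteq> 0" "z \<noteq> 1" for z
  proof -
    let ?D = "\<lambda>z. F z - \<omega> * cnj (F (1 - cnj z))"
    have "1 - cnj z \<noteq> 1" using that by simp
    then have "isCont ?D z"
      by (intro continuous_intros Fc isCont_o2[where g = F]) (use that in auto)
    then have lim: "(?D \<longlongrightarrow> ?D z) (at z)" by (simp add: isCont_def)
    have "\<forall>\<^sub>F w in cosparse UNIV. ?D w = 0"
      using functional_equation_sparse[OF fe] by (simp add: gamma_factor_def)
    then have "\<forall>\<^sub>F w in at z. ?D w = 0" by (rule eventually_cosparse_imp_eventually_at) simp
    then have "(?D \<longlongrightarrow> 0) (at z)" by (rule tendsto_eventually)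
    with lim have "?D z = 0" by (rule LIM_unique)
    then show ?thesis by simp
  qed
  \<comment> \<open>At 1 the functional equation predicts the value through F 0, which is finite; so
    the possible pole at 1 is removable.\<close>
  define E where "E = (\<lambda>z. if z = 1 then \<omega> * cnj (F 0) else F z)"
  have Eh: "E holomorphic_on UNIV"
  proof (rule no_isolated_singularity'[where K = "{1}"])
    have "E holomorphic_on - {1} \<longleftrightarrow> F holomorphic_on - {1}"
      by (rule holomorphic_cong) (auto simp: E_def)
    then show "E holomorphic_on UNIV - {1}" using Fh by (simp add: Compl_eq_Diff_UNIV)
    have "isCont (\<lambda>z::complex. 1 - cnj z) 1" by (intro continuous_intros)
    moreover have "isCont F (1 - cnj 1)" using Fc[of 0] by simp
    ultimately have "isCont (\<lambda>z. F (1 - cnj z)) 1" by (rule isCont_o2)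
    then have "isCont (\<lambda>z. \<omega> * cnj (F (1 - cnj z))) 1" by (intro continuous_intros)
    then have "((\<lambda>z. \<omega> * cnj (F (1 - cnj z))) \<longlongrightarrow> \<omega> * cnj (F 0)) (at 1)"
      by (simp add: isCont_def)
    moreover have "\<forall>\<^sub>F z in at 1. \<omega> * cnj (F (1 - cnj z)) = E z"
    proof -
      have "\<forall>\<^sub>F z in at (1::complex). z \<in> - {0} - {1}"
        by (rule eventually_at_in_open) auto
      then show ?thesis
      proof eventually_elim
        case (elim z)
        then have "z \<noteq> 0" "z \<noteq> 1" by auto
        then show ?case unfolding E_def using FE[of z] by simp
      qed
    qed
    ultimately have "(E \<longlongrightarrow> \<omega> * cnj (F 0)) (at 1)" by (rule Lim_transform_eventually)
    then show "(E \<longlongrightarrow> E z) (at z within UNIV)" if "z \<in> {1}" for z using that by (simp add: E_def)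
  qed auto
  obtain b where b: "2 \<le> b" "\<And>z. b \<le> Re z \<Longrightarrow> norm (F z - 1) \<le> 1"
    using dirichlet_right[OF D, of 1] by auto
  have right: "norm (E z) \<le> 2" if "b \<le> Re z" for z
  proof -
    have "z \<noteq> 1" using that b by auto
    then show ?thesis using b(2)[OF that] norm_triangle_ineq[of "F z - 1" 1] by (simp add: E_def)
  qed
  have left: "norm (E z) \<le> 2" if "Re z \<le> 1 - b" for z
  proof -
    have "b \<le> Re (1 - cnj z)" using that by simp
    then have "norm (E (1 - cnj z)) \<le> 2" by (rule right)
    moreover have "z \<noteq> 0" "z \<noteq> 1" using that b by auto
    moreover from this have "norm (F z) = norm (F (1 - cnj z))"
      using \<omega> by (subst FE) (simp_all add: norm_mult)
    ultimately show ?thesis by (simp add: E_def)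
  qed
  obtain R A where RA: "\<And>z. 1 \<le> norm (z - 1) \<Longrightarrow> R \<le> norm z \<Longrightarrow> norm (F z) \<le> exp (norm z powr A)"
    using continuation_order[OF m] by blast
  have Eord: "norm (E z) \<le> exp (norm z powr A)" if "max R 2 \<le> norm z" for z
  proof -
    have "1 \<le> norm (z - 1)" using that norm_triangle_ineq2[of z 1] by simp
    moreover have "z \<noteq> 1" using that by auto
    ultimately show ?thesis using RA[of z] that by (simp add: E_def)
  qed
  let ?K = "cbox (Complex (1 - b) 0) (Complex b 0)"
  have "bounded (E ` ?K)"
    by (intro compact_imp_bounded compact_continuous_image holomorphic_on_imp_continuous_on
        holomorphic_on_subset[OF Eh]) auto
  then obtain C0 where C0: "\<And>z. z \<in> ?K \<Longrightarrow> norm (E z) \<le> C0" by (auto simp: bounded_iff)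
  define C where "C = max C0 2"
  have upper: "norm (E' z) \<le> C"
    \<comment> \<open>The half-strip principle covers heights above 0. The half-turn
      \<open>z \<mapsto> 1 - z\<close> preserves the strip and exchanges its upper and lower
      halves.\<close>
    if E': "E' = E \<or> E' = (\<lambda>z. E (1 - z))" and z: "1 - b \<le> Re z" "Re z \<le> b" "0 \<le> Im z" for E' z
  proof (rule phragmen_lindelof_half_strip[where f = E' and S = UNIV and a = "1 - b" and b = b and ?t0.0 = 0 and R = "max R 2 + 1" and A = "2 * \<bar>A\<bar>"])
    have "(\<lambda>z. 1 - z) holomorphic_on UNIV" by (intro holomorphic_intros)
    then have "(\<lambda>z. E (1 - z)) holomorphic_on UNIV"
      using holomorphic_on_compose_gen[OF _ Eh, of "\<lambda>z. 1 - z" UNIV] by (simp add: o_def)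
    then show "E' holomorphic_on UNIV" using E' Eh by auto
    show "norm (E' z) \<le> C" if "1 - b \<le> Re z" "Re z \<le> b" "0 \<le> Im z" "Re z = 1 - b \<or> Re z = b \<or> Im z = 0" for z
      using that E' left[of z] right[of z] left[of "1 - z"] right[of "1 - z"] C0[of z] C0[of "1 - z"]
      by (auto simp: C_def in_cbox_complex_iff)
    show "norm (E' z) \<le> exp (norm z powr (2 * \<bar>A\<bar>))" if z: "max R 2 + 1 \<le> norm z" for z
    proof -
      \<comment> \<open>|1 - z| may exceed |z|, but it is at most |z|^2 here; this explains the
        doubled exponent, and the absolute value covers a negative A.\<close>
      have le: "norm (E u) \<le> exp (norm z powr (2 * \<bar>A\<bar>))"
        if u: "max R 2 \<le> norm u" "norm u \<le> norm z ^ 2" for u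
      proof -
        have "norm u powr A \<le> norm u powr \<bar>A\<bar>" using u by (intro powr_mono) auto
        also have "\<dots> \<le> (norm z ^ 2) powr \<bar>A\<bar>" using u by (intro powr_mono2) auto
        also have "norm z ^ 2 = norm z powr 2" using z by simp
        also have "(norm z powr 2) powr \<bar>A\<bar> = norm z powr (2 * \<bar>A\<bar>)" by (rule powr_powr)
        finally have "norm u powr A \<le> norm z powr (2 * \<bar>A\<bar>)" .
        with Eord[OF u(1)] show ?thesis by (meson exp_le_cancel_iff order_trans)
      qed
      have "2 * norm z \<le> norm z ^ 2" unfolding power2_eq_square using z by (intro mult_right_mono) auto
      then have "norm z \<le> norm z ^ 2" "1 + norm z \<le> norm z ^ 2" using z by auto
      moreover have "max R 2 \<le> norm (1 - z)" "norm (1 - z) \<le> 1 + norm z"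
        using z norm_triangle_ineq2[of z 1] norm_triangle_ineq4[of 1 z] by (auto simp: norm_minus_commute)
      ultimately have "max R 2 \<le> norm (1 - z)" "norm (1 - z) \<le> norm z ^ 2" "max R 2 \<le> norm z" "norm z \<le> norm z ^ 2"
        using z by auto
      then show ?thesis using E' le[of z] le[of "1 - z"] by auto
    qed
  qed (use b z in \<open>auto simp: C_def\<close>)
  have bound: "norm (E z) \<le> C" for z
  proof -
    consider "Re z \<le> 1 - b" | "b \<le> Re z" | "1 - b \<le> Re z" "Re z \<le> b" by linarith
    then show ?thesis
    proof cases
      case 1 then show ?thesis using left[of z] by (simp add: C_def)
    next
      case 2 then show ?thesis using right[of z] by (simp add: C_def)
    next
      case 3
      show ?thesis
      proof (cases "0 \<le> Im z")
        case True
        then show ?thesis using upper[of E z] 3 by simp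
      next
        case False
        then show ?thesis using upper[of "\<lambda>z. E (1 - z)" "1 - z"] 3 by simp
      qed
    qed
  qed
  then have "bounded (range E)" by (auto simp: bounded_iff)
  then obtain c where c: "\<And>z. E z = c"
    using Liouville_theorem[OF Eh] by (auto simp: constant_on_def)
  \<comment> \<open>The constant is identified by the limit 1 of the Dirichlet series to the
    right.\<close>
  have "norm (c - 1) \<le> \<epsilon>" if "\<epsilon> > 0" for \<epsilon>
  proof -
    obtain \<sigma>1 where \<sigma>1: "2 \<le> \<sigma>1" "\<And>z. \<sigma>1 \<le> Re z \<Longrightarrow> norm (F z - 1) \<le> \<epsilon>"
      using dirichlet_right[OF D \<open>\<epsilon> > 0\<close>] by blast
    have "norm (F (of_real \<sigma>1) - 1) \<le> \<epsilon>" by (rule \<sigma>1(2)) simp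
    moreover have "F (of_real \<sigma>1) = c" using c[of "of_real \<sigma>1"] \<sigma>1(1) by (simp add: E_def split: if_splits)
    ultimately show ?thesis by simp
  qed
  then have "norm (c - 1) \<le> 0" by (rule field_le_epsilon) simp
  then have "c = 1" by simp
  then show ?thesis using c[of s] s by (simp add: E_def)
qed

text \<open>For k = 0 there are no zeros. For k \<ge> 1 the function vanishes off 1, so every point
  of the rectangle counts as a zero; the index set is empty or infinite, and the sum is 0 by
  convention in the infinite case.\<close>

lemma zero_count_trivial_gamma_factor:
  assumes F: "\<And>s. s \<noteq> 1 \<Longrightarrow> F s = 1" and \<sigma>: "1 \<le> \<sigma>"
  shows "zero_count (F_iter (psi_fun 0 1 lam mu \<omega>) F k) \<sigma> T = 0"
proof (cases k)
  case 0
  have "\<not> (F \<longlongrightarrow> 0) (at \<rho>)" for \<rho>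
  proof -
    have "\<forall>\<^sub>F z in at \<rho>. z \<noteq> 1" by (rule eventually_neq_at_within)
    then have "\<forall>\<^sub>F z in at \<rho>. F z = 1" by eventually_elim (use F in auto)
    then have "(F \<longlongrightarrow> 1) (at \<rho>)" by (rule tendsto_eventually)
    then show ?thesis using LIM_unique[of F 1 \<rho> 0] by auto
  qed
  then show ?thesis using 0 by (simp add: zero_count_def)
next
  case (Suc l)
  have \<psi>: "psi_fun 0 1 lam mu \<omega> s = 0" for s
    by (simp add: psi_fun_def H_fun_def[abs_def] gamma_factor_def)
  have d0: "deriv g s = 0" if "\<And>s. s \<noteq> 1 \<Longrightarrow> g s = c" "s \<noteq> 1" for g s and c :: complex
  proof -
    have "((\<lambda>_. c) has_field_derivative 0) (at s)" by simp
    then have "(g has_field_derivative 0) (at s)"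
      by (rule has_field_derivative_transform_within_open[of _ _ _ "- {1}"]) (use that in auto)
    then show ?thesis by (rule DERIV_imp_deriv)
  qed
  have z: "F_iter (psi_fun 0 1 lam mu \<omega>) F (Suc l) s = 0" if "s \<noteq> 1" for l s
    using that
  proof (induction l arbitrary: s)
    case 0
    then show ?case using d0[of F 1 s] F \<psi> by simp
  next
    case (Suc l)
    let ?G = "F_iter (psi_fun 0 1 lam mu \<omega>) F (Suc l)"
    have "deriv ?G s = 0" by (rule d0[OF Suc.IH Suc.prems])
    then show ?case unfolding F_iter.simps(2)[of _ _ "Suc l"] \<psi> by simp
  qed
  have lim: "(F_iter (psi_fun 0 1 lam mu \<omega>) F k \<longlongrightarrow> 0) (at \<rho>)" for \<rho>
  proof -
    have "\<forall>\<^sub>F z in at \<rho>. z \<noteq> 1" by (rule eventually_neq_at_within)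
    then have "\<forall>\<^sub>F s in at \<rho>. F_iter (psi_fun 0 1 lam mu \<omega>) F k s = 0"
      by eventually_elim (use z Suc in auto)
    then show ?thesis by (rule tendsto_eventually)
  qed
  let ?S = "{\<rho>. 1 - \<sigma> < Re \<rho> \<and> Re \<rho> < \<sigma> \<and> 0 < Im \<rho> \<and> Im \<rho> < T}"
  have disj: "?S = {} \<or> infinite ?S"
  proof (cases "0 < T")
    case True
    \<comment> \<open>\<sigma> \<ge> 1 puts the critical line inside the strip, which makes the
      rectangle infinite.\<close>
    have "Complex (1 / 2) ` {0<..<T} \<subseteq> ?S" using \<sigma> by auto
    moreover have "infinite (Complex (1 / 2) ` {0<..<T})"
      using True by (subst finite_image_iff) (auto simp: inj_on_def)
    ultimately show ?thesis using finite_subset by blast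
  qed auto
  have "zero_count (F_iter (psi_fun 0 1 lam mu \<omega>) F k) \<sigma> T =
      (\<Sum>\<rho>\<in>?S. nat (zorder (F_iter (psi_fun 0 1 lam mu \<omega>) F k) \<rho>))"
    unfolding zero_count_def by (simp add: lim)
  also have "\<dots> = 0" using disj
  proof
    assume e: "?S = {}"
    show ?thesis unfolding e by simp
  next
    assume "infinite ?S"
    then show ?thesis by (rule sum.infinite)
  qed
  finally show ?thesis .
qed

text \<open>For a constant gamma factor both coefficients and the count are 0, so the formula holds
  exactly. Otherwise the count above T1 is completed by the constant \<open>n0\<close> of
  \<open>zero_count_split\<close>.\<close>

lemma zero_count_asymptotics:
  assumes D: "dirichlet_axiom F" and m: "continuation_exponent F m"
    and fe: "functional_equation F r Q lam mu \<omega>"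
  shows "\<exists>\<sigma>0>0. \<forall>\<sigma>\<ge>\<sigma>0. (\<lambda>T. real (zero_count (F_iter (psi_fun r Q lam mu \<omega>) F k) \<sigma> T)
    - (gamma_degree r lam / (2 * pi) * T * ln T +
       (gamma_data.\<psi>_const r Q lam - gamma_degree r lam) / (2 * pi) * T)) \<in> O[at_top](\<lambda>T. ln T)"
proof (cases "r = 0 \<and> Q = 1")
  case True
  have "F s = 1" if "s \<noteq> 1" for s
    using trivial_gamma_factor_imp_one[OF D m _ that] fe True by blast
  moreover have "gamma_data.\<psi>_const r Q lam = 0" "gamma_degree r lam = 0"
    using True gamma_data.\<psi>_const_def[OF functional_equation_gamma_data[OF fe]]
    by (simp_all add: gamma_degree_def)
  ultimately show ?thesis using zero_count_trivial_gamma_factor[of F] True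
    by (intro exI[of _ 1]) simp
next
  case False
  interpret gamma_data r Q lam mu \<omega> by (rule functional_equation_gamma_data[OF fe])
  interpret upper_functional_equation F H \<psi> T0 "gamma_degree r lam" \<psi>_const
    by (rule upper_functional_equationI[OF D m fe]) (use False in auto)
  have mero: "Fk k meromorphic_on UNIV"
    by (intro F_iter_meromorphic continuation_meromorphic[OF m])
      (auto simp: psi_fun_def[abs_def] intro!: meromorphic_intros H_fun_meromorphic Q)
  obtain \<sigma>0 where \<sigma>0: "1 \<le> \<sigma>0" "\<forall>\<sigma>\<ge>\<sigma>0. \<exists>T1>T0. \<exists>K T2. (\<exists>w. T0 < Im w \<and> Fk k w \<noteq> 0) \<and>
    (\<forall>z. 1 - \<sigma> \<le> Re z \<longrightarrow> Re z \<le> \<sigma> \<longrightarrow> Im z = T1 \<longrightarrow> Fk k z \<noteq> 0) \<and>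
    (\<forall>T\<ge>T2. \<bar>of_int (\<Sum>\<rho> | 1 - \<sigma> < Re \<rho> \<and> Re \<rho> < \<sigma> \<and> T1 < Im \<rho> \<and> Im \<rho> < T \<and> Fk k \<rho> = 0. zorder (Fk k) \<rho>)
      - main_term T\<bar> \<le> K * ln T)"
    using zero_count_upper[of k] by blast
  have "(\<lambda>T. real (zero_count (Fk k) \<sigma> T) - main_term T) \<in> O[at_top](\<lambda>T. ln T)" if \<sigma>: "\<sigma>0 \<le> \<sigma>" for \<sigma>
  proof -
    obtain T1 K T2 w where T1: "T0 < T1" and w: "T0 < Im w" "Fk k w \<noteq> 0"
      and bot: "\<forall>z. 1 - \<sigma> \<le> Re z \<longrightarrow> Re z \<le> \<sigma> \<longrightarrow> Im z = T1 \<longrightarrow> Fk k z \<noteq> 0"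
      and K': "\<forall>T\<ge>T2. \<bar>of_int (\<Sum>\<rho> | 1 - \<sigma> < Re \<rho> \<and> Re \<rho> < \<sigma> \<and> T1 < Im \<rho> \<and> Im \<rho> < T \<and> Fk k \<rho> = 0. zorder (Fk k) \<rho>)
        - main_term T\<bar> \<le> K * ln T"
      using \<sigma>0(2)[rule_format, OF \<sigma>] by (elim exE conjE) (rule that)
    note K = K'[rule_format]
    have "0 \<le> T1" using T1 T0_ge_1 by simp
    from zero_count_split[OF mero Fk_holo w T1 this bot] obtain n0 where
      n0': "\<forall>T\<ge>T1. real (zero_count (Fk k) \<sigma> T) = real n0 +
        of_int (\<Sum>\<rho> | 1 - \<sigma> < Re \<rho> \<and> Re \<rho> < \<sigma> \<and> T1 < Im \<rho> \<and> Im \<rho> < T \<and> Fk k \<rho> = 0. zorder (Fk k) \<rho>)"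
      by (elim exE)
    note n0 = n0'[rule_format]
    show ?thesis
    proof (rule bigoI[where c = "real n0 + \<bar>K\<bar>"])
      show "\<forall>\<^sub>F T in at_top. norm (real (zero_count (Fk k) \<sigma> T) - main_term T) \<le> (real n0 + \<bar>K\<bar>) * norm (ln T)"
        using eventually_ge_at_top[of "max (max T1 T2) 3"]
      proof eventually_elim
        case (elim T)
        then have t: "T1 \<le> T" "T2 \<le> T" "3 \<le> T" by auto
        have "exp 1 \<le> T" using exp_le t by linarith
        then have l1: "1 \<le> ln T" using t by (subst ln_ge_iff) auto
        have "\<bar>real (zero_count (Fk k) \<sigma> T) - main_term T\<bar> \<le> real n0 + K * ln T"
          using K[OF t(2)] n0[OF t(1)] by linarith
        also have "real n0 \<le> real n0 * ln T" using mult_left_mono[OF l1, of "real n0"] by simp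
        also have "K * ln T \<le> \<bar>K\<bar> * ln T" using l1 by (intro mult_right_mono) auto
        finally show ?case using l1 by (simp add: distrib_right)
      qed
    qed
  qed
  then show ?thesis using \<sigma>0(1)
    by (intro exI[of _ \<sigma>0]) (auto simp: main_term_def)
qed

section \<open>Independence of the constant from the functional equation\<close>

lemma log_linear_coeffs_zero:
  fixes a b :: real
  assumes "(\<lambda>T. a * T * ln T + b * T) \<in> O[at_top](\<lambda>T. ln T)"
  shows "a = 0" "b = 0"
proof -
  have "(\<lambda>T::real. ln T) \<in> o[at_top](\<lambda>T. T * ln T)" by real_asymp
  with assms have "(\<lambda>T. a * T * ln T + b * T) \<in> o[at_top](\<lambda>T. T * ln T)" by (rule landau_o.big_small_trans)
  then have "((\<lambda>T. (a * T * ln T + b * T) / (T * ln T)) \<longlongrightarrow> 0) at_top" by (rule smalloD_tendsto)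
  moreover have "((\<lambda>T. (a * T * ln T + b * T) / (T * ln T)) \<longlongrightarrow> a) at_top" by real_asymp
  ultimately show a: "a = 0" using tendsto_unique[OF trivial_limit_at_top_linorder] by blast
  have "(\<lambda>T::real. ln T) \<in> o[at_top](\<lambda>T. T)" by real_asymp
  with assms have "(\<lambda>T. a * T * ln T + b * T) \<in> o[at_top](\<lambda>T. T)" by (rule landau_o.big_small_trans)
  then have "((\<lambda>T. (a * T * ln T + b * T) / T) \<longlongrightarrow> 0) at_top" by (rule smalloD_tendsto)
  moreover have "((\<lambda>T. (a * T * ln T + b * T) / T) \<longlongrightarrow> b) at_top" unfolding a by real_asymp
  ultimately show "b = 0" using tendsto_unique[OF trivial_limit_at_top_linorder] by blast
qed

theorem theorem1p2:
  fixes F :: "complex \<Rightarrow> complex"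
  assumes "F \<in> extended_Selberg_class"
  shows "\<exists>c::real. \<forall>r Q lam mu \<omega>. functional_equation F r Q lam mu \<omega> \<longrightarrow>
           (\<forall>k::nat. \<exists>\<sigma>0>0. \<forall>\<sigma>\<ge>\<sigma>0.
              (\<lambda>T::real. real (zero_count (F_iter (psi_fun r Q lam mu \<omega>) F k) \<sigma> T)
                  - (gamma_degree r lam / (2 * pi) * T * ln T + c * T)) \<in> O[at_top](\<lambda>T. ln T))"
proof -
  obtain m r0 Q0 lam0 mu0 \<omega>0 where D: "dirichlet_axiom F" and m: "continuation_exponent F m"
    and fe0: "functional_equation F r0 Q0 lam0 mu0 \<omega>0"
    using assms unfolding extended_Selberg_class_def by blast
  define c where "c = (\<lambda>r Q lam. (gamma_data.\<psi>_const r Q lam - gamma_degree r lam) / (2 * pi))"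
  have asym: "\<exists>\<sigma>0>0. \<forall>\<sigma>\<ge>\<sigma>0. (\<lambda>T. real (zero_count (F_iter (psi_fun r Q lam mu \<omega>) F k) \<sigma> T)
      - (gamma_degree r lam / (2 * pi) * T * ln T + c r Q lam * T)) \<in> O[at_top](\<lambda>T. ln T)"
    if "functional_equation F r Q lam mu \<omega>" for r Q lam mu \<omega> k
    unfolding c_def by (rule zero_count_asymptotics[OF D m that])
  have c_unique: "c r Q lam = c r0 Q0 lam0" if fe: "functional_equation F r Q lam mu \<omega>" for r Q lam mu \<omega>
  proof -
    \<comment> \<open>For k = 0 the counted function is F itself, which does not involve
      \<open>\<psi>\<close>. So two functional equations give two expansions of one and the same
      count, once a common abscissa is taken.\<close>
    obtain \<sigma>1 \<sigma>2 where
      1: "\<forall>\<sigma>\<ge>\<sigma>1. (\<lambda>T. real (zero_count F \<sigma> T) - (gamma_degree r lam / (2 * pi) * T * ln T + c r Q lam * T)) \<in> O[at_top](\<lambda>T. ln T)" and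
      2: "\<forall>\<sigma>\<ge>\<sigma>2. (\<lambda>T. real (zero_count F \<sigma> T) - (gamma_degree r0 lam0 / (2 * pi) * T * ln T + c r0 Q0 lam0 * T)) \<in> O[at_top](\<lambda>T. ln T)"
      using asym[OF fe, of 0] asym[OF fe0, of 0] by auto
    let ?\<sigma> = "max \<sigma>1 \<sigma>2"
    have "(\<lambda>T. (real (zero_count F ?\<sigma> T) - (gamma_degree r lam / (2 * pi) * T * ln T + c r Q lam * T))
        - (real (zero_count F ?\<sigma> T) - (gamma_degree r0 lam0 / (2 * pi) * T * ln T + c r0 Q0 lam0 * T))) \<in> O[at_top](\<lambda>T. ln T)"
      by (rule sum_in_bigo(2)) (use 1 2 in auto)
    also have "(\<lambda>T. (real (zero_count F ?\<sigma> T) - (gamma_degree r lam / (2 * pi) * T * ln T + c r Q lam * T))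
        - (real (zero_count F ?\<sigma> T) - (gamma_degree r0 lam0 / (2 * pi) * T * ln T + c r0 Q0 lam0 * T)))
      = (\<lambda>T. (gamma_degree r0 lam0 / (2 * pi) - gamma_degree r lam / (2 * pi)) * T * ln T + (c r0 Q0 lam0 - c r Q lam) * T)"
      by (simp add: fun_eq_iff algebra_simps)
    finally show ?thesis by (auto dest: log_linear_coeffs_zero(2))
  qed
  show ?thesis
  proof (rule exI[of _ "c r0 Q0 lam0"], intro allI impI)
    fix r Q lam mu \<omega> k
    assume fe: "functional_equation F r Q lam mu \<omega>"
    show "\<exists>\<sigma>0>0. \<forall>\<sigma>\<ge>\<sigma>0. (\<lambda>T. real (zero_count (F_iter (psi_fun r Q lam mu \<omega>) F k) \<sigma> T)
        - (gamma_degree r lam / (2 * pi) * T * ln T + c r0 Q0 lam0 * T)) \<in> O[at_top](\<lambda>T. ln T)"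
      using asym[OF fe, of k] unfolding c_unique[OF fe] .
  qed
qed

end
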